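(* Let $\Omega\subset\mathbb{C}$ be a domain, let $N\ge 2$ be an integer, and let $g:\overline{\Omega}\times\Omega\to\mathbb{R}$ be of class $C^2$ and symmetric ($g(w,z)=g(z,w)$ for all $w,z\in\Omega$). Define $h:\Omega\to\mathbb{R}$, $h(z)=g(z,z)$, and on $\{z=(z_1,\dots,z_N)\in\Omega^N: z_j\ne z_k\text{ for } j\ne k\}$ define \[ H_\Omega(z)=\frac1{2\pi}\sum_{\substack{j,k=1\\ j\ne k}}^N\log\frac1{|z_j-z_k|}-\sum_{\substack{j,k=1\\ j\ne k}}^N g(z_j,z_k)-\sum_{k=1}^N g(z_k,z_k). \] Consider the Hamiltonian system \[ \dot z_k(t)=-i\nabla_{z_k}H_\Omega(z(t)),\qquad k=1,\dots,N. \tag{HS} \] If $a_0\in\Omega$ is a stable critical point of $h$, then there exists $r_0>0$ such that for each $0<r\le r_0$, (HS) has a periodic solution $z^r=(z^r_1,\dots,z^r_N)$ with minimal period $T_r=4\pi^2r^2/(N-1)$ such that $z^r_k(t)=z^r_1(t+(k-1)T_r/N)$ for every $k=1,\dots,N$. Moreover, there exist $a_r\in\Omega$ with $a_r\to a_0$ as $r\to 0$ such that the rescaled function \[ u^r_1(t):=\frac1r\big(z^r_1(T_rt/2\pi)-a_r\big) \] satisfies $u^r_1\to u_0$, where $u_0(t)=e^{it}$, in $H^1(\mathbb{R}/2\pi\mathbb{Z},\mathbb{C})$ as $r\to0$.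
   Context: Here $\mathbb{C}$ is identified with $\mathbb{R}^2$, $i$ is the imaginary unit and $\nabla_{z_k}$ denotes the (real) gradient with respect to the $k$-th complex variable. A critical point $a\in\Omega$ of $h$ with $h(a)=c$ is called stable if it is an isolated critical point and its critical group $H_*(h^c,h^c\setminus\{a\})$ is nontrivial, where $h^c=\{z\in\Omega: h(z)\le c\}$ and $H_*$ denotes (singular) homology. $H^1(\mathbb{R}/2\pi\mathbb{Z},\mathbb{C})$ is the Sobolev space of $2\pi$-periodic absolutely continuous functions with square integrable derivative. *)

theory Defs
  imports "HOL-Analysis.Analysis" "HOL-Homology.Homology"
begin

(* C^2 on a set S (possibly non-open, e.g. closure Omega \<times> Omega):
   twice Frechet differentiable on the interior of S, and g together with its first and
   second derivatives extends continuously to all of S. *)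
definition C2_upto :: "('a::euclidean_space) set \<Rightarrow> ('a \<Rightarrow> real) \<Rightarrow> bool" where
  "C2_upto S g \<longleftrightarrow>
     (\<exists>g1 :: 'a \<Rightarrow> ('a \<Rightarrow>\<^sub>L real). \<exists>g2 :: 'a \<Rightarrow> ('a \<Rightarrow>\<^sub>L ('a \<Rightarrow>\<^sub>L real)).
        (\<forall>x\<in>interior S. (g has_derivative blinfun_apply (g1 x)) (at x)) \<and>
        (\<forall>x\<in>interior S. (g1 has_derivative blinfun_apply (g2 x)) (at x)) \<and>
        continuous_on S g \<and> continuous_on S g1 \<and> continuous_on S g2)"

definition sublevel :: "complex set \<Rightarrow> (complex \<Rightarrow> real) \<Rightarrow> real \<Rightarrow> complex set" where
  "sublevel \<Omega> h c = {z \<in> \<Omega>. h z \<le> c}"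

definition critical_point :: "complex set \<Rightarrow> (complex \<Rightarrow> real) \<Rightarrow> complex \<Rightarrow> bool" where
  "critical_point \<Omega> h a \<longleftrightarrow> a \<in> \<Omega> \<and> (h has_derivative (\<lambda>_. 0)) (at a)"

(* stable critical point: isolated critical point with nontrivial critical group
   H_*(h^c, h^c \ {a}), c = h a, singular homology (integer coefficients) *)
definition stable_critical_point :: "complex set \<Rightarrow> (complex \<Rightarrow> real) \<Rightarrow> complex \<Rightarrow> bool" where
  "stable_critical_point \<Omega> h a \<longleftrightarrow>
     critical_point \<Omega> h a \<and>
     (\<exists>e>0. \<forall>z\<in>ball a e. z \<noteq> a \<longrightarrow> \<not> critical_point \<Omega> h z) \<and>
     (\<exists>p::int. \<not> trivial_group
        (relative_homology_group p (top_of_set (sublevel \<Omega> h (h a)))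
                                   (sublevel \<Omega> h (h a) - {a})))"

definition config_space :: "complex set \<Rightarrow> nat \<Rightarrow> (nat \<Rightarrow> complex) set" where
  "config_space \<Omega> N = {z. (\<forall>k\<in>{1..N}. z k \<in> \<Omega>) \<and> (\<forall>j\<in>{1..N}. \<forall>k\<in>{1..N}. j \<noteq> k \<longrightarrow> z j \<noteq> z k)}"

definition Ham :: "(complex \<times> complex \<Rightarrow> real) \<Rightarrow> nat \<Rightarrow> (nat \<Rightarrow> complex) \<Rightarrow> real" where
  "Ham g N z =
     1 / (2 * pi) * (\<Sum>j\<in>{1..N}. \<Sum>k\<in>{1..N}-{j}. ln (1 / cmod (z j - z k)))
     - (\<Sum>j\<in>{1..N}. \<Sum>k\<in>{1..N}-{j}. g (z j, z k))
     - (\<Sum>k\<in>{1..N}. g (z k, z k))"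

definition partial_gradient :: "((nat \<Rightarrow> complex) \<Rightarrow> real) \<Rightarrow> nat \<Rightarrow> (nat \<Rightarrow> complex) \<Rightarrow> complex \<Rightarrow> bool" where
  "partial_gradient H k z v \<longleftrightarrow> ((\<lambda>w. H (z(k := w))) has_derivative (\<lambda>d. v \<bullet> d)) (at (z k))"

definition HS_solution :: "complex set \<Rightarrow> (complex \<times> complex \<Rightarrow> real) \<Rightarrow> nat \<Rightarrow> (nat \<Rightarrow> real \<Rightarrow> complex) \<Rightarrow> bool" where
  "HS_solution \<Omega> g N z \<longleftrightarrow>
     (\<forall>t. (\<lambda>k. z k t) \<in> config_space \<Omega> N) \<and>
     (\<forall>t. \<forall>k\<in>{1..N}. \<exists>v. partial_gradient (Ham g N) k (\<lambda>j. z j t) v \<and>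
                          (z k has_vector_derivative (- \<i> * v)) (at t))"

definition minimal_period :: "nat \<Rightarrow> (nat \<Rightarrow> real \<Rightarrow> complex) \<Rightarrow> real \<Rightarrow> bool" where
  "minimal_period N z T \<longleftrightarrow> T > 0 \<and>
     (\<forall>t. \<forall>k\<in>{1..N}. z k (t + T) = z k t) \<and>
     (\<forall>T'. 0 < T' \<and> T' < T \<longrightarrow> \<not> (\<forall>t. \<forall>k\<in>{1..N}. z k (t + T') = z k t))"

(* squared H^1(R/2piZ, C) distance of two (differentiable) 2pi-periodic functions *)
definition H1_dist_sq :: "(real \<Rightarrow> complex) \<Rightarrow> (real \<Rightarrow> complex) \<Rightarrow> real" where
  "H1_dist_sq u v = integral {0..2*pi}
     (\<lambda>t. (cmod (u t - v t))\<^sup>2 + (cmod (vector_derivative u (at t) - vector_derivative v (at t)))\<^sup>2)"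

end

theory Submission
  imports Defs
begin

text \<open>Write \<open>z\<^sub>k(t) = a + r * u(\<omega> t + 2 * pi * (k - 1) / N)\<close> with \<open>u\<close> a \<open>2 * pi\<close>-periodic function. For small \<open>r\<close> the
system becomes \<open>- \<i> u' = F(a, r, u)\<close>, whose limit \<open>r = 0\<close> is the free vortex polygon with solution \<open>e\<^sup>i\<^sup>t\<close>. The
linearisation at \<open>e\<^sup>i\<^sup>t\<close> has a kernel spanned by constants and by the phase direction, and Fourier series invert it
elsewhere, so a contraction solves the equation up to two multipliers for every centre \<open>a\<close>. The phase multiplier
vanishes by invariance under time translations. By the envelope principle the remaining one is the gradient in \<open>a\<close>
of the reduced action, and it is, up to a factor, uniformly close to the gradient of \<open>h\<close>. If such a perturbed
gradient had no zero near \<open>a\<^sub>0\<close>, iterated steepest descent steps would deform the sublevel set of \<open>h\<close> off the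
point \<open>a\<^sub>0\<close>, and the critical group would be trivial.\<close>


section \<open>Relative homology\<close>

text \<open>Nothing but its critical group is known about \<open>a0\<close>, which may be
  degenerate, so it cannot be continued by the implicit function theorem. Moreover \<open>g\<close>
  is only C^2: the correction depends on the centre in a Lipschitz way, and so does the reduced
  gradient. This is why the whole descent argument works with Lipschitz gradients and finite steps.

  The obstacle is that descent for the perturbed energy leaves the sublevel set of \<open>h\<close>,
  where the homology lives. Orbits are brought back by a retraction, which has to miss
  \<open>a0\<close> on a suitable set of points. That set is cut out by adding to the energy a
  potential of height \<open>4 * e\<close>, where \<open>e / 2\<close> bounds the distance between
  the two energies. Descent for \<open>h\<close> itself pushes every compact part of the punctured
  sublevel set into it.

  The factor \<open>2 / (N - 1)\<close> in the rescaled force makes the unit polygon rotate with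
  speed one; this normalisation produces the period.\<close>

text \<open>The boundary of a relative cycle has compact support in \<open>A\<close>. Once this
  support is pushed into \<open>Y\<close>, the class comes from the pair of \<open>X\<close> and
  \<open>Y\<close>, and there the inclusion is homotopic to a map into \<open>A\<close>. Only
  compact sets are pushed, so the number of iterations may depend on \<open>K\<close>.\<close>

lemma trivial_relative_homology_group_if_compressible:
  assumes YA: "Y \<subseteq> A"
    and push: "\<And>K. compactin X K \<Longrightarrow> K \<subseteq> A \<Longrightarrow>
      \<exists>F n. homotopic_with (\<lambda>f. f \<in> A \<rightarrow> A) X X id F \<and> (F ^^ n) ` K \<subseteq> Y"
    and hG: "homotopic_with (\<lambda>f. f \<in> Y \<rightarrow> A) X X id G"
    and GA: "G \<in> topspace X \<rightarrow> A"
  shows "trivial_group (relative_homology_group p X A)"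
proof (cases "p < 0")
  case True
  then show ?thesis by simp
next
  case False
  then obtain n where p: "p = int n" by (metis int_nat_eq not_le)
  have "c = one (relative_homology_group p X A)"
    if c: "c \<in> carrier (relative_homology_group p X A)" for c
  proof -
    obtain d where d: "singular_relcycle n X A d" and cd: "c = homologous_rel_set n X A d"
      using c unfolding p carrier_relative_homology_group by auto
    define b where "b = chain_boundary n d"
    have chd: "singular_chain n X d" and chb: "singular_chain (n - Suc 0) (subtopology X A) b"
      using d by (auto simp: singular_relcycle b_def)
    define K where "K = (\<Union>f\<in>Poly_Mapping.keys b. f ` standard_simplex (n - Suc 0))"
    have simp_f: "singular_simplex (n - Suc 0) (subtopology X A) f" if "f \<in> Poly_Mapping.keys b" for f
      using chb that by (auto simp: singular_chain_def)
    have "compactin X K" unfolding K_def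
    proof (rule compactin_Union, goal_cases)
      case 1
      then show ?case by simp
    next
      case (2 S)
      then obtain f where f: "f \<in> Poly_Mapping.keys b" and S: "S = f ` standard_simplex (n - Suc 0)" by auto
      have "continuous_map (subtopology (powertop_real UNIV) (standard_simplex (n - Suc 0))) X f"
        using simp_f[OF f] by (auto simp: singular_simplex_def continuous_map_in_subtopology)
      then show ?case unfolding S
        by (rule image_compactin[rotated]) (simp add: compactin_standard_simplex compactin_subtopology)
    qed
    moreover have KA: "K \<subseteq> A"
      using simp_f unfolding K_def singular_simplex_subtopology by (auto)
    ultimately obtain F m where hF: "homotopic_with (\<lambda>f. f \<in> A \<rightarrow> A) X X id F" and FK: "(F ^^ m) ` K \<subseteq> Y"
      using push by blast
    have contF: "continuous_map X X F" and FA: "F \<in> A \<rightarrow> A"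
      using homotopic_with_imp_continuous_maps[OF hF] homotopic_with_imp_property[OF hF] by auto
    \<comment> \<open>One application of \<open>F\<close> acts as the identity on relative homology,
      hence so does every iterate.\<close>
    have iter: "continuous_map X X (F ^^ k) \<and> (F ^^ k) \<in> A \<rightarrow> A \<and>
        (\<forall>x\<in>carrier (relative_homology_group p X A). hom_induced p X A X A (F ^^ k) x = x)" for k
    proof (induction k)
      case 0
      show ?case using hom_induced_id[of _ p X A] by (auto simp: id_def)
    next
      case (Suc k)
      have "hom_induced p X A X A (F ^^ Suc k) x = x"
        if x: "x \<in> carrier (relative_homology_group p X A)" for x
      proof -
        have "hom_induced p X A X A (F \<circ> (F ^^ k)) x
            = hom_induced p X A X A F (hom_induced p X A X A (F ^^ k) x)"
          using Suc hom_induced_compose'[of X X "F ^^ k" A A X F A] contF FA by metis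
        also have "\<dots> = hom_induced p X A X A id x"
          using Suc x homology_homotopy_axiom[OF hF] by metis
        finally show ?thesis using hom_induced_id[OF x] by simp
      qed
      moreover have "continuous_map X X (F ^^ Suc k)"
        using Suc contF continuous_map_compose by (metis funpow.simps(2))
      moreover have "(F ^^ Suc k) \<in> A \<rightarrow> A" using Suc FA by auto
      ultimately show ?case by blast
    qed
    define e where "e = chain_map n (F ^^ m) d"
    have che: "singular_chain n X e" unfolding e_def
      using singular_chain_chain_map[OF chd] iter by blast
    have ceA: "c = homologous_rel_set n X A e"
      using iter[of m] c d unfolding cd p e_def
      by (metis hom_induced_chain_map)
    have relA: "singular_relcycle n X A e" unfolding e_def
      using singular_relcycle_chain_map[OF d, of X "F ^^ m" A] iter[of m] by blast
    have bK: "singular_chain (n - Suc 0) (subtopology X K) b"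
      unfolding singular_chain_def
    proof
      fix f assume f: "f \<in> Poly_Mapping.keys b"
      have "f ` standard_simplex (n - Suc 0) \<subseteq> K" using f unfolding K_def by auto
      then show "f \<in> singular_simplex_set (n - Suc 0) (subtopology X K)"
        using simp_f[OF f] by (simp add: singular_simplex_subtopology)
    qed
    have "continuous_map (subtopology X K) (subtopology X Y) (F ^^ m)"
      using iter[of m] FK by (auto simp: continuous_map_in_subtopology continuous_map_from_subtopology)
    then have "singular_chain (n - Suc 0) (subtopology X Y) (chain_map (n - Suc 0) (F ^^ m) b)"
      by (rule singular_chain_chain_map[OF bK])
    \<comment> \<open>\<open>e\<close> represents the class of \<open>d\<close>, but its boundary
      lies in \<open>Y\<close>.\<close>
    then have relY: "singular_relcycle n X Y e"
      using che chain_boundary_chain_map[OF chd, of "F ^^ m"]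
      by (simp add: singular_relcycle e_def b_def)
    have idYA: "id \<in> Y \<rightarrow> A" using YA by auto
    have contG: "continuous_map X X G" and GY: "G \<in> Y \<rightarrow> A"
      using homotopic_with_imp_continuous_maps[OF hG] homotopic_with_imp_property[OF hG] by auto
    \<comment> \<open>Factor the class through \<open>Y\<close>; there \<open>id\<close> may be
      replaced by \<open>G\<close>, whose image chain lies entirely in \<open>A\<close>.\<close>
    have "c = hom_induced n X Y X A id (homologous_rel_set n X Y e)"
      unfolding ceA using hom_induced_chain_map[OF continuous_map_id idYA relY] chain_map_id[of n]
      using che by (simp add: chain_map_id_gen)
    also have "\<dots> = hom_induced n X Y X A G (homologous_rel_set n X Y e)"
      using homology_homotopy_axiom[OF hG, of n] by simp
    also have "\<dots> = homologous_rel_set n X A (chain_map n G e)"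
      by (rule hom_induced_chain_map[OF contG GY relY])
    also have "\<dots> = singular_relboundary_set n X A"
    proof -
      have "continuous_map X (subtopology X A) G"
        using contG GA by (auto simp: continuous_map_in_subtopology)
      then have "singular_chain n (subtopology X A) (chain_map n G e)"
        by (rule singular_chain_chain_map[OF che])
      then show ?thesis
        using singular_chain_imp_relboundary homologous_rel_set_eq_relboundary by blast
    qed
    finally show ?thesis by (simp add: p)
  qed
  then show ?thesis
    by (metis group.trivial_group group_relative_homology_group subgroup.one_closed
        group.subgroup_self insert_absorb singletonI subsetI subset_singletonD equals0D)
qed

section \<open>Discrete gradient descent\<close>

text \<open>Mean value inequality for \<open>f z - V x \<bullet> z\<close> on the segment from
  \<open>x\<close> to \<open>y\<close>. This route gives \<open>L\<close> instead of the sharp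
  \<open>L / 2\<close>, which is good enough for all later estimates.\<close>

lemma quadratic_bound_lipschitz_gradient:
  fixes f :: "'a::real_inner \<Rightarrow> real" and V :: "'a \<Rightarrow> 'a"
  assumes S: "convex S" and x: "x \<in> S" and y: "y \<in> S" and L: "L \<ge> 0"
    and der: "\<And>z. z \<in> S \<Longrightarrow> (f has_derivative (\<lambda>d. V z \<bullet> d)) (at z within S)"
    and lip: "\<And>z. z \<in> S \<Longrightarrow> norm (V z - V x) \<le> L * norm (z - x)"
  shows "\<bar>f y - f x - V x \<bullet> (y - x)\<bar> \<le> L * (norm (y - x))\<^sup>2"
proof -
  let ?C = "closed_segment x y"
  have CS: "?C \<subseteq> S" using S x y by (simp add: closed_segment_subset)
  have nrm: "norm (z - x) \<le> norm (y - x)" if "z \<in> ?C" for z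
    using that by (metis dist_commute dist_norm segment_bound(1))
  have "norm ((f y - V x \<bullet> y) - (f x - V x \<bullet> x)) \<le> (L * norm (y - x)) * norm (y - x)"
  proof (rule differentiable_bound[where S = ?C and f = "\<lambda>z. f z - V x \<bullet> z" and f' = "\<lambda>z d. V z \<bullet> d - V x \<bullet> d"])
    fix z assume z: "z \<in> ?C"
    have "(f has_derivative (\<lambda>d. V z \<bullet> d)) (at z within ?C)"
      using der CS z has_derivative_subset by blast
    then show "((\<lambda>z. f z - V x \<bullet> z) has_derivative (\<lambda>d. V z \<bullet> d - V x \<bullet> d)) (at z within ?C)"
      by (auto intro!: derivative_eq_intros)
    show "onorm (\<lambda>d. V z \<bullet> d - V x \<bullet> d) \<le> L * norm (y - x)"
    proof (rule onorm_bound)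
      show "0 \<le> L * norm (y - x)" using L by simp
      fix d
      have "norm (V z \<bullet> d - V x \<bullet> d) \<le> norm (V z - V x) * norm d"
        by (metis inner_diff_left real_norm_def Cauchy_Schwarz_ineq2)
      also have "\<dots> \<le> (L * norm (y - x)) * norm d"
        using lip[of z] nrm[OF z] CS z L
        by (intro mult_right_mono) (auto intro: order_trans mult_left_mono)
      finally show "norm (V z \<bullet> d - V x \<bullet> d) \<le> L * norm (y - x) * norm d" .
    qed
  qed (auto)
  then show ?thesis by (simp add: power2_eq_square inner_diff_right algebra_simps)
qed

definition cutoff_field :: "'a::real_normed_vector \<Rightarrow> real \<Rightarrow> ('a \<Rightarrow> 'a) \<Rightarrow> 'a \<Rightarrow> 'a" where
  "cutoff_field a \<rho> V x = max 0 (\<rho> - dist x a) *\<^sub>R V x"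

definition descent_step :: "'a::real_normed_vector \<Rightarrow> real \<Rightarrow> ('a \<Rightarrow> 'a) \<Rightarrow> real \<Rightarrow> 'a \<Rightarrow> 'a" where
  "descent_step a \<rho> V \<tau> x = x - \<tau> *\<^sub>R cutoff_field a \<rho> V x"

definition depth :: "'a::metric_space \<Rightarrow> real \<Rightarrow> real \<Rightarrow> 'a \<Rightarrow> real" where
  "depth a s t x = max 0 (min (t - s) (t - dist x a))"

lemma depth_inner: "s \<le> t \<Longrightarrow> dist x a \<le> s \<Longrightarrow> depth a s t x = t - s"
  by (simp add: depth_def)

lemma depth_outer: "s \<le> t \<Longrightarrow> t \<le> dist x a \<Longrightarrow> depth a s t x = 0"
  by (simp add: depth_def)

lemma depth_bounds: "s \<le> t \<Longrightarrow> 0 \<le> depth a s t x" "s \<le> t \<Longrightarrow> depth a s t x \<le> t - s"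
  by (auto simp: depth_def)

text \<open>Crossing the annulus between the radii \<open>s\<close> and \<open>t\<close> inwards costs at least \<open>\<kappa> * (t - s)\<close> of the
  decreasing function \<open>f\<close>; recording the unpaid part of that cost makes the quantity monotone.\<close>
lemma potential_mono:
  fixes f :: "'a::real_normed_vector \<Rightarrow> real"
  assumes st: "s \<le> t" and k: "\<kappa> \<ge> 0" and dec: "f y \<le> f x"
    and ann: "s \<le> dist x a \<Longrightarrow> f y \<le> f x - \<kappa> * dist y x"
  shows "f y + \<kappa> * depth a s t y \<le> f x + \<kappa> * depth a s t x"
proof (cases "s \<le> dist x a")
  case True
  have "depth a s t y \<le> depth a s t x + dist y x"
    using st dist_triangle[of x a y] zero_le_dist[of y x] unfolding depth_def dist_commute[of x y]
    by linarith
  then have "\<kappa> * depth a s t y \<le> \<kappa> * depth a s t x + \<kappa> * dist y x"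
    using k by (metis distrib_left mult_left_mono)
  then show ?thesis using ann[OF True] by linarith
next
  case False
  then have "depth a s t y \<le> depth a s t x"
    using depth_inner[of s t x a] depth_bounds(2)[OF st, of a y] st by simp
  then show ?thesis using dec k mult_left_mono[of "depth a s t y" "depth a s t x" \<kappa>] by linarith
qed

text \<open>The hypotheses are those which the reduced energy can satisfy as well: a gradient that
  is Lipschitz but perhaps not differentiable, and derivatives taken within a closed ball. The
  locale serves both for \<open>h\<close> and for its perturbation.\<close>

locale gradient_ball =
  fixes a :: "'a::euclidean_space" and R L M :: real and f :: "'a \<Rightarrow> real" and V :: "'a \<Rightarrow> 'a"
  assumes R: "R > 0" and L: "L \<ge> 0"
    and der: "\<And>x. x \<in> cball a R \<Longrightarrow> (f has_derivative (\<lambda>d. V x \<bullet> d)) (at x within cball a R)"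
    and lip: "\<And>x y. x \<in> cball a R \<Longrightarrow> y \<in> cball a R \<Longrightarrow> norm (V x - V y) \<le> L * norm (x - y)"
    and bnd: "\<And>x. x \<in> cball a R \<Longrightarrow> norm (V x) \<le> M"
begin

lemma M_nonneg: "M \<ge> 0"
  using bnd[of a] R norm_ge_zero[of "V a"] by (auto simp del: norm_ge_zero intro: order_trans)

lemma cont_V: "continuous_on (cball a R) V"
proof (rule lipschitz_on_continuous_on[of L])
  show "L-lipschitz_on (cball a R) V"
    using lip L by (auto simp: lipschitz_on_def dist_norm)
qed

lemma cont_f: "continuous_on (cball a R) f"
  using der has_derivative_continuous continuous_on_eq_continuous_within by blast

lemma continuous_on_cutoff_field:
  assumes "\<rho> \<le> R"
  shows "continuous_on UNIV (cutoff_field a \<rho> V)"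
proof -
  have 1: "continuous_on (cball a R) (cutoff_field a \<rho> V)"
    unfolding cutoff_field_def by (intro continuous_intros cont_V)
  have z: "cutoff_field a \<rho> V x = 0" if "x \<in> - ball a R" for x
    using that assms by (auto simp: cutoff_field_def dist_commute)
  have 2: "continuous_on (- ball a R) (cutoff_field a \<rho> V)"
    by (rule continuous_on_eq[of _ "\<lambda>x. 0"]) (auto simp: z)
  have "continuous_on (cball a R \<union> - ball a R) (cutoff_field a \<rho> V)"
    by (rule continuous_on_closed_Un[OF _ _ 1 2]) auto
  moreover have "cball a R \<union> - ball a R = UNIV" by auto
  ultimately show ?thesis by simp
qed

lemma step_outside: "\<rho> \<le> dist x a \<Longrightarrow> descent_step a \<rho> V \<tau> x = x"
  by (simp add: descent_step_def cutoff_field_def)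

lemma step_dist: "descent_step a \<rho> V \<tau> x - x = - ((\<tau> * max 0 (\<rho> - dist x a)) *\<^sub>R V x)"
  by (simp add: descent_step_def cutoff_field_def)

context
  fixes \<rho> \<tau> :: real
  assumes rho: "0 < \<rho>" "\<rho> \<le> R" and tau: "0 \<le> \<tau>" "\<tau> * M \<le> 1" "\<tau> * R * L \<le> 1 / 2"
begin

text \<open>The cutoff makes the step length at most \<open>\<tau> * M\<close> times the distance to
  the sphere of radius \<open>\<rho>\<close>, so \<open>\<tau> * M \<le> 1\<close> suffices.\<close>

lemma step_in:
  assumes "x \<in> cball a \<rho>"
  shows "descent_step a \<rho> V \<tau> x \<in> cball a \<rho>"
proof -
  have xR: "x \<in> cball a R" using assms rho by auto
  have "norm (descent_step a \<rho> V \<tau> x - x) = \<tau> * (\<rho> - dist x a) * norm (V x)"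
    using assms tau by (simp add: step_dist dist_commute)
  also have "\<dots> = (\<rho> - dist x a) * (\<tau> * norm (V x))" by simp
  also have "\<dots> \<le> (\<rho> - dist x a) * 1"
  proof (rule mult_left_mono)
    show "\<tau> * norm (V x) \<le> 1" using tau bnd[OF xR] by (meson mult_left_mono order_trans)
  qed (use assms in \<open>auto simp: dist_commute\<close>)
  finally have "dist (descent_step a \<rho> V \<tau> x) x \<le> \<rho> - dist x a" by (simp add: dist_norm)
  then show ?thesis using dist_triangle[of "descent_step a \<rho> V \<tau> x" a x] by (auto simp: dist_commute)
qed

text \<open>The linear term of the decrease is \<open>w * |V x|^2\<close>, and
  \<open>\<tau> * R * L \<le> 1 / 2\<close> makes the quadratic error at most half of it. The lower
  bound will ensure that a step does not overshoot a level.\<close>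

lemma step_estimates:
  assumes x: "x \<in> cball a \<rho>"
  defines "y \<equiv> descent_step a \<rho> V \<tau> x" and "w \<equiv> \<tau> * (\<rho> - dist x a)"
  shows "f y \<le> f x - w / 2 * (norm (V x))\<^sup>2" "f y \<ge> f x - 2 * w * (norm (V x))\<^sup>2" "w \<ge> 0"
    "dist y x = w * norm (V x)"
proof -
  have xR: "x \<in> cball a R" and yR: "y \<in> cball a R"
    using x rho step_in[OF x] by (auto simp: y_def)
  have yx: "y - x = - (w *\<^sub>R V x)" using x by (simp add: y_def w_def step_dist dist_commute)
  show w0: "w \<ge> 0" using x tau by (simp add: w_def dist_commute)
  have "w * L \<le> 1 / 2"
  proof -
    have "\<rho> - dist x a \<le> R" using rho zero_le_dist[of x a] by linarith
    then have "w \<le> \<tau> * R" using tau(1) unfolding w_def by (rule mult_left_mono)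
    then have "w * L \<le> \<tau> * R * L" using L by (rule mult_right_mono)
    then show ?thesis using tau by linarith
  qed
  then have wL: "L * w\<^sup>2 \<le> w / 2" using w0
    by (simp add: power2_eq_square) (metis mult.assoc mult.commute mult_left_mono mult.right_neutral times_divide_eq_right)
  have "\<bar>f y - f x - V x \<bullet> (y - x)\<bar> \<le> L * (norm (y - x))\<^sup>2"
    using quadratic_bound_lipschitz_gradient[OF convex_cball xR yR L der lip[OF _ xR]] by blast
  then have "\<bar>f y - f x + w * (norm (V x))\<^sup>2\<bar> \<le> L * w\<^sup>2 * (norm (V x))\<^sup>2"
    unfolding yx by (simp add: power_mult_distrib power2_norm_eq_inner)
  also have "\<dots> \<le> w / 2 * (norm (V x))\<^sup>2" using wL by (rule mult_right_mono) simp
  finally have *: "\<bar>f y - f x + w * (norm (V x))\<^sup>2\<bar> \<le> w / 2 * (norm (V x))\<^sup>2" .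
  have w2: "w / 2 * (norm (V x))\<^sup>2 = w * (norm (V x))\<^sup>2 / 2"
    "2 * w * (norm (V x))\<^sup>2 = 2 * (w * (norm (V x))\<^sup>2)" by auto
  show "f y \<le> f x - w / 2 * (norm (V x))\<^sup>2" using * unfolding w2 by linarith
  have "0 \<le> w * (norm (V x))\<^sup>2" using w0 by simp
  then show "f y \<ge> f x - 2 * w * (norm (V x))\<^sup>2" using * unfolding w2 by linarith
  show "dist y x = w * norm (V x)" using yx w0 by (simp add: dist_norm)
qed

lemma step_decreases: "x \<in> cball a \<rho> \<Longrightarrow> f (descent_step a \<rho> V \<tau> x) \<le> f x"
  using step_estimates(1,3)[of x] by (smt (verit) mult_nonneg_nonneg zero_le_power2 divide_nonneg_pos)

text \<open>The guaranteed decrease is the step length times half of \<open>|V x|\<close>.\<close>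

lemma step_pays:
  assumes x: "x \<in> cball a \<rho>" and k: "2 * \<kappa> \<le> norm (V x)"
  shows "f (descent_step a \<rho> V \<tau> x) \<le> f x - \<kappa> * dist (descent_step a \<rho> V \<tau> x) x"
proof -
  have "\<kappa> * (\<tau> * (\<rho> - dist x a) * norm (V x)) \<le> \<tau> * (\<rho> - dist x a) / 2 * (norm (V x))\<^sup>2"
    using mult_right_mono[OF k mult_nonneg_nonneg[OF step_estimates(3)[OF x] norm_ge_zero[of "V x"]]]
    by (simp add: power2_eq_square algebra_simps)
  then show ?thesis using step_estimates(1,4)[OF x] by simp
qed

lemma step_potential:
  assumes x: "x \<in> cball a \<rho>" and st: "s \<le> t" and k0: "\<kappa> \<ge> 0"
    and k: "\<And>x. x \<in> cball a R \<Longrightarrow> s \<le> dist x a \<Longrightarrow> 2 * \<kappa> \<le> norm (V x)"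
  shows "f (descent_step a \<rho> V \<tau> x) + \<kappa> * depth a s t (descent_step a \<rho> V \<tau> x)
    \<le> f x + \<kappa> * depth a s t x"
proof (rule potential_mono[where f = f, OF st k0 step_decreases[OF x]])
  assume "s \<le> dist x a"
  then show "f (descent_step a \<rho> V \<tau> x) \<le> f x - \<kappa> * dist (descent_step a \<rho> V \<tau> x) x"
    using step_pays[OF x, of \<kappa>] k[of x] x rho by auto
qed

text \<open>Since \<open>V\<close> is Lipschitz and vanishes at \<open>a\<close>, a step covers at
  most half of the distance to \<open>a\<close>. This is the discrete counterpart of the fact that a
  gradient flow does not reach a critical point in finite time.\<close>

lemma step_neq_critical:
  assumes Va: "V a = 0" and xa: "x \<noteq> a"
  shows "descent_step a \<rho> V \<tau> x \<noteq> a"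
proof (cases "x \<in> cball a \<rho>")
  case True
  then have xR: "x \<in> cball a R" using rho by auto
  have "norm (V x) \<le> L * norm (x - a)" using lip[OF xR, of a] R Va by auto
  then have "dist (descent_step a \<rho> V \<tau> x) x \<le> \<tau> * (\<rho> - dist x a) * (L * norm (x - a))"
    using step_estimates(3,4)[OF True] by (simp add: mult_left_mono)
  also have "\<dots> \<le> \<tau> * R * (L * norm (x - a))"
    using tau(1) rho L zero_le_dist[of x a]
    by (intro mult_right_mono mult_left_mono mult_nonneg_nonneg norm_ge_zero) linarith+
  also have "\<dots> \<le> 1 / 2 * norm (x - a)"
    using mult_right_mono[OF tau(3), of "norm (x - a)"] by (simp add: mult.assoc)
  finally have "dist (descent_step a \<rho> V \<tau> x) x \<le> dist a x / 2" by (simp add: dist_norm norm_minus_commute)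
  then show ?thesis using xa zero_less_dist_iff[of a x] by auto
qed (use step_outside[of \<rho> x] xa in \<open>auto simp: dist_commute\<close>)

end

lemma exists_step_size:
  assumes "B > 0"
  shows "\<exists>\<tau>>0. \<tau> * M \<le> 1 \<and> \<tau> * R * L \<le> 1 / 2 \<and> \<tau> * B \<le> 1"
proof -
  define \<tau> where "\<tau> = 1 / (1 + M + 2 * R * L + B)"
  have RL: "R * L \<ge> 0" using R L by simp
  have p: "1 + M + 2 * R * L + B > 0" using M_nonneg RL assms by linarith
  have "\<tau> > 0" using p by (simp add: \<tau>_def)
  moreover have "\<tau> * M \<le> 1" "\<tau> * R * L \<le> 1 / 2" "\<tau> * B \<le> 1"
    using p M_nonneg RL assms by (auto simp: \<tau>_def field_simps)
  ultimately show ?thesis by blast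
qed

end

section \<open>Retraction of slightly higher levels onto the sublevel set\<close>

lemma norm_bounded_below_on_compact:
  fixes V :: "'a::topological_space \<Rightarrow> 'b::real_normed_vector"
  assumes "compact K" "continuous_on K V" "\<And>x. x \<in> K \<Longrightarrow> V x \<noteq> 0"
  shows "\<exists>m>0. \<forall>x\<in>K. m \<le> norm (V x)"
proof (cases "K = {}")
  case False
  have "continuous_on K (\<lambda>x. norm (V x))" using assms(2) by (intro continuous_intros)
  then obtain x where "x \<in> K" "\<forall>y\<in>K. norm (V x) \<le> norm (V y)"
    using continuous_attains_inf[OF assms(1) False] by blast
  then show ?thesis using assms(3)[of x] by (intro exI[of _ "norm (V x)"]) auto
qed (auto intro: exI[of _ 1])

context gradient_ball begin

lemma gradient_bounded_below:
  assumes "\<And>x. x \<in> cball a R \<Longrightarrow> x \<noteq> a \<Longrightarrow> V x \<noteq> 0" and b: "b > 0"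
  shows "\<exists>m>0. \<forall>x\<in>cball a R. b \<le> dist x a \<longrightarrow> m \<le> norm (V x)"
proof -
  have "compact (cball a R - ball a b)" by (intro compact_diff) auto
  moreover have "continuous_on (cball a R - ball a b) V"
    using cont_V continuous_on_subset by blast
  ultimately obtain m where m: "m > 0" "\<forall>x\<in>cball a R - ball a b. m \<le> norm (V x)"
    using norm_bounded_below_on_compact[of "cball a R - ball a b" V] assms by force
  then show ?thesis by (intro exI[of _ m]) (auto simp: dist_commute)
qed

text \<open>The retraction is the limit of descent steps whose length is proportional to \<open>f - f a\<close>. Near the
  critical point the steps degenerate, but an orbit with little energy left cannot travel far, which
  makes the convergence uniform and hence the limit continuous.\<close>
lemma retraction_onto_sublevel:
  assumes Va: "V a = 0" and crit: "\<And>x. x \<in> cball a R \<Longrightarrow> x \<noteq> a \<Longrightarrow> V x \<noteq> 0"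
    and kap: "\<kappa> > 0" "\<And>x. x \<in> cball a R \<Longrightarrow> R / 16 \<le> dist x a \<Longrightarrow> 2 * \<kappa> \<le> norm (V x)"
    and e: "e = \<kappa> * R / 32"
  defines "D \<equiv> {x \<in> cball a (R / 2). f x \<le> f a + e}"
  shows "\<exists>r. continuous_on D r \<and> (\<forall>x\<in>D. r x \<in> cball a R \<and> f (r x) \<le> f a) \<and>
    (\<forall>x\<in>D. f x \<le> f a \<longrightarrow> r x = x) \<and> (\<forall>x\<in>D. R / 8 \<le> dist x a \<longrightarrow> r x \<noteq> a)"
proof -
  have e0: "e > 0" unfolding e using kap(1) R by simp
  \<comment> \<open>The first summand keeps a step shorter than \<open>R / 4\<close>, the second
    prevents a step from falling below the level \<open>f a\<close>.\<close>
  define B where "B = 4 * M + 2 * R * M\<^sup>2 / e + 1"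
  have B4: "4 * M \<le> B" and B2: "2 * R * M\<^sup>2 / e \<le> B" and B0: "B > 0"
  proof -
    have "0 \<le> 2 * R * M\<^sup>2 / e" using R e0 by (intro divide_nonneg_pos) auto
    then show "4 * M \<le> B" "2 * R * M\<^sup>2 / e \<le> B" "B > 0" unfolding B_def using M_nonneg by linarith+
  qed
  obtain \<tau> where t: "\<tau> > 0" "\<tau> * M \<le> 1" "\<tau> * R * L \<le> 1 / 2" and tB: "\<tau> * B \<le> 1"
    using exists_step_size[OF B0] by blast
  have t4M: "\<tau> * (4 * M) \<le> 1" and tRM: "\<tau> * (2 * R * M\<^sup>2 / e) \<le> 1"
    using mult_left_mono[OF B4, of \<tau>] mult_left_mono[OF B2, of \<tau>] tB t(1) by linarith+
  define \<sigma> where "\<sigma> = \<tau> / e"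
  have s0: "\<sigma> > 0" and se: "\<sigma> * e = \<tau>" using t(1) e0 by (auto simp: \<sigma>_def)
  have sRM: "2 * \<sigma> * R * M\<^sup>2 \<le> 1" using tRM by (simp add: \<sigma>_def mult_ac)
  define gap where "gap x = max 0 (f x - f a)" for x
  \<comment> \<open>The step length is proportional to the excess over \<open>f a\<close>, so points
    of the sublevel set are fixed; \<open>\<sigma>\<close> is scaled so that an excess of at most
    \<open>e\<close> keeps the step size below \<open>\<tau>\<close>.\<close>
  define T where "T x = descent_step a R V (\<sigma> * gap x) x" for x
  \<comment> \<open>An invariant set containing \<open>D\<close>. Beyond radius
    \<open>R / 16\<close> a step pays \<open>\<kappa>\<close> per unit of length, so the budget
    \<open>e\<close> allows an orbit above the level \<open>f a\<close> to exceed radius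
    \<open>R / 2\<close> by at most \<open>R / 32\<close>. It thus stays where the cutoff is at
    least \<open>R / 4\<close>.\<close>
  define Q where "Q = {x \<in> cball a R. f x + \<kappa> * max 0 (dist x a - R / 2) \<le> f a + e \<or> f x \<le> f a}"
  have DQ: "D \<subseteq> Q" using R by (auto simp: D_def Q_def dist_commute)
  have gap0: "gap x \<ge> 0" for x by (simp add: gap_def)
  have fQ: "f x \<le> f a + e" if "x \<in> Q" for x
  proof -
    have "0 \<le> \<kappa> * max 0 (dist x a - R / 2)" using kap(1) by simp
    then show ?thesis using that e0 by (auto simp: Q_def)
  qed
  then have gape: "gap x \<le> e" if "x \<in> Q" for x using that e0 by (force simp: gap_def)
  have tx: "0 \<le> \<sigma> * gap x" "\<sigma> * gap x \<le> \<tau>" if "x \<in> Q" for x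
    using s0 gap0[of x] mult_left_mono[OF gape[OF that], of \<sigma>] se by auto
  have ok: "0 < R" "R \<le> R" "0 \<le> \<sigma> * gap x" "\<sigma> * gap x * M \<le> 1" "\<sigma> * gap x * R * L \<le> 1 / 2"
    if "x \<in> Q" for x
  proof -
    have "0 \<le> R * L" using R L by simp
    then show "\<sigma> * gap x * R * L \<le> 1 / 2"
      using mult_right_mono[OF tx(2)[OF that], of "R * L"] t(3) by (simp add: mult.assoc)
    show "\<sigma> * gap x * M \<le> 1" using mult_right_mono[OF tx(2)[OF that] M_nonneg] t(2) by linarith
  qed (use R tx[OF that] in auto)
  have Qc: "x \<in> cball a R" if "x \<in> Q" for x using that by (auto simp: Q_def)
  have Qd: "R - dist x a \<ge> 0" if "x \<in> Q" for x using Qc[OF that] by (simp add: dist_commute)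
  have Tfix: "T x = x" if "f x \<le> f a" for x
    using that by (simp add: T_def gap_def descent_step_def)
  have Tdec: "f (T x) \<le> f x" if "x \<in> Q" for x
    unfolding T_def by (rule step_decreases[OF ok[OF that] Qc[OF that]])
  have Tcb: "T x \<in> cball a R" if "x \<in> Q" for x
    unfolding T_def by (rule step_in[OF ok[OF that] Qc[OF that]])
  have Tpays: "f (T x) \<le> f x - k * dist (T x) x" if "x \<in> Q" "2 * k \<le> norm (V x)" for x k
    unfolding T_def by (rule step_pays[OF ok[OF that(1)] Qc[OF that(1)] that(2)])
  have Tlen: "dist (T x) x \<le> \<sigma> * gap x * R * M" if x: "x \<in> Q" for x
  proof -
    have "dist (T x) x = \<sigma> * gap x * (R - dist x a) * norm (V x)"
      unfolding T_def by (rule step_estimates(4)[OF ok[OF x] Qc[OF x]])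
    also have "\<dots> \<le> \<sigma> * gap x * R * M"
      using s0 gap0[of x] Qd[OF x] bnd[OF Qc[OF x]] R M_nonneg
      by (intro mult_mono mult_left_mono mult_nonneg_nonneg) auto
    finally show ?thesis .
  qed
  have Tlow: "f (T x) \<ge> f a" if x: "x \<in> Q" "f x \<ge> f a" for x
  proof -
    let ?w = "\<sigma> * gap x * (R - dist x a)"
    have "2 * ?w * (norm (V x))\<^sup>2 \<le> 2 * (\<sigma> * gap x * R) * M\<^sup>2"
      using s0 gap0[of x] bnd[OF Qc[OF x(1)]] R M_nonneg Qd[OF x(1)]
      by (intro mult_mono mult_left_mono mult_nonneg_nonneg power_mono) auto
    also have "\<dots> = gap x * (2 * \<sigma> * R * M\<^sup>2)" by simp
    also have "\<dots> \<le> gap x" using mult_left_mono[OF sRM gap0[of x]] by simp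
    also have "\<dots> = f x - f a" using x by (simp add: gap_def)
    finally show ?thesis
      using step_estimates(2)[OF ok[OF x(1)] Qc[OF x(1)]] unfolding T_def by linarith
  qed
  have TQ: "T x \<in> Q" if x: "x \<in> Q" for x
  proof (cases "f x \<le> f a")
    case False
    then have P: "f x + \<kappa> * max 0 (dist x a - R / 2) \<le> f a + e" using x by (auto simp: Q_def)
    have "f (T x) + \<kappa> * max 0 (dist (T x) a - R / 2) \<le> f a + e"
    proof (cases "R / 16 \<le> dist x a")
      case True
      have "max 0 (dist (T x) a - R / 2) \<le> max 0 (dist x a - R / 2) + dist (T x) x"
        using dist_triangle[of "T x" a x] zero_le_dist[of "T x" x] by linarith
      then have "\<kappa> * max 0 (dist (T x) a - R / 2) \<le> \<kappa> * max 0 (dist x a - R / 2) + \<kappa> * dist (T x) x"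
        using kap(1) by (metis distrib_left mult_left_mono less_imp_le)
      then show ?thesis using Tpays[OF x kap(2)[OF Qc[OF x] True]] P by linarith
    next
      case F: False
      have "dist (T x) x \<le> \<tau> * R * M"
        using Tlen[OF x] mult_right_mono[OF tx(2)[OF x] mult_nonneg_nonneg[OF less_imp_le[OF R] M_nonneg]]
        unfolding mult.assoc by linarith
      also have "\<dots> \<le> R / 4" using mult_left_mono[OF t4M, of R] R by (simp add: mult_ac)
      finally have "dist (T x) a \<le> R / 2" using F R dist_triangle[of "T x" a x] by linarith
      then show ?thesis using Tdec[OF x] fQ[OF x] by simp
    qed
    then show ?thesis using Tcb[OF x] by (simp add: Q_def)
  qed (use Tfix x in simp)
  have TnQ: "(T ^^ n) x \<in> Q" if "x \<in> Q" for n x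
    by (induction n) (use that TQ in auto)
  have Tnfix: "(T ^^ n) x = x" if "f x \<le> f a" for n x
    by (induction n) (use that Tfix in auto)
  have Tnlow: "f ((T ^^ n) x) \<ge> f a" if "x \<in> Q" "f x \<ge> f a" for n x
    by (induction n) (use that TnQ Tlow in auto)
  have Tndec: "f ((T ^^ n) x) \<le> f x" if "x \<in> Q" for n x
    by (induction n) (use that TnQ Tdec order_trans in \<open>auto, blast\<close>)
  have far: "R - dist x a \<ge> R / 4" if "x \<in> Q" "f x > f a" for x
  proof -
    have "\<kappa> * max 0 (dist x a - R / 2) \<le> \<kappa> * (R / 32)" using that by (auto simp: Q_def e)
    then have "max 0 (dist x a - R / 2) \<le> R / 32" using kap(1) by simp
    then show ?thesis using R by linarith
  qed
  \<comment> \<open>Above the level \<open>f a + \<theta>\<close> the gradient, the excess and the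
    cutoff are all bounded below, so each step loses a fixed amount \<open>\<mu>\<close>.\<close>
  have low: "\<exists>n. \<forall>x\<in>Q. f ((T ^^ n) x) \<le> f a + \<theta>" if th: "\<theta> > 0" for \<theta>
  proof -
    let ?C = "{x \<in> cball a R. f a + \<theta> \<le> f x}"
    have "closed ?C" using continuous_closed_preimage[OF cont_f, of "{f a + \<theta>..}"]
      by (simp add: vimage_def Int_def)
    then have "compact ?C" using compact_Int_closed[of "cball a R" ?C]
      by (metis (no_types, lifting) compact_cball inf.absorb2 mem_Collect_eq subsetI)
    moreover have "continuous_on ?C V" using cont_V by (rule continuous_on_subset) auto
    ultimately obtain m where m: "m > 0" "\<forall>x\<in>?C. m \<le> norm (V x)"
      using norm_bounded_below_on_compact[of ?C V] crit th by fastforce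
    define \<mu> where "\<mu> = \<sigma> * \<theta> * (R / 4) / 2 * m\<^sup>2"
    have mu: "\<mu> > 0" using s0 th R m by (simp add: \<mu>_def)
    have drop: "f (T x) \<le> f x - \<mu>" if x: "x \<in> Q" "f x \<ge> f a + \<theta>" for x
    proof -
      have "\<mu> \<le> \<sigma> * gap x * (R - dist x a) / 2 * (norm (V x))\<^sup>2" unfolding \<mu>_def
        using s0 th R m x far[OF x(1)] Qc[OF x(1)]
        by (intro mult_mono divide_right_mono power_mono) (auto simp: gap_def)
      then show ?thesis
        using step_estimates(1)[OF ok[OF x(1)] Qc[OF x(1)]] unfolding T_def by linarith
    qed
    have "f ((T ^^ n) x) \<le> f a + \<theta> \<or> f ((T ^^ n) x) \<le> f a + e - real n * \<mu>" if x: "x \<in> Q" for x n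
    proof (induction n)
      case 0
      then show ?case using fQ[OF x] by simp
    next
      case (Suc n)
      show ?case
      proof (cases "f ((T ^^ n) x) \<le> f a + \<theta>")
        case True
        then show ?thesis using Tdec[OF TnQ[OF x], of n] by auto
      next
        case False
        then show ?thesis using drop[OF TnQ[OF x], of n] Suc by (auto simp: algebra_simps)
      qed
    qed
    moreover obtain n where "real n * \<mu> > e" using mu reals_Archimedean3 by blast
    ultimately show ?thesis using th by (intro exI[of _ n]) (smt (verit))
  qed
  have near: "\<exists>\<theta>>0. \<forall>x\<in>Q. f x \<le> f a + \<theta> \<longrightarrow> (\<forall>n. dist ((T ^^ n) x) x \<le> \<zeta>)" if z: "\<zeta> > 0" for \<zeta>
  proof -
    define b where "b = \<zeta> / 5"
    have b: "b > 0" using z by (simp add: b_def)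
    obtain m where m: "m > 0" "\<forall>x\<in>cball a R. b \<le> dist x a \<longrightarrow> m \<le> norm (V x)"
      using gradient_bounded_below[OF crit b] by blast
    define k where "k = m / 2"
    have k: "k > 0" using m by (simp add: k_def)
    \<comment> \<open>The first bound leaves too little energy to pay for a distance
      \<open>b\<close>; the second makes each single step shorter than \<open>b\<close>.\<close>
    define \<theta> where "\<theta> = min (k * b / 2) (b / (\<sigma> * R * M + 1))"
    have sRM0: "\<sigma> * R * M \<ge> 0" using s0 R M_nonneg by simp
    have q: "0 < \<sigma> * R * M + 1" using sRM0 by linarith
    have th: "\<theta> > 0" "\<theta> \<le> k * b / 2"
      using k b divide_pos_pos[OF b q] mult_pos_pos[OF k b] unfolding \<theta>_def by linarith+
    have "\<theta> \<le> b / (\<sigma> * R * M + 1)" by (simp add: \<theta>_def)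
    then have th3: "\<theta> * (\<sigma> * R * M + 1) \<le> b" using q by (simp add: pos_le_divide_eq)
    have thb: "\<theta> * (\<sigma> * R * M) \<le> b" using th th3 by (simp add: distrib_left)
    have pays: "f (T y) \<le> f y - k * dist (T y) y" if "y \<in> Q" "b \<le> dist y a" for y
      using Tpays[OF that(1), of k] m Qc[OF that(1)] that(2) by (auto simp: k_def)
    have "dist ((T ^^ n) x) x \<le> \<zeta>" if x: "x \<in> Q" "f x \<le> f a + \<theta>" for x n
    proof (cases "f x \<le> f a")
      case True
      then show ?thesis using Tnfix z by simp
    next
      case False
      note lw = Tnlow[OF x(1), of n]
      show ?thesis
      proof (cases "2 * b \<le> dist x a")
        case far2: True
        \<comment> \<open>As long as the orbit is within \<open>b\<close> of \<open>x\<close>, it is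
          at least \<open>b\<close> away from \<open>a\<close> and pays \<open>k\<close> per unit of
          length.\<close>
        have "f ((T ^^ n) x) + k * min b (dist ((T ^^ n) x) x) \<le> f x" for n
        proof (induction n)
          case 0
          then show ?case using b by simp
        next
          case (Suc n)
          let ?y = "(T ^^ n) x"
          have yQ: "?y \<in> Q" using TnQ x by blast
          show ?case
          proof (cases "b \<le> dist ?y x")
            case True
            have "k * min b (dist (T ?y) x) \<le> k * min b (dist ?y x)"
              using True k by (intro mult_left_mono) auto
            then show ?thesis using Suc Tdec[OF yQ] by simp
          next
            case False
            then have "b \<le> dist ?y a" using far2 dist_triangle[of x a ?y] by (simp add: dist_commute)
            then have p: "f (T ?y) \<le> f ?y - k * dist (T ?y) ?y" using pays[OF yQ] by blast
            have "min b (dist (T ?y) x) \<le> min b (dist ?y x) + dist (T ?y) ?y"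
              using dist_triangle[of "T ?y" x ?y] zero_le_dist[of "T ?y" ?y] by linarith
            then have "k * min b (dist (T ?y) x) \<le> k * min b (dist ?y x) + k * dist (T ?y) ?y"
              using k by (metis distrib_left mult_left_mono less_imp_le)
            then show ?thesis using Suc p by simp
          qed
        qed
        from this[of n] have "k * min b (dist ((T ^^ n) x) x) \<le> k * (b / 2)"
          using lw False x th by simp
        then have "min b (dist ((T ^^ n) x) x) \<le> b / 2" using k by simp
        then show ?thesis using b by (simp add: b_def min_def split: if_splits)
      next
        case near2: False
        \<comment> \<open>The same bookkeeping for leaving the ball of radius \<open>2 * b\<close>.
          Within radius \<open>b\<close> nothing is paid, but a step from there ends inside radius
          \<open>2 * b\<close>.\<close>
        have "f ((T ^^ n) x) + k * max 0 (dist ((T ^^ n) x) a - 2 * b) \<le> f x" for n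
        proof (induction n)
          case 0
          then show ?case using near2 by simp
        next
          case (Suc n)
          let ?y = "(T ^^ n) x"
          have yQ: "?y \<in> Q" using TnQ x by blast
          show ?case
          proof (cases "b \<le> dist ?y a")
            case True
            have "max 0 (dist (T ?y) a - 2 * b) \<le> max 0 (dist ?y a - 2 * b) + dist (T ?y) ?y"
              using dist_triangle[of "T ?y" a ?y] zero_le_dist[of "T ?y" ?y] by linarith
            then have "k * max 0 (dist (T ?y) a - 2 * b) \<le> k * max 0 (dist ?y a - 2 * b) + k * dist (T ?y) ?y"
              using k by (metis distrib_left mult_left_mono less_imp_le)
            then show ?thesis using Suc pays[OF yQ True] by simp
          next
            case F: False
            have "gap ?y \<le> \<theta>" using Tndec[OF x(1), of n] x th by (simp add: gap_def)
            then have "gap ?y * (\<sigma> * R * M) \<le> \<theta> * (\<sigma> * R * M)" using sRM0 by (rule mult_right_mono)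
            then have "dist (T ?y) ?y \<le> b" using Tlen[OF yQ] thb by (simp add: mult_ac)
            then have "dist (T ?y) a \<le> 2 * b" using F dist_triangle[of "T ?y" a ?y] by linarith
            then show ?thesis using Tdec[OF yQ] Tndec[OF x(1), of n] by simp
          qed
        qed
        from this[of n] have "k * max 0 (dist ((T ^^ n) x) a - 2 * b) \<le> k * (b / 2)"
          using lw False x th by simp
        then have "max 0 (dist ((T ^^ n) x) a - 2 * b) \<le> b / 2" using k by simp
        then have "dist ((T ^^ n) x) x \<le> 5 * b"
          using near2 dist_triangle[of "(T ^^ n) x" x a] dist_commute[of a x] b by linarith
        then show ?thesis by (simp add: b_def)
      qed
    qed
    then show ?thesis using th by blast
  qed
  \<comment> \<open>\<open>low\<close> brings all orbits to small energy after a common number of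
    steps, and from then on \<open>near\<close> confines them.\<close>
  have "uniformly_Cauchy_on Q (\<lambda>n x. (T ^^ n) x)"
  proof (rule uniformly_Cauchy_onI)
    fix \<zeta> :: real assume "\<zeta> > 0"
    then obtain \<theta> where th: "\<theta> > 0" "\<forall>x\<in>Q. f x \<le> f a + \<theta> \<longrightarrow> (\<forall>n. dist ((T ^^ n) x) x \<le> \<zeta> / 3)"
      using near[of "\<zeta> / 3"] by auto
    obtain n0 where n0: "\<forall>x\<in>Q. f ((T ^^ n0) x) \<le> f a + \<theta>" using low[OF th(1)] by blast
    have *: "dist ((T ^^ n) x) ((T ^^ n0) x) \<le> \<zeta> / 3" if "x \<in> Q" "n \<ge> n0" for x n
    proof -
      have "(T ^^ n) x = (T ^^ (n - n0)) ((T ^^ n0) x)"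
        using that(2) by (metis comp_apply funpow_add le_add_diff_inverse2)
      then show ?thesis using th(2) n0 TnQ[OF that(1)] that(1) by metis
    qed
    have "dist ((T ^^ m) x) ((T ^^ n) x) < \<zeta>" if "x \<in> Q" "m \<ge> n0" "n \<ge> n0" for x m n
      using *[OF that(1,2)] *[OF that(1,3)] \<open>\<zeta> > 0\<close> dist_triangle2[of "(T ^^ m) x" "(T ^^ n) x" "(T ^^ n0) x"]
      by linarith
    then show "\<exists>N. \<forall>x\<in>Q. \<forall>m\<ge>N. \<forall>n\<ge>N. dist ((T ^^ m) x) ((T ^^ n) x) < \<zeta>" by blast
  qed
  then obtain r where r: "uniform_limit Q (\<lambda>n x. (T ^^ n) x) r sequentially"
    using Cauchy_uniformly_convergent uniformly_convergent_on_def by blast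
  have contT: "continuous_on Q T"
  proof -
    have "continuous_on (cball a R) gap" unfolding gap_def by (intro continuous_intros cont_f)
    moreover have "continuous_on (cball a R) (cutoff_field a R V)"
      using continuous_on_cutoff_field[of R] continuous_on_subset by blast
    ultimately have "continuous_on (cball a R) T"
      unfolding T_def descent_step_def by (intro continuous_intros)
    then show ?thesis using continuous_on_subset Qc by blast
  qed
  have contTn: "continuous_on Q (\<lambda>x. (T ^^ n) x)" for n
  proof (induction n)
    case (Suc n)
    have "continuous_on Q (T \<circ> (\<lambda>x. (T ^^ n) x))"
      by (rule continuous_on_compose[OF Suc]) (use contT TnQ continuous_on_subset in blast)
    then show ?case by (simp add: o_def)
  qed simp
  have contr: "continuous_on Q r"
    by (rule uniform_limit_theorem[OF _ r]) (auto simp: contTn)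
  have lim: "(\<lambda>n. (T ^^ n) x) \<longlonglongrightarrow> r x" if "x \<in> Q" for x
    using tendsto_uniform_limitI[OF r that] .
  have rcb: "r x \<in> cball a R" if "x \<in> Q" for x
    by (rule closed_sequentially[OF closed_cball _ lim[OF that]]) (use TnQ[OF that] Qc in blast)
  have flim: "(\<lambda>n. f ((T ^^ n) x)) \<longlonglongrightarrow> f (r x)" if "x \<in> Q" for x
    by (rule continuous_on_tendsto_compose[OF cont_f lim[OF that] rcb[OF that]])
      (use TnQ[OF that] Qc in \<open>auto intro!: always_eventually\<close>)
  have frx: "f (r x) \<le> f a" if x: "x \<in> Q" for x
  proof (rule field_le_epsilon)
    fix \<theta> :: real assume "\<theta> > 0"
    then obtain n0 where n0: "\<forall>x\<in>Q. f ((T ^^ n0) x) \<le> f a + \<theta>" using low by blast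
    have "f ((T ^^ n) x) \<le> f a + \<theta>" if "n \<ge> n0" for n
    proof -
      have "(T ^^ n) x = (T ^^ (n - n0)) ((T ^^ n0) x)"
        using that by (metis comp_apply funpow_add le_add_diff_inverse2)
      then show ?thesis using Tndec[OF TnQ[OF x], of "n - n0" n0] n0 x by force
    qed
    then show "f (r x) \<le> f a + \<theta>" using Lim_bounded[OF flim[OF x]] by blast
  qed
  have rfix: "r x = x" if "x \<in> Q" "f x \<le> f a" for x
    using LIMSEQ_unique[OF lim[OF that(1)], of x] Tnfix[OF that(2)] by simp
  have rne: "r x \<noteq> a" if x: "x \<in> Q" "R / 8 \<le> dist x a" for x
  proof
    assume ra: "r x = a"
    \<comment> \<open>Reaching \<open>a\<close>, even in the limit, would mean crossing the annulus
      between \<open>R / 16\<close> and \<open>R / 8\<close> at a cost of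
      \<open>\<kappa> * (R / 16) = 2 * e\<close>, while only \<open>e\<close> is available.\<close>
    have "f ((T ^^ n) x) + \<kappa> * depth a (R/16) (R/8) ((T ^^ n) x) \<le> f a + e" for n
    proof (induction n)
      case 0
      then show ?case using x fQ[OF x(1)] depth_outer[of "R/16" "R/8" x a] R by simp
    next
      case (Suc n)
      have "f (T ((T ^^ n) x)) + \<kappa> * depth a (R/16) (R/8) (T ((T ^^ n) x))
        \<le> f ((T ^^ n) x) + \<kappa> * depth a (R/16) (R/8) ((T ^^ n) x)"
        unfolding T_def
        by (rule step_potential[OF ok[OF TnQ[OF x(1), unfolded T_def]] Qc[OF TnQ[OF x(1), unfolded T_def]]])
          (use R kap in auto)
      then show ?case using Suc by simp
    qed
    moreover have "(\<lambda>n. f ((T ^^ n) x) + \<kappa> * depth a (R/16) (R/8) ((T ^^ n) x))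
        \<longlonglongrightarrow> f (r x) + \<kappa> * depth a (R/16) (R/8) (r x)"
      unfolding depth_def by (intro tendsto_intros flim lim x)
    ultimately have "f (r x) + \<kappa> * depth a (R/16) (R/8) (r x) \<le> f a + e"
      by (intro LIMSEQ_le_const2) auto
    then have "\<kappa> * (R / 16) \<le> e" unfolding ra using depth_inner[of "R/16" "R/8" a a] R by simp
    then show False using kap(1) R by (simp add: e)
  qed
  show ?thesis
    using contr rcb frx rfix rne DQ continuous_on_subset by (intro exI[of _ r]) blast
qed

end

section \<open>Persistence of a zero under small perturbations of the gradient\<close>

lemma homotopic_with_canonI:
  assumes "continuous_on ({0..1::real} \<times> X) k" "\<And>t x. t \<in> {0..1} \<Longrightarrow> x \<in> X \<Longrightarrow> k (t, x) \<in> Y"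
    and "\<And>x. x \<in> X \<Longrightarrow> k (0, x) = f x" "\<And>x. x \<in> X \<Longrightarrow> k (1, x) = g x"
    and "\<And>t x. t \<in> {0..1} \<Longrightarrow> x \<in> A \<Longrightarrow> k (t, x) \<in> B" and AX: "A \<subseteq> X"
  shows "homotopic_with_canon (\<lambda>f. f \<in> A \<rightarrow> B) X Y f g"
proof -
  have "continuous_map (prod_topology (top_of_set {0..1}) (top_of_set X)) (top_of_set Y) k"
    using assms(1,2) by auto
  with assms show ?thesis
    by (subst homotopic_with) (auto simp: Pi_iff subset_iff intro!: exI[of _ k])
qed

context gradient_ball begin

text \<open>If \<open>U\<close> has no zero, its descent followed by the retraction carries all of
  the sublevel set into \<open>X - {a}\<close>, and compressibility makes the critical group
  trivial. The threshold \<open>\<delta>\<close> depends on \<open>f\<close> alone; the Lipschitz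
  constant \<open>K\<close> of \<open>U\<close> enters only the step size.\<close>

lemma close_gradient_has_zero:
  fixes \<Omega> :: "'a set"
  defines "X \<equiv> {z \<in> \<Omega>. f z \<le> f a}"
  assumes sub: "cball a R \<subseteq> \<Omega>" and contf: "continuous_on \<Omega> f"
    and Va: "V a = 0" and crit: "\<And>x. x \<in> cball a R \<Longrightarrow> x \<noteq> a \<Longrightarrow> V x \<noteq> 0"
    and nontriv: "\<not> trivial_group (relative_homology_group p (top_of_set X) (X - {a}))"
  shows "\<exists>\<delta>>0. \<forall>g U K.
     (\<forall>x\<in>cball a R. (g has_derivative (\<lambda>d. U x \<bullet> d)) (at x within cball a R)) \<and>
     (\<forall>x\<in>cball a R. \<forall>y\<in>cball a R. norm (U x - U y) \<le> K * norm (x - y)) \<and>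
     (\<forall>x\<in>cball a R. norm (U x - V x) \<le> \<delta>) \<longrightarrow> (\<exists>x\<in>cball a R. U x = 0)"
proof -
  obtain m where m: "m > 0" "\<forall>x\<in>cball a R. R / 16 \<le> dist x a \<longrightarrow> m \<le> norm (V x)"
    using gradient_bounded_below[OF crit, of "R / 16"] R by auto
  \<comment> \<open>With \<open>4 * \<kappa>\<close> for \<open>V\<close>, the perturbed gradient
    still has norm at least \<open>2 * \<kappa>\<close> outside radius
    \<open>R / 16\<close>.\<close>
  define \<kappa> where "\<kappa> = m / 4"
  have k0: "\<kappa> > 0" using m by (simp add: \<kappa>_def)
  have k4: "4 * \<kappa> \<le> norm (V x)" if "x \<in> cball a R" "R / 16 \<le> dist x a" for x
    using m that by (simp add: \<kappa>_def)
  then have k2: "2 * \<kappa> \<le> norm (V x)" if "x \<in> cball a R" "R / 16 \<le> dist x a" for x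
    using that k0 by fastforce
  define e where "e = \<kappa> * R / 32"
  have e0: "e > 0" using k0 R by (simp add: e_def)
  define D where "D = {x \<in> cball a (R / 2). f x \<le> f a + e}"
  obtain r where contr: "continuous_on D r" and rX: "\<And>x. x \<in> D \<Longrightarrow> r x \<in> cball a R \<and> f (r x) \<le> f a"
    and rfix: "\<And>x. x \<in> D \<Longrightarrow> f x \<le> f a \<Longrightarrow> r x = x"
    and rne: "\<And>x. x \<in> D \<Longrightarrow> R / 8 \<le> dist x a \<Longrightarrow> r x \<noteq> a"
    using retraction_onto_sublevel[OF Va crit k0 k2 e_def, folded D_def] by blast
  \<comment> \<open>The retraction is the identity on \<open>X \<inter> D\<close>, so it can be
    glued with the identity on the rest of \<open>X\<close>.\<close>
  define rr where "rr x = (if x \<in> D then r x else x)" for x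
  have DO: "D \<subseteq> \<Omega>" using sub R by (auto simp: D_def)
  have aO: "a \<in> \<Omega>" using sub R by auto
  have rrX: "rr x \<in> X" if "x \<in> X \<union> D" for x
    using that rX sub by (auto simp: rr_def X_def)
  have rrfix: "rr x = x" if "x \<in> X" for x using that rfix by (auto simp: rr_def X_def)
  have contrr: "continuous_on (X \<union> D) rr"
  proof -
    have "closedin (top_of_set (X \<union> D)) D"
    proof -
      have "continuous_on (cball a (R/2)) f" using cont_f by (rule continuous_on_subset) (use R in auto)
      then have "closed D" using continuous_closed_preimage[of "cball a (R/2)" f "{..f a + e}"]
        by (simp add: D_def vimage_def Int_def)
      then show ?thesis by (simp add: closed_subset)
    qed
    moreover have "closedin (top_of_set (X \<union> D)) X"
    proof -
      have "continuous_on (X \<union> D) f" using contf by (rule continuous_on_subset) (use DO in \<open>auto simp: X_def\<close>)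
      then have "closedin (top_of_set (X \<union> D)) ((X \<union> D) \<inter> f -` {..f a})"
        by (rule continuous_closedin_preimage) auto
      moreover have "(X \<union> D) \<inter> f -` {..f a} = X" using DO by (auto simp: X_def)
      ultimately show ?thesis by simp
    qed
    moreover have "continuous_on D rr" using contr by (rule continuous_on_eq) (simp add: rr_def)
    moreover have "continuous_on X rr" by (rule continuous_on_eq[of _ "\<lambda>x. x"]) (use rrfix in auto)
    ultimately show ?thesis using continuous_on_Un_local[of X D rr] by blast
  qed
  \<comment> \<open>A barrier of height \<open>4 * e\<close> over the ball of radius
    \<open>R / 8\<close>, vanishing outside radius \<open>R / 4\<close>. Its slope
    \<open>\<kappa>\<close> is what descent steps can pay, so the energy plus \<open>P\<close> does
    not increase along orbits.\<close>
  define P where "P x = \<kappa> * depth a (R/8) (R/4) x" for x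
  have Pb: "0 \<le> P x" "P x \<le> 4 * e" for x
    using depth_bounds[of "R/8" "R/4" a x] R k0 mult_left_mono[of "depth a (R/8) (R/4) x" "R/8" \<kappa>]
    by (auto simp: P_def e_def)
  have Pin: "P x = 4 * e" if "dist x a \<le> R / 8" for x
    using depth_inner[OF _ that, of "R/4"] R by (simp add: P_def e_def)
  have Pout: "P x = 0" if "R / 4 \<le> dist x a" for x
    using depth_outer[OF _ that, of "R/8"] R by (simp add: P_def)
  \<comment> \<open>Points near \<open>a\<close> belong to \<open>Y\<close> only if they lie well
    below the critical level; outside radius \<open>R / 4\<close> all of \<open>X\<close> belongs to
    it.\<close>
  define Y where "Y = {x \<in> X. f x + P x \<le> f a}"
  have aY: "a \<notin> Y" using Pin[of a] R e0 by (auto simp: Y_def)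
  have push: "\<exists>F n. homotopic_with (\<lambda>f. f \<in> X - {a} \<rightarrow> X - {a}) (top_of_set X) (top_of_set X) id F \<and> (F ^^ n) ` K \<subseteq> Y"
    if "compactin (top_of_set X) K" "K \<subseteq> X - {a}" for K
  proof -
    have cK: "compact K" using that(1) by (simp add: compactin_subtopology)
    obtain \<tau> where t: "\<tau> > 0" "\<tau> * M \<le> 1" "\<tau> * R * L \<le> 1 / 2" using exists_step_size[of 1] by auto
    define S where "S l = descent_step a (R/2) V (l * \<tau>)" for l
    have ok: "0 < R / 2" "R / 2 \<le> R" "0 \<le> l * \<tau>" "l * \<tau> * M \<le> 1" "l * \<tau> * R * L \<le> 1 / 2" if "l \<in> {0..1}" for l
    proof -
      have *: "l * \<tau> * z \<le> \<tau> * z" if "z \<ge> 0" for z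
        using t(1) \<open>l \<in> {0..1}\<close> that mult_right_mono[of l 1 "\<tau> * z"] by (simp add: mult.assoc)
      show "l * \<tau> * M \<le> 1" using *[OF M_nonneg] t by linarith
      have "R * L \<ge> 0" using R L by simp
      from *[OF this] show "l * \<tau> * R * L \<le> 1 / 2" using t(3) unfolding mult.assoc by linarith
    qed (use R t that in auto)
    have SX: "S l x \<in> X" if l: "l \<in> {0..1}" and x: "x \<in> X" for l x
    proof (cases "x \<in> cball a (R/2)")
      case True
      then show ?thesis using step_in[OF ok[OF l] True] step_decreases[OF ok[OF l] True] sub x R
        by (auto simp: S_def X_def subset_iff)
    next
      case False
      then show ?thesis using x step_outside[of "R/2" x] by (auto simp: S_def dist_commute)
    qed
    have Sa: "S l x \<noteq> a" if l: "l \<in> {0..1}" and x: "x \<noteq> a" for l x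
      unfolding S_def by (rule step_neq_critical[OF ok[OF l] Va x])
    have one: "(1::real) \<in> {0..1}" by simp
    define F where "F = S 1"
    have "homotopic_with (\<lambda>f. f \<in> X - {a} \<rightarrow> X - {a}) (top_of_set X) (top_of_set X) id F"
    proof (rule homotopic_with_canonI[where k = "\<lambda>(l,x). S l x"])
      show "continuous_on ({0..1} \<times> X) (\<lambda>(l, x). S l x)"
        unfolding S_def descent_step_def case_prod_beta
        by (intro continuous_intros continuous_on_compose2[OF continuous_on_cutoff_field]) (use R in auto)
    qed (use SX Sa in \<open>auto simp: F_def S_def descent_step_def\<close>)
    moreover have "\<exists>n. (F ^^ n) ` K \<subseteq> Y"
    proof -
      have FX: "F x \<in> X" if "x \<in> X" for x using SX[OF one that] by (simp add: F_def)
      have FY: "F x \<in> Y" if "x \<in> Y" for x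
      proof (cases "x \<in> cball a (R/2)")
        case True
        have "f (F x) + P (F x) \<le> f x + P x" unfolding F_def S_def P_def
          by (rule step_potential[OF ok[OF one] True]) (use R k0 k2 in auto)
        then show ?thesis using that FX by (auto simp: Y_def)
      next
        case False
        then show ?thesis using that step_outside[of "R/2" x] by (auto simp: F_def S_def dist_commute)
      qed
      let ?C = "K \<inter> cball a (R/4)"
      have FV: "f (F x) \<le> f x - \<tau> * (R / 4) / 2 * (norm (V x))\<^sup>2" if "x \<in> cball a (R/4)" for x
      proof -
        have x2: "x \<in> cball a (R/2)" using that R by auto
        have "\<tau> * (R / 4) / 2 * (norm (V x))\<^sup>2 \<le> 1 * \<tau> * (R/2 - dist x a) / 2 * (norm (V x))\<^sup>2"
          using t that by (intro mult_right_mono divide_right_mono) (auto simp: dist_commute)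
        then show ?thesis using step_estimates(1)[OF ok[OF one] x2] unfolding F_def S_def by linarith
      qed
      have contFV: "continuous_on (cball a (R/4)) V" using cont_V by (rule continuous_on_subset) (use R in auto)
      have V0: "V x \<noteq> 0" if "x \<in> cball a (R/4)" "x \<noteq> a" for x using crit[of x] that R by auto
      have "compact ?C" using cK by (intro compact_Int_closed) auto
      moreover have "continuous_on ?C V" using contFV by (rule continuous_on_subset) auto
      moreover have "V x \<noteq> 0" if "x \<in> ?C" for x using V0[of x] \<open>K \<subseteq> X - {a}\<close> that by auto
      \<comment> \<open>The compact set \<open>K\<close> keeps a positive distance from
        \<open>a\<close>, so the first step gains a uniform amount \<open>\<omega>\<close>. This
        excludes \<open>a\<close> from the compact set \<open>?E\<close>, on which all later steps
        gain a uniform \<open>\<mu>\<close>.\<close>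
      ultimately obtain m1 where m1: "m1 > 0" "\<forall>x\<in>?C. m1 \<le> norm (V x)"
        using norm_bounded_below_on_compact[of ?C V] by blast
      define \<omega> where "\<omega> = \<tau> * (R/4) / 2 * m1\<^sup>2"
      have om: "\<omega> > 0" using t R m1 by (simp add: \<omega>_def)
      have F1: "f (F x) \<le> f a - \<omega>" if x: "x \<in> ?C" for x
      proof -
        have "\<omega> \<le> \<tau> * (R / 4) / 2 * (norm (V x))\<^sup>2"
          using t R m1 x unfolding \<omega>_def by (intro mult_left_mono power_mono) auto
        moreover have "f x \<le> f a" using x \<open>K \<subseteq> X - {a}\<close> by (auto simp: X_def)
        ultimately show ?thesis using FV[of x] x by simp
      qed
      let ?E = "{x \<in> cball a (R/4). f x \<le> f a - \<omega>}"
      have "continuous_on (cball a (R/4)) f" using cont_f by (rule continuous_on_subset) (use R in auto)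
      then have "closed ?E" using continuous_closed_preimage[of "cball a (R/4)" f "{..f a - \<omega>}"]
        by (simp add: vimage_def Int_def)
      then have "compact ?E" using compact_Int_closed[of "cball a (R/4)" ?E]
        by (metis (no_types, lifting) compact_cball inf.absorb2 mem_Collect_eq subsetI)
      moreover have "continuous_on ?E V" using contFV by (rule continuous_on_subset) auto
      moreover have "V x \<noteq> 0" if "x \<in> ?E" for x using V0[of x] om that by (cases "x = a") auto
      ultimately obtain m2 where m2: "m2 > 0" "\<forall>x\<in>?E. m2 \<le> norm (V x)"
        using norm_bounded_below_on_compact[of ?E V] by blast
      define \<mu> where "\<mu> = \<tau> * (R/4) / 2 * m2\<^sup>2"
      have mu: "\<mu> > 0" using t R m2 by (simp add: \<mu>_def)
      have F2: "f (F x) \<le> f x - \<mu>" if x: "x \<in> ?E" for x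
      proof -
        have "\<mu> \<le> \<tau> * (R / 4) / 2 * (norm (V x))\<^sup>2"
          using t R m2 x unfolding \<mu>_def by (intro mult_left_mono power_mono) auto
        then show ?thesis using FV[of x] x by simp
      qed
      have inY: "x \<in> Y" if "x \<in> X" "R / 4 \<le> dist x a" for x
        using that Pout by (auto simp: Y_def X_def)
      have orb: "(F ^^ Suc n) x \<in> Y \<or> ((F ^^ Suc n) x \<in> X \<inter> cball a (R/4) \<and> f ((F ^^ Suc n) x) \<le> f a - \<omega> - real n * \<mu>)"
        if x: "x \<in> K" for x n
      proof (induction n)
        case 0
        have xX: "x \<in> X" using x \<open>K \<subseteq> X - {a}\<close> by auto
        show ?case
        proof (cases "x \<in> cball a (R/4)")
          case True
          then show ?thesis using F1[of x] x inY[OF FX[OF xX]] FX[OF xX] by (auto simp: dist_commute)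
        next
          case False
          then show ?thesis using FY[OF inY[OF xX]] by (auto simp: dist_commute)
        qed
      next
        case (Suc n)
        let ?y = "(F ^^ Suc n) x"
        show ?case
        proof (cases "?y \<in> Y")
          case True
          then show ?thesis using FY by auto
        next
          case False
          with Suc have y: "?y \<in> X \<inter> cball a (R/4)" "f ?y \<le> f a - \<omega> - real n * \<mu>" by auto
          then have "?y \<in> ?E" using mu by (auto intro: order_trans[of _ "f a - \<omega> - real n * \<mu>"])
          from F2[OF this] have "f (F ?y) \<le> f a - \<omega> - real (Suc n) * \<mu>" using y(2) by (simp add: algebra_simps)
          then show ?thesis using inY[of "F ?y"] FX[of ?y] y(1) by (auto simp: dist_commute)
        qed
      qed
      \<comment> \<open>After this descent the barrier, of height at most \<open>4 * e\<close>, is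
        outweighed.\<close>
      obtain n where n: "real n * \<mu> > 4 * e" using mu reals_Archimedean3 by blast
      have "(F ^^ Suc n) x \<in> Y" if "x \<in> K" for x
      proof (rule ccontr)
        assume no: "(F ^^ Suc n) x \<notin> Y"
        then have "f ((F ^^ Suc n) x) \<le> f a - \<omega> - real n * \<mu>" "(F ^^ Suc n) x \<in> X"
          using orb[OF that, of n] by blast+
        then show False using n om no Pb(2)[of "(F ^^ Suc n) x"] unfolding Y_def mem_Collect_eq by linarith
      qed
      then show ?thesis by blast
    qed
    ultimately show ?thesis by blast
  qed
  have main: "\<exists>x\<in>cball a R. U x = 0"
    if gder: "\<forall>x\<in>cball a R. (g has_derivative (\<lambda>d. U x \<bullet> d)) (at x within cball a R)"
      and glip: "\<forall>x\<in>cball a R. \<forall>y\<in>cball a R. norm (U x - U y) \<le> K * norm (x - y)"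
      and UV: "\<forall>x\<in>cball a R. norm (U x - V x) \<le> \<kappa> / 64" for g U K
  proof (rule ccontr)
    assume "\<not> (\<exists>x\<in>cball a R. U x = 0)"
    then have U0: "U x \<noteq> 0" if "x \<in> cball a R" for x using that by blast
    \<comment> \<open>Normalised to agree with \<open>f\<close> at \<open>a\<close>. The gradients
      differ by at most \<open>\<kappa> / 64\<close>, so on the ball the functions differ by at most
      \<open>\<kappa> / 64 * R = e / 2\<close>.\<close>
    define h where "h x = g x - g a + f a" for x
    have hder: "(h has_derivative (\<lambda>d. U x \<bullet> d)) (at x within cball a R)" if "x \<in> cball a R" for x
      unfolding h_def using gder[rule_format, OF that] by (auto intro!: derivative_eq_intros)
    interpret h: gradient_ball a R "max 0 K" "M + \<kappa> / 64" h U
    proof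
      fix x y assume x: "x \<in> cball a R" and y: "y \<in> cball a R"
      show "norm (U x - U y) \<le> max 0 K * norm (x - y)"
        using glip[rule_format, OF x y] mult_right_mono[OF max.cobounded2[of K 0] norm_ge_zero[of "x - y"]] by linarith
    next
      fix x assume x: "x \<in> cball a R"
      then show "norm (U x) \<le> M + \<kappa> / 64"
        using bnd[OF x] UV norm_triangle_sub[of "U x" "V x"] by force
    qed (use R hder in auto)
    have hf: "h x \<le> f x + e / 2 \<and> f x \<le> h x + e / 2" if x: "x \<in> cball a R" for x
    proof -
      have "norm ((h x - f x) - (h a - f a)) \<le> \<kappa> / 64 * norm (x - a)"
      proof (rule differentiable_bound[of "cball a R" "\<lambda>x. h x - f x" "\<lambda>x d. U x \<bullet> d - V x \<bullet> d"])
        fix z assume z: "z \<in> cball a R"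
        show "((\<lambda>x. h x - f x) has_derivative (\<lambda>d. U z \<bullet> d - V z \<bullet> d)) (at z within cball a R)"
          using hder[OF z] der[OF z] by (auto intro!: derivative_eq_intros)
        show "onorm (\<lambda>d. U z \<bullet> d - V z \<bullet> d) \<le> \<kappa> / 64"
        proof (rule onorm_bound)
          fix d
          have "norm (U z \<bullet> d - V z \<bullet> d) \<le> norm (U z - V z) * norm d"
            by (metis inner_diff_left real_norm_def Cauchy_Schwarz_ineq2)
          also have "\<dots> \<le> \<kappa> / 64 * norm d" using UV z by (intro mult_right_mono) auto
          finally show "norm (U z \<bullet> d - V z \<bullet> d) \<le> \<kappa> / 64 * norm d" .
        qed (use k0 in auto)
      qed (use x R in auto)
      also have "\<dots> \<le> \<kappa> / 64 * R"
        using x k0 by (intro mult_left_mono) (auto simp: dist_norm norm_minus_commute)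
      finally have "\<bar>h x - f x\<bar> \<le> e / 2" by (simp add: h_def e_def)
      then show ?thesis by linarith
    qed
    have kU: "2 * \<kappa> \<le> norm (U x)" if "x \<in> cball a R" "R / 16 \<le> dist x a" for x
      using k4[OF that] UV[rule_format, OF that(1)] norm_triangle_ineq2[of "V x" "U x"] k0
      by (simp add: norm_minus_commute)
    obtain \<tau> where t: "\<tau> > 0" "\<tau> * (M + \<kappa> / 64) \<le> 1" "\<tau> * R * max 0 K \<le> 1 / 2"
      using h.exists_step_size[of 1] by auto
    define S where "S l = descent_step a (R/2) U (l * \<tau>)" for l
    have ok: "0 < R / 2" "R / 2 \<le> R" "0 \<le> l * \<tau>" "l * \<tau> * (M + \<kappa> / 64) \<le> 1" "l * \<tau> * R * max 0 K \<le> 1 / 2"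
      if "l \<in> {0..1}" for l
    proof -
      have *: "l * \<tau> * z \<le> \<tau> * z" if "z \<ge> 0" for z
        using t(1) \<open>l \<in> {0..1}\<close> that mult_right_mono[of l 1 "\<tau> * z"] by (simp add: mult.assoc)
      show "l * \<tau> * (M + \<kappa> / 64) \<le> 1" using *[OF h.M_nonneg] t by linarith
      have "R * max 0 K \<ge> 0" using R by simp
      from *[OF this] show "l * \<tau> * R * max 0 K \<le> 1 / 2" using t(3) unfolding mult.assoc by linarith
    qed (use R t that in auto)
    have one: "(1::real) \<in> {0..1}" by simp
    \<comment> \<open>The margin \<open>e / 2\<close> is used twice: \<open>D'\<close> contains the
      part of \<open>X\<close> in the ball of radius \<open>R / 2\<close>, and it is contained in
      \<open>D\<close>. Hence \<open>Z\<close> contains \<open>X\<close>, is invariant under descent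
      for \<open>h\<close>, and lies in the domain of the retraction.\<close>
    define D' where "D' = {x \<in> cball a (R/2). h x \<le> f a + e / 2}"
    define Z where "Z = X \<union> D'"
    have cR: "x \<in> cball a R" if "x \<in> cball a (R/2)" for x using that R by auto
    have D'D: "D' \<subseteq> D"
    proof
      fix x assume "x \<in> D'"
      then show "x \<in> D" using hf[OF cR[of x]] unfolding D'_def D_def by auto
    qed
    have XD': "x \<in> D'" if "x \<in> Z" "x \<in> cball a (R/2)" for x
      using that hf[OF cR[OF that(2)]] by (auto simp: D'_def Z_def X_def)
    have Sout: "S l x = x" if "x \<notin> cball a (R/2)" for l x
      using that h.step_outside[of "R/2" x] by (auto simp: S_def dist_commute)
    have SZ: "S l x \<in> Z" if l: "l \<in> {0..1}" and x: "x \<in> Z" for l x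
    proof (cases "x \<in> cball a (R/2)")
      case True
      have "S l x \<in> D'" using XD'[OF x True] h.step_in[OF ok[OF l] True] h.step_decreases[OF ok[OF l] True]
        by (auto simp: D'_def S_def)
      then show ?thesis by (simp add: Z_def)
    qed (use x Sout in auto)
    \<comment> \<open>Counterpart of \<open>Y\<close> for the perturbed energy: it contains
      \<open>Y\<close>, and descent for \<open>h\<close> cannot leave it.\<close>
    define Y' where "Y' = {x \<in> Z. x \<in> cball a (R/2) \<longrightarrow> h x + P x \<le> f a + e / 2}"
    have YY': "Y \<subseteq> Y'"
    proof
      fix x assume x: "x \<in> Y"
      then show "x \<in> Y'" using hf[OF cR[of x]] by (auto simp: Y_def Y'_def Z_def)
    qed
    have SY': "S l x \<in> Y'" if l: "l \<in> {0..1}" and x: "x \<in> Y'" for l x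
    proof (cases "x \<in> cball a (R/2)")
      case True
      have "h (S l x) + P (S l x) \<le> h x + P x" unfolding S_def P_def
        by (rule h.step_potential[OF ok[OF l] True]) (use R k0 kU in auto)
      then show ?thesis using x True SZ[OF l, of x] by (auto simp: Y'_def)
    qed (use x Sout in auto)
    have rrY': "rr x \<noteq> a" if x: "x \<in> Y'" for x
    proof (cases "x \<in> cball a (R/2)")
      case False
      then have "x \<in> X" using x by (auto simp: Y'_def Z_def D'_def)
      then show ?thesis using rrfix[of x] False R by auto
    next
      case True
      \<comment> \<open>Within radius \<open>R / 8\<close> the barrier forces
        \<open>f x < f a\<close> despite the two errors of \<open>e / 2\<close>, so the retraction
        fixes \<open>x\<close>. Farther out it is the retraction itself that avoids
        \<open>a\<close>.\<close>
      show ?thesis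
      proof (cases "dist x a \<le> R / 8")
        case d: True
        have "f x < f a" using x True Pin[OF d] hf[OF cR[OF True]] e0 by (auto simp: Y'_def)
        then have "x \<in> X" "x \<noteq> a" using cR[OF True] sub by (auto simp: X_def)
        then show ?thesis using rrfix by auto
      next
        case False
        have "x \<in> D" using XD'[of x] True x D'D by (auto simp: Y'_def)
        then show ?thesis using rne[of x] False by (simp add: rr_def)
      qed
    qed
    \<comment> \<open>Retracting after the descent returns to \<open>X\<close>. Consecutive maps are
      joined by the partial steps \<open>S l\<close>, which yields a homotopy from the identity to
      every \<open>G n\<close>.\<close>
    define G where "G n x = rr (((S 1) ^^ n) x)" for n x
    have SnZ: "((S 1) ^^ n) x \<in> Z" if "x \<in> Z" for n x
      by (induction n) (use that SZ[OF one] in auto)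
    have SnY': "((S 1) ^^ n) x \<in> Y'" if "x \<in> Y'" for n x
      by (induction n) (use that SY'[OF one] in auto)
    have ZX: "Z \<subseteq> X \<union> D" using D'D by (auto simp: Z_def)
    have contS: "continuous_on UNIV (\<lambda>p. S (fst p) (snd p))"
      unfolding S_def descent_step_def
      by (intro continuous_intros continuous_on_compose2[OF h.continuous_on_cutoff_field]) (use R in auto)
    have contSn: "continuous_on UNIV ((S 1) ^^ n)" for n
    proof (induction n)
      case (Suc n)
      have "continuous_on UNIV (\<lambda>x. (\<lambda>p. S (fst p) (snd p)) (1, ((S 1) ^^ n) x))"
        by (rule continuous_on_compose2[OF contS]) (use Suc in \<open>auto intro!: continuous_intros\<close>)
      then show ?case by (simp add: o_def)
    qed (simp add: id_def)
    have hstep: "homotopic_with (\<lambda>f. f \<in> Y \<rightarrow> X - {a}) (top_of_set X) (top_of_set X) (G n) (G (Suc n))" for n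
    proof (rule homotopic_with_canonI[where k = "\<lambda>p. rr (S (fst p) (((S 1) ^^ n) (snd p)))"])
      show "continuous_on ({0..1} \<times> X) (\<lambda>p. rr (S (fst p) (((S 1) ^^ n) (snd p))))"
      proof (rule continuous_on_compose2[OF contrr])
        show "continuous_on ({0..1} \<times> X) (\<lambda>p. S (fst p) (((S 1) ^^ n) (snd p)))"
        proof -
          have "continuous_on ({0..1} \<times> X) (\<lambda>p. (fst p, ((S 1) ^^ n) (snd p)))"
            by (intro continuous_intros continuous_on_compose2[OF contSn]) auto
          from continuous_on_compose2[OF contS this] show ?thesis by simp
        qed
        show "(\<lambda>p. S (fst p) (((S 1) ^^ n) (snd p))) ` ({0..1} \<times> X) \<subseteq> X \<union> D"
        proof clarsimp
          fix l :: real and x assume "x \<in> X" "0 \<le> l" "l \<le> 1" "S l (((S 1) ^^ n) x) \<notin> D"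
          then show "S l (((S 1) ^^ n) x) \<in> X"
            using SZ[of l, OF _ SnZ[of x n]] ZX by (auto simp: Z_def)
        qed
      qed
    next
      fix l x assume l: "l \<in> {0..1::real}" and x: "x \<in> X"
      show "rr (S (fst (l, x)) ((S 1 ^^ n) (snd (l, x)))) \<in> X"
        using SZ[OF l SnZ[of x n]] x ZX rrX by (auto simp: Z_def)
    next
      fix l x assume l: "l \<in> {0..1::real}" and x: "x \<in> Y"
      have y: "S l ((S 1 ^^ n) x) \<in> Y'" using SY'[OF l SnY'] x YY' by blast
      then show "rr (S (fst (l, x)) ((S 1 ^^ n) (snd (l, x)))) \<in> X - {a}"
        using rrY'[OF y] rrX ZX by (auto simp: Y'_def)
    qed (auto simp: G_def S_def descent_step_def Y_def)
    have hid: "homotopic_with (\<lambda>f. f \<in> Y \<rightarrow> X - {a}) (top_of_set X) (top_of_set X) id (G n)" for n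
    proof (induction n)
      case 0
      show ?case
        by (rule homotopic_with_equal) (use aY rrfix in \<open>auto simp: G_def Y_def\<close>)
    next
      case (Suc n)
      then show ?case using hstep homotopic_with_trans by blast
    qed
    \<comment> \<open>The contradiction hypothesis enters here: \<open>U\<close> is bounded away
      from zero on the whole ball, including its centre, so every orbit in \<open>Z\<close> reaches
      \<open>Y'\<close> in a common number of steps.\<close>
    have "compact (cball a R)" by simp
    then obtain \<nu> where nu: "\<nu> > 0" "\<forall>x\<in>cball a R. \<nu> \<le> norm (U x)"
      using norm_bounded_below_on_compact[OF _ h.cont_V] U0 by blast
    define \<mu> where "\<mu> = \<tau> * (R/4) / 2 * \<nu>\<^sup>2"
    have mu: "\<mu> > 0" using t R nu by (simp add: \<mu>_def)
    have drop: "h (S 1 x) \<le> h x - \<mu>" if x: "x \<in> cball a (R/4)" for x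
    proof -
      have x2: "x \<in> cball a (R/2)" using x R by auto
      have "\<mu> \<le> 1 * \<tau> * (R/2 - dist x a) / 2 * (norm (U x))\<^sup>2" unfolding \<mu>_def
        using t x R nu cR[OF x2] by (intro mult_mono divide_right_mono power_mono) (auto simp: dist_commute)
      then show ?thesis using h.step_estimates(1)[OF ok[OF one] x2] unfolding S_def by linarith
    qed
    have inY': "x \<in> Y'" if "x \<in> Z" "R / 4 \<le> dist x a" for x
      using that Pout XD'[of x] by (auto simp: Y'_def D'_def)
    have orb: "(S 1 ^^ n) x \<in> Y' \<or> ((S 1 ^^ n) x \<in> cball a (R/4) \<and> h ((S 1 ^^ n) x) \<le> f a + e / 2 - real n * \<mu>)"
      if x: "x \<in> Z" for x n
    proof (induction n)
      case 0
      show ?case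
      proof (cases "x \<in> cball a (R/4)")
        case True
        then have "x \<in> cball a (R/2)" using R by auto
        then show ?thesis using True XD'[OF x] by (auto simp: D'_def)
      qed (use inY'[OF x] in \<open>auto simp: dist_commute\<close>)
    next
      case (Suc n)
      let ?y = "(S 1 ^^ n) x"
      show ?case
      proof (cases "?y \<in> Y'")
        case True
        then show ?thesis using SY'[OF one] by auto
      next
        case False
        with Suc have y: "?y \<in> cball a (R/4)" "h ?y \<le> f a + e / 2 - real n * \<mu>" by auto
        have "h (S 1 ?y) \<le> f a + e / 2 - real (Suc n) * \<mu>" using drop[OF y(1)] y(2) by (simp add: algebra_simps)
        then show ?thesis using inY'[OF SZ[OF one SnZ[OF x, of n]]] by (auto simp: dist_commute)
      qed
    qed
    obtain n where n: "real n * \<mu> > 4 * e" using mu reals_Archimedean3 by blast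
    have fin: "(S 1 ^^ n) x \<in> Y'" if "x \<in> Z" for x
    proof (rule ccontr)
      assume no: "(S 1 ^^ n) x \<notin> Y'"
      then have "h ((S 1 ^^ n) x) \<le> f a + e / 2 - real n * \<mu>" using orb[OF that, of n] by blast
      then show False using n no Pb(2)[of "(S 1 ^^ n) x"] SnZ[OF that, of n]
        unfolding Y'_def mem_Collect_eq by linarith
    qed
    have "trivial_group (relative_homology_group p (top_of_set X) (X - {a}))"
    proof (rule trivial_relative_homology_group_if_compressible[OF _ push hid])
      show "Y \<subseteq> X - {a}" using aY by (auto simp: Y_def)
      show "G n \<in> topspace (top_of_set X) \<rightarrow> X - {a}"
      proof
        fix x assume "x \<in> topspace (top_of_set X)"
        then have y: "(S 1 ^^ n) x \<in> Y'" using fin[of x] by (auto simp: Z_def)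
        then have "(S 1 ^^ n) x \<in> X \<union> D" using ZX by (auto simp: Y'_def)
        then show "G n x \<in> X - {a}" using rrY'[OF y] rrX by (simp add: G_def)
      qed
    qed auto
    then show False using nontriv by contradiction
  qed
  show ?thesis
  proof (intro exI[of _ "\<kappa> / 64"] conjI allI impI)
    show "\<kappa> / 64 > 0" using k0 by simp
    fix g :: "'a \<Rightarrow> real" and U K
    assume "(\<forall>x\<in>cball a R. (g has_derivative (\<lambda>d. U x \<bullet> d)) (at x within cball a R)) \<and>
      (\<forall>x\<in>cball a R. \<forall>y\<in>cball a R. norm (U x - U y) \<le> K * norm (x - y)) \<and>
      (\<forall>x\<in>cball a R. norm (U x - V x) \<le> \<kappa> / 64)"
    then show "\<exists>x\<in>cball a R. U x = 0" using main[of g U K] by blast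
  qed
qed

end

section \<open>Periodic functions and Fourier coefficients\<close>

definition per :: "(real \<Rightarrow> 'a::euclidean_space) \<Rightarrow> bool" where
  "per f \<longleftrightarrow> continuous_on UNIV f \<and> (\<forall>t. f (t + 2 * pi) = f t)"

definition avg :: "(real \<Rightarrow> 'a::euclidean_space) \<Rightarrow> 'a" where
  "avg f = (1 / (2 * pi)) *\<^sub>R integral {0..2*pi} f"

lemma per_cont: "per f \<Longrightarrow> continuous_on S f"
  unfolding per_def using continuous_on_subset by blast

lemma per_shift: "per f \<Longrightarrow> f (t + 2 * pi) = f t"
  by (simp add: per_def)

lemma per_int: "per f \<Longrightarrow> f (t + 2 * pi * of_int n) = f t" 
proof -
  assume f: "per f"
  have nat: "f (t + 2 * pi * real n) = f t" for n t
  proof (induction n)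
    case (Suc n)
    have "t + 2 * pi * real (Suc n) = t + 2 * pi * real n + 2 * pi" by (simp add: algebra_simps)
    then show ?case using per_shift[OF f, of "t + 2 * pi * real n"] Suc by metis
  qed simp
  show ?thesis
  proof (cases "n \<ge> 0")
    case True
    then show ?thesis using nat[of t "nat n"] by simp
  next
    case False
    then show ?thesis using nat[of "t + 2 * pi * of_int n" "nat (- n)"] by simp
  qed
qed

lemma per_int_on: "per f \<Longrightarrow> f integrable_on {a..b}"
  by (intro integrable_continuous_real per_cont)

lemma per_bounded: "per f \<Longrightarrow> \<exists>B\<ge>0. \<forall>t. norm (f t) \<le> B"
proof -
  assume f: "per f"
  have "compact (f ` {0..2*pi})" by (intro compact_continuous_image per_cont f) auto
  then obtain B where B: "\<forall>x\<in>f ` {0..2*pi}. norm x \<le> B" using compact_imp_bounded bounded_iff by blast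
  have "norm (f t) \<le> B" for t
  proof -
    define n where "n = \<lfloor>t / (2 * pi)\<rfloor>"
    have "of_int n \<le> t / (2 * pi)" "t / (2 * pi) < of_int n + 1" unfolding n_def by linarith+
    then have "0 \<le> t - 2 * pi * of_int n" "t - 2 * pi * of_int n \<le> 2 * pi"
      by (auto simp: field_simps)
    then have "norm (f (t - 2 * pi * of_int n)) \<le> B" using B by auto
    then show ?thesis using per_int[OF f, of "t - 2 * pi * of_int n" n] by simp
  qed
  then show ?thesis by (intro exI[of _ "max B 0"]) (simp add: le_max_iff_disj)
qed

lemma per_cis: "per (\<lambda>t. cis (of_int n * t))"
  unfolding per_def
proof (intro conjI allI)
  fix t
  have "cis (of_int n * (t + 2 * pi)) = cis (of_int n * t) * cis (2 * pi * of_int n)"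
    by (simp add: cis_mult algebra_simps)
  also have "cis (2 * pi * of_int n) = 1" by (simp add: complex_eq_iff cos_int_2pin sin_int_2pin)
  finally show "cis (of_int n * (t + 2 * pi)) = cis (of_int n * t)" by simp
qed (intro continuous_intros)

lemma per_cis1: "per cis" using per_cis[of 1] by simp

lemma per_const [simp]: "per (\<lambda>t. c)" by (simp add: per_def)
lemma per_add: "per f \<Longrightarrow> per g \<Longrightarrow> per (\<lambda>t. f t + g t)" by (auto simp: per_def intro: continuous_intros)
lemma per_diff: "per f \<Longrightarrow> per g \<Longrightarrow> per (\<lambda>t. f t - g t)" by (auto simp: per_def intro: continuous_intros)
lemma per_minus: "per f \<Longrightarrow> per (\<lambda>t. - f t)" by (auto simp: per_def intro: continuous_intros)
lemma per_mult: "per f \<Longrightarrow> per g \<Longrightarrow> per (\<lambda>t. f t * g t :: 'a::{euclidean_space,real_normed_algebra})"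
  by (auto simp: per_def intro: continuous_intros)
lemma per_cnj: "per f \<Longrightarrow> per (\<lambda>t. cnj (f t))" by (auto simp: per_def intro: continuous_intros)
lemma per_of_real: "per f \<Longrightarrow> per (\<lambda>t. complex_of_real (f t))" by (auto simp: per_def intro: continuous_intros)
lemma per_inner: "per f \<Longrightarrow> per g \<Longrightarrow> per (\<lambda>t. f t \<bullet> g t)" by (auto simp: per_def intro: continuous_intros)
lemma per_translate: "per f \<Longrightarrow> per (\<lambda>t. f (t + c))"
  unfolding per_def
  by (auto intro!: continuous_intros continuous_on_compose2[of UNIV f]) (metis add.assoc add.commute)
lemma per_sum: "(\<And>i. i \<in> I \<Longrightarrow> per (f i)) \<Longrightarrow> per (\<lambda>t. \<Sum>i\<in>I. f i t)"
  by (auto simp: per_def intro: continuous_intros)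
lemma per_compose: "per f \<Longrightarrow> continuous_on UNIV h \<Longrightarrow> per (\<lambda>t. h (f t))"
  unfolding per_def by (auto intro: continuous_on_compose2)

lemmas per_intros = per_const per_add per_diff per_minus per_mult per_cnj per_of_real per_inner per_translate
  per_sum per_cis per_cis1

lemma avg_add: "per f \<Longrightarrow> per g \<Longrightarrow> avg (\<lambda>t. f t + g t) = avg f + avg g"
  by (simp add: avg_def integral_add per_int_on scaleR_add_right)

lemma avg_diff: "per f \<Longrightarrow> per g \<Longrightarrow> avg (\<lambda>t. f t - g t) = avg f - avg g"
  by (simp add: avg_def integral_diff per_int_on scaleR_diff_right)

lemma avg_linear:
  assumes "bounded_linear h" "per f"
  shows "avg (\<lambda>t. h (f t)) = h (avg f)"
proof -
  interpret bounded_linear h by fact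
  show ?thesis using integral_linear[OF per_int_on[OF assms(2)] assms(1), of 0 "2*pi"]
    by (simp add: avg_def o_def scaleR)
qed

lemma avg_cmult: "per f \<Longrightarrow> avg (\<lambda>t. c * f t) = c * avg (f :: real \<Rightarrow> complex)"
  by (rule avg_linear[OF bounded_linear_mult_right])

lemma avg_cnj: "per f \<Longrightarrow> avg (\<lambda>t. cnj (f t)) = cnj (avg f)"
  by (rule avg_linear[OF bounded_linear_cnj])

lemma avg_sum: "(\<And>i. i \<in> I \<Longrightarrow> per (f i)) \<Longrightarrow> avg (\<lambda>t. \<Sum>i\<in>I. f i t) = (\<Sum>i\<in>I. avg (f i))"
proof (induction I rule: infinite_finite_induct)
  case (insert i I)
  then show ?case by (simp add: avg_add per_sum)
qed (auto simp: avg_def)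

lemma avg_const [simp]: "avg (\<lambda>t. c) = c"
  by (simp add: avg_def)

lemma norm_avg_le:
  assumes "per f" "\<And>t. norm (f t) \<le> B"
  shows "norm (avg f) \<le> B"
proof -
  have "norm (integral {0..2*pi} f) \<le> B * (2 * pi - 0)"
    by (rule integral_bound) (use assms per_cont in auto)
  then show ?thesis by (simp add: avg_def field_simps)
qed

lemma avg_mono: "per f \<Longrightarrow> per g \<Longrightarrow> (\<And>t. f t \<le> g t) \<Longrightarrow> avg f \<le> (avg g :: real)"
  unfolding avg_def using integral_le[OF per_int_on per_int_on, of f g 0 "2*pi"]
  by (simp add: divide_right_mono)

lemma continuous_has_antiderivative:
  fixes f :: "real \<Rightarrow> 'a::euclidean_space"
  assumes "continuous_on UNIV f"
  obtains F where "\<And>t. (F has_vector_derivative f t) (at t)"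
proof -
  have "\<exists>F. \<forall>x :: real. (-\<infinity>::ereal) < x \<longrightarrow> x < (\<infinity>::ereal) \<longrightarrow> (F has_vector_derivative f x) (at x)"
    by (rule einterval_antiderivative) (use assms in \<open>auto simp: continuous_on_eq_continuous_at\<close>)
  then show ?thesis using that by auto
qed

lemma integral_antiderivative:
  fixes F f :: "real \<Rightarrow> 'a::euclidean_space"
  assumes "\<And>t. (F has_vector_derivative f t) (at t)" "a \<le> b"
  shows "integral {a..b} f = F b - F a"
proof (rule integral_unique)
  show "(f has_integral F b - F a) {a..b}"
    by (rule fundamental_theorem_of_calculus) (use assms has_vector_derivative_at_within in blast)+
qed

lemma has_vector_derivative_translate:
  assumes "\<And>t. (F has_vector_derivative f t) (at t)"
  shows "((\<lambda>t. F (t + c)) has_vector_derivative f (t + c)) (at t)"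
proof -
  have "((\<lambda>t. t + c) has_vector_derivative 1) (at t)"
    by (auto intro!: derivative_eq_intros)
  from vector_diff_chain_at[OF this assms] show ?thesis by (simp add: o_def)
qed

lemma avg_derivative:
  assumes "\<And>t. (F has_vector_derivative f t) (at t)" "per F"
  shows "avg f = 0"
  using integral_antiderivative[of F f 0 "2*pi"] assms per_shift[of F 0] by (simp add: avg_def)

lemma antiderivative_periodic:
  assumes F: "\<And>t. (F has_vector_derivative f t) (at t)" and f: "per f" and z: "avg f = 0"
  shows "per F"
  unfolding per_def
proof (intro conjI allI)
  show "continuous_on UNIV F"
    using F has_vector_derivative_continuous continuous_at_imp_continuous_on by blast
  fix t
  have "((\<lambda>t. F (t + 2 * pi) - F t) has_vector_derivative 0) (at t)" for t
    using has_vector_derivative_diff[OF has_vector_derivative_translate[OF F, where c = "2 * pi"] F, of t]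
    by (simp only: per_shift[OF f] diff_self)
  then have "((\<lambda>t. F (t + 2 * pi) - F t) has_derivative (\<lambda>h. 0)) (at t within UNIV)" for t
    by (simp add: has_vector_derivative_def)
  then have "F (t + 2 * pi) - F t = F (0 + 2 * pi) - F 0"
    using has_derivative_zero_unique[of UNIV "\<lambda>t. F (t + 2 * pi) - F t" t 0] by simp
  then show "F (t + 2 * pi) = F t"
    using z integral_antiderivative[of F f 0 "2*pi"] F by (simp add: avg_def)
qed

text \<open>The function \<open>f - avg f\<close> has a periodic antiderivative, and this property
  is invariant under translation.\<close>

lemma avg_translate:
  assumes f: "per f"
  shows "avg (\<lambda>t. f (t + c)) = avg f"
proof -
  obtain F where F: "\<And>t. (F has_vector_derivative f t - avg f) (at t)"
    using continuous_has_antiderivative[of "\<lambda>t. f t - avg f"] per_diff[OF f per_const] per_cont by blast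
  have p: "per (\<lambda>t. f t - avg f)" using f by (intro per_intros)
  have "avg (\<lambda>t. f t - avg f) = 0" using avg_diff[OF f per_const, of "avg f"] by simp
  then have pF: "per F" using antiderivative_periodic[OF F p] by blast
  have "((\<lambda>t. F (t + c)) has_vector_derivative f (t + c) - avg f) (at t)" for t
    by (rule has_vector_derivative_translate[OF F])
  then have "avg (\<lambda>t. f (t + c) - avg f) = 0"
    by (rule avg_derivative) (rule per_translate[OF pF])
  then show ?thesis using avg_diff[OF per_translate[OF f] per_const, of c "avg f"] by simp
qed

section \<open>Fourier coefficients, uniqueness and absolutely convergent series\<close>

definition fc :: "(real \<Rightarrow> complex) \<Rightarrow> int \<Rightarrow> complex" where
  "fc f n = avg (\<lambda>t. f t * cis (- (of_int n * t)))"

lemma per_cis_neg: "per (\<lambda>t. cis (- (of_int n * t)))"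
  using per_cis[of "- n"] by simp

lemma per_fc: "per f \<Longrightarrow> per (\<lambda>t. f t * cis (- (of_int n * t)))"
  by (intro per_intros per_cis_neg)

lemma fc_add: "per f \<Longrightarrow> per g \<Longrightarrow> fc (\<lambda>t. f t + g t) n = fc f n + fc g n"
  unfolding fc_def using avg_add[OF per_fc per_fc, of f g] by (simp add: distrib_right)

lemma fc_diff: "per f \<Longrightarrow> per g \<Longrightarrow> fc (\<lambda>t. f t - g t) n = fc f n - fc g n"
  unfolding fc_def using avg_diff[OF per_fc per_fc, of f g] by (simp add: left_diff_distrib)

lemma fc_cmult: "per f \<Longrightarrow> fc (\<lambda>t. c * f t) n = c * fc f n"
  unfolding fc_def using avg_cmult[OF per_fc, of f c] by (simp add: mult.assoc)

lemma fc_sum: "(\<And>i. i \<in> I \<Longrightarrow> per (f i)) \<Longrightarrow> fc (\<lambda>t. \<Sum>i\<in>I. f i t) n = (\<Sum>i\<in>I. fc (f i) n)"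
  unfolding fc_def sum_distrib_right by (rule avg_sum) (rule per_fc)

lemma fc_translate: "per f \<Longrightarrow> fc (\<lambda>t. f (t + c)) n = cis (of_int n * c) * fc f n"
proof -
  assume f: "per f"
  have "fc (\<lambda>t. f (t + c)) n = avg (\<lambda>t. cis (of_int n * c) * (f (t + c) * cis (- (of_int n * (t + c)))))"
    unfolding fc_def by (rule arg_cong[of _ _ avg]) (auto simp: cis_mult algebra_simps)
  also have "\<dots> = cis (of_int n * c) * avg (\<lambda>t. f (t + c) * cis (- (of_int n * (t + c))))"
    by (rule avg_cmult) (rule per_translate[OF per_fc[OF f]])
  also have "avg (\<lambda>t. f (t + c) * cis (- (of_int n * (t + c)))) = fc f n"
    unfolding fc_def by (rule avg_translate[OF per_fc[OF f]])
  finally show ?thesis .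
qed

lemma fc_shift: "fc (\<lambda>t. cis (of_int k * t) * f t) n = fc f (n - k)"
  unfolding fc_def by (rule arg_cong[of _ _ avg]) (auto simp: cis_mult algebra_simps)

lemma fc_cnj: "per f \<Longrightarrow> fc (\<lambda>t. cnj (f t)) n = cnj (fc f (- n))"
  unfolding fc_def by (subst avg_cnj[symmetric, OF per_fc]) (auto simp: cis_cnj)

lemma avg_cis: "avg (\<lambda>t. cis (of_int n * t)) = (if n = 0 then 1 else 0)"
proof (cases "n = 0")
  case False
  have "((\<lambda>t. cis (of_int n * t) / (\<i> * of_int n)) has_vector_derivative cis (of_int n * t)) (at t)" for t
  proof -
    have "((\<lambda>t. cis (of_int n * t)) has_vector_derivative (of_int n *\<^sub>R (\<i> * cis (of_int n * t)))) (at t)"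
      by (rule vector_diff_chain_at[of "\<lambda>t. of_int n * t" _ _ cis, unfolded o_def])
        (auto intro!: derivative_eq_intros simp: has_vector_derivative_def cis_conv_exp mult_ac scaleR_conv_of_real)
    then show ?thesis using False
      by (auto intro!: derivative_eq_intros has_vector_derivative_divide simp: scaleR_conv_of_real field_simps)
  qed
  moreover have "per (\<lambda>t. cis (of_int n * t) / (\<i> * of_int n))"
    using per_mult[OF per_cis per_const, of n "inverse (\<i> * of_int n)"] by (simp add: divide_inverse)
  ultimately have "avg (\<lambda>t. cis (of_int n * t)) = 0" by (rule avg_derivative)
  then show ?thesis using False by simp
qed simp

lemma fc_cis: "fc (\<lambda>t. cis (of_int k * t)) n = (if n = k then 1 else 0)"
  using avg_cis[of "k - n"] unfolding fc_def by (simp add: cis_mult algebra_simps) 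

lemma fc_const: "fc (\<lambda>t. c) n = (if n = 0 then c else 0)"
  using fc_cmult[OF per_const, of c 1 n] fc_cis[of 0 n] by simp

lemma norm_fc_le: "per f \<Longrightarrow> (\<And>t. norm (f t) \<le> B) \<Longrightarrow> norm (fc f n) \<le> B"
  unfolding fc_def by (rule norm_avg_le[OF per_fc]) (auto simp: norm_mult)

text \<open>The mean square of \<open>f - s\<close> is nonnegative for the partial sum
  \<open>s\<close> over \<open>I\<close>, and the mean square of \<open>f\<close> is at most
  \<open>B^2\<close>.\<close>

lemma bessel:
  assumes f: "per f" and B: "\<And>t. norm (f t) \<le> B" and I: "finite I"
  shows "(\<Sum>n\<in>I. (norm (fc f n))\<^sup>2) \<le> B\<^sup>2"
proof -
  define s where "s t = (\<Sum>n\<in>I. fc f n * cis (of_int n * t))" for t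
  have ps: "per s" unfolding s_def by (intro per_intros)
  define S where "S = (\<Sum>n\<in>I. (norm (fc f n))\<^sup>2)"
  have fs: "avg (\<lambda>t. f t * cnj (s t)) = of_real S"
  proof -
    have "avg (\<lambda>t. f t * cnj (s t)) = avg (\<lambda>t. \<Sum>n\<in>I. cnj (fc f n) * (f t * cis (- (of_int n * t))))"
      by (rule arg_cong[of _ _ avg]) (auto simp: s_def sum_distrib_left cis_cnj mult_ac)
    also have "\<dots> = (\<Sum>n\<in>I. avg (\<lambda>t. cnj (fc f n) * (f t * cis (- (of_int n * t)))))"
      by (intro avg_sum per_mult per_const per_fc f)
    also have "\<dots> = (\<Sum>n\<in>I. cnj (fc f n) * fc f n)"
      by (intro sum.cong refl) (simp add: avg_cmult[OF per_fc[OF f]] fc_def)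
    finally show ?thesis by (simp add: S_def complex_norm_square mult.commute del: of_real_power)
  qed
  have fcs: "fc s n = (if n \<in> I then fc f n else 0)" for n
  proof -
    have "fc s n = (\<Sum>k\<in>I. fc (\<lambda>t. fc f k * cis (of_int k * t)) n)"
      unfolding s_def by (intro fc_sum per_intros)
    also have "\<dots> = (\<Sum>k\<in>I. if n = k then fc f k else 0)"
      by (intro sum.cong refl) (simp add: fc_cmult[OF per_cis] fc_cis)
    finally show ?thesis using I by simp
  qed
  have ss: "avg (\<lambda>t. s t * cnj (s t)) = of_real S"
  proof -
    have "avg (\<lambda>t. s t * cnj (s t)) = avg (\<lambda>t. \<Sum>n\<in>I. cnj (fc f n) * (s t * cis (- (of_int n * t))))"
      by (rule arg_cong[of _ _ avg]) (auto simp: s_def sum_distrib_left cis_cnj mult_ac)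
    also have "\<dots> = (\<Sum>n\<in>I. avg (\<lambda>t. cnj (fc f n) * (s t * cis (- (of_int n * t)))))"
      by (intro avg_sum per_mult per_const per_fc ps)
    also have "\<dots> = (\<Sum>n\<in>I. cnj (fc f n) * fc f n)"
      by (intro sum.cong refl) (simp add: avg_cmult[OF per_fc[OF ps]] fc_def[symmetric] fcs)
    finally show ?thesis by (simp add: S_def complex_norm_square mult.commute del: of_real_power)
  qed
  have sf: "avg (\<lambda>t. s t * cnj (f t)) = of_real S"
    using avg_cnj[of "\<lambda>t. f t * cnj (s t)"] fs f ps by (simp add: per_intros mult.commute)
  have pp: "per (\<lambda>t. f t * cnj (f t))" "per (\<lambda>t. f t * cnj (s t))" "per (\<lambda>t. s t * cnj (f t))" "per (\<lambda>t. s t * cnj (s t))"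
    using f ps by (auto intro!: per_intros)
  have "avg (\<lambda>t. (f t - s t) * cnj (f t - s t)) =
      avg (\<lambda>t. (f t * cnj (f t) - f t * cnj (s t)) - (s t * cnj (f t) - s t * cnj (s t)))"
    by (rule arg_cong[of _ _ avg]) (auto simp: algebra_simps)
  also have "\<dots> = avg (\<lambda>t. f t * cnj (f t)) - of_real S"
    by (simp add: avg_diff per_diff pp fs sf ss)
  finally have eq: "avg (\<lambda>t. (f t - s t) * cnj (f t - s t)) = avg (\<lambda>t. f t * cnj (f t)) - of_real S" .
  have pd: "per (\<lambda>t. (norm (f t - s t))\<^sup>2)" using per_compose[OF per_diff[OF f ps], of "\<lambda>x. (norm x)\<^sup>2"]
    by (auto intro!: continuous_intros)
  have "avg (\<lambda>t. (f t - s t) * cnj (f t - s t)) = of_real (avg (\<lambda>t. (norm (f t - s t))\<^sup>2))"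
    unfolding complex_norm_square[symmetric] by (rule avg_linear[OF bounded_linear_of_real pd])
  moreover have "avg (\<lambda>t. (norm (f t - s t))\<^sup>2) \<ge> avg (\<lambda>t. 0)" by (rule avg_mono[OF per_const pd]) auto
  ultimately have "0 \<le> Re (avg (\<lambda>t. (f t - s t) * cnj (f t - s t)))" by simp
  then have "S \<le> Re (avg (\<lambda>t. f t * cnj (f t)))" using eq by simp
  also have "\<dots> \<le> norm (avg (\<lambda>t. f t * cnj (f t)))" by (rule complex_Re_le_cmod)
  also have "\<dots> \<le> B\<^sup>2"
    by (rule norm_avg_le[OF pp(1)]) (use B in \<open>auto simp: norm_mult power2_eq_square intro!: mult_mono order_trans[OF norm_ge_zero B]\<close>)
  finally show ?thesis by (simp add: S_def)
qed

text \<open>On the unit circle a linear form is a combination of \<open>cis t\<close> and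
  \<open>cis (- t)\<close>, so multiplying by it only shifts the coefficient index by one in either
  direction. Generalising over \<open>f\<close> lets products be treated one factor at a
  time.\<close>

lemma fc_zero_mult_polynomial:
  assumes "real_polynomial_function p" "per f" "\<And>n. fc f n = 0"
  shows "per (\<lambda>t. f t * of_real (p (cis t))) \<and> (\<forall>n. fc (\<lambda>t. f t * of_real (p (cis t))) n = 0)"
  using assms
proof (induction p arbitrary: f rule: real_polynomial_function.induct)
  case (linear p f)
  interpret bounded_linear p by fact
  define \<alpha> \<beta> where "\<alpha> = (of_real (p 1) - \<i> * of_real (p \<i>)) / 2" and "\<beta> = (of_real (p 1) + \<i> * of_real (p \<i>)) / 2"
  have "p (cis t) = cos t * p 1 + sin t * p \<i>" for t
  proof -
    have "cis t = cos t *\<^sub>R 1 + sin t *\<^sub>R \<i>" by (simp add: complex_eq_iff)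
    then show ?thesis by (simp add: add scaleR)
  qed
  then have "of_real (p (cis t)) = \<alpha> * cis (of_int 1 * t) + \<beta> * cis (of_int (-1) * t)" for t
    by (simp add: \<alpha>_def \<beta>_def complex_eq_iff field_simps)
  then have eq: "(\<lambda>t. f t * of_real (p (cis t))) =
      (\<lambda>t. \<alpha> * (cis (of_int 1 * t) * f t) + \<beta> * (cis (of_int (-1) * t) * f t))"
    by (auto simp: algebra_simps)
  have pp: "per (\<lambda>t. cis (of_int k * t) * f t)" for k using linear.prems by (intro per_intros)
  have "fc (\<lambda>t. \<alpha> * (cis (of_int 1 * t) * f t) + \<beta> * (cis (of_int (-1) * t) * f t)) n =
     \<alpha> * fc f (n - 1) + \<beta> * fc f (n - (-1))" for n
    by (simp only: fc_add[OF per_mult[OF per_const pp] per_mult[OF per_const pp]] fc_cmult[OF pp] fc_shift)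
  moreover have "per (\<lambda>t. \<alpha> * (cis (of_int 1 * t) * f t) + \<beta> * (cis (of_int (-1) * t) * f t))"
    by (rule per_add[OF per_mult[OF per_const pp] per_mult[OF per_const pp]])
  ultimately show ?case unfolding eq using linear.prems by simp
next
  case (const c f)
  then show ?case using fc_cmult[of f "of_real c"] by (auto simp: mult.commute intro!: per_intros)
next
  case (add p q f)
  from add.IH(1)[OF add.prems] add.IH(2)[OF add.prems] show ?case
    by (auto simp: distrib_left fc_add intro!: per_add)
next
  case (mult p q f)
  from mult.IH(1)[OF mult.prems] have 1: "per (\<lambda>t. f t * of_real (p (cis t)))"
    "\<And>n. fc (\<lambda>t. f t * of_real (p (cis t))) n = 0" by auto
  from mult.IH(2)[OF 1] show ?case by (simp add: mult.assoc)
qed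

text \<open>Such an \<open>f\<close> is orthogonal to all polynomials in \<open>cis t\<close>. By
  Stone-Weierstrass on the circle these approximate the conjugate of \<open>f\<close> uniformly, so
  the mean square of \<open>f\<close> vanishes.\<close>

lemma fourier_uniqueness:
  assumes f: "per f" and z: "\<And>n. fc f n = 0"
  shows "f t = 0"
proof -
  have cisf: "f s = f t" if "cis s = cis t" for s t
  proof -
    have "sin s = sin t \<and> cos s = cos t" using that by (metis cis.sel)
    then obtain n :: int where "s = t + 2 * pi * n" using sin_cos_eq_iff by blast
    then show ?thesis using per_int[OF f] by simp
  qed
  have cisA: "cis (Arg2pi z) = z" if "z \<in> sphere 0 1" for z
    using that complex_norm_eq_1_exp[of z] by (simp add: cis_conv_exp)
  have cisB: "cis (Arg z) = z" if "z \<in> sphere 0 1" for z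
    using that cis_Arg[of z] by (cases "z = 0") (auto simp: sgn_div_norm)
  have contA: "continuous_on (sphere 0 1) (\<lambda>z. f (Arg2pi z))"
    unfolding continuous_on_eq_continuous_within
  proof
    fix z :: complex assume zs: "z \<in> sphere 0 1"
    have cf: "isCont f x" for x using per_cont[OF f, of UNIV] by (simp add: continuous_on_eq_continuous_at)
    show "continuous (at z within sphere 0 1) (\<lambda>z. f (Arg2pi z))"
    proof (cases "z \<in> \<real>\<^sub>\<ge>\<^sub>0")
      case False
      have "continuous (at z) (\<lambda>z. f (Arg2pi z))"
        using continuous_at_compose[OF continuous_at_Arg2pi[OF False] cf] by (simp add: o_def)
      then show ?thesis by (rule continuous_at_imp_continuous_at_within)
    next
      \<comment> \<open>On the positive real axis \<open>Arg2pi\<close> jumps; \<open>Arg\<close> is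
        continuous there and gives the same values of \<open>f\<close>.\<close>
      case True
      have "z \<notin> \<real>\<^sub>\<le>\<^sub>0"
      proof
        assume "z \<in> \<real>\<^sub>\<le>\<^sub>0"
        then have "z = 0" using True
          by (auto simp: complex_nonpos_Reals_iff complex_nonneg_Reals_iff complex_eq_iff)
        then show False using zs by simp
      qed
      then have "continuous (at z) (\<lambda>z. f (Arg z))"
        using continuous_at_compose[OF continuous_at_Arg cf] by (simp add: o_def)
      then have c: "continuous (at z within sphere 0 1) (\<lambda>z. f (Arg z))"
        by (rule continuous_at_imp_continuous_at_within)
      have AA: "f (Arg w) = f (Arg2pi w)" if "w \<in> sphere 0 1" for w
        by (rule cisf) (simp only: cisA[OF that] cisB[OF that])
      show ?thesis
        by (rule continuous_transform_within[OF c zero_less_one zs]) (rule AA)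
    qed
  qed
  obtain B where B: "B \<ge> 0" "\<And>t. norm (f t) \<le> B" using per_bounded[OF f] by blast
  define q where "q = avg (\<lambda>t. (norm (f t))\<^sup>2)"
  have pn: "per (\<lambda>t. (norm (f t))\<^sup>2)" using per_compose[OF f, of "\<lambda>x. (norm x)\<^sup>2"]
    by (auto intro!: continuous_intros)
  have "\<bar>q\<bar> \<le> 0 + e" if e: "e > 0" for e
  proof -
    have "continuous_on (sphere 0 1) (\<lambda>z. cnj (f (Arg2pi z)))" by (intro continuous_intros contA)
    then obtain g :: "complex \<Rightarrow> complex" where g: "polynomial_function g"
      "\<forall>z\<in>sphere 0 1. norm (cnj (f (Arg2pi z)) - g z) < e / (B + 1)"
      using Stone_Weierstrass_polynomial_function[of "sphere 0 1" "\<lambda>z. cnj (f (Arg2pi z))" "e / (B + 1)"] e B by auto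
    have gR: "real_polynomial_function (\<lambda>z. Re (g z))" "real_polynomial_function (\<lambda>z. Im (g z))"
      using g(1) bounded_linear_Re bounded_linear_Im unfolding polynomial_function_def by (auto simp: o_def)
    note R = fc_zero_mult_polynomial[OF gR(1) f z] and I = fc_zero_mult_polynomial[OF gR(2) f z]
    have fg: "(\<lambda>t. f t * g (cis t)) = (\<lambda>t. f t * of_real (Re (g (cis t))) + \<i> * (f t * of_real (Im (g (cis t)))))"
      by (rule ext) (subst complex_eq[of "g (cis _)"], simp add: algebra_simps)
    have pfg: "per (\<lambda>t. f t * g (cis t))" unfolding fg using R I by (intro per_add per_mult[OF per_const]) auto
    have "fc (\<lambda>t. f t * g (cis t)) 0 = 0" unfolding fg using R I
      by (subst fc_add) (auto simp: fc_cmult intro!: per_mult[OF per_const])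
    then have zero: "avg (\<lambda>t. f t * g (cis t)) = 0" by (simp add: fc_def)
    have pff: "per (\<lambda>t. f t * cnj (f t))" using f by (intro per_intros)
    have "of_real q = avg (\<lambda>t. f t * cnj (f t))"
      unfolding q_def complex_norm_square[symmetric] by (rule avg_linear[OF bounded_linear_of_real pn, symmetric])
    also have "\<dots> = avg (\<lambda>t. f t * cnj (f t) - f t * g (cis t))" using avg_diff[OF pff pfg] zero by simp
    finally have "norm (complex_of_real q) = norm (avg (\<lambda>t. f t * cnj (f t) - f t * g (cis t)))" by simp
    also have "\<dots> \<le> B * (e / (B + 1))"
    proof (rule norm_avg_le[OF per_diff[OF pff pfg]])
      fix t
      have "f (Arg2pi (cis t)) = f t" by (rule cisf, rule cisA) simp
      then have "norm (cnj (f t) - g (cis t)) < e / (B + 1)" using g(2)[rule_format, of "cis t"] by simp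
      then have "norm (f t) * norm (cnj (f t) - g (cis t)) \<le> B * (e / (B + 1))" using B by (intro mult_mono) auto
      then show "norm (f t * cnj (f t) - f t * g (cis t)) \<le> B * (e / (B + 1))"
        by (simp add: norm_mult[symmetric] right_diff_distrib)
    qed
    also have "\<dots> \<le> e" using e B by (simp add: field_simps)
    finally show ?thesis by simp
  qed
  then have "\<bar>q\<bar> \<le> 0" by (rule field_le_epsilon)
  then have "q = 0" by simp
  then have "integral {0..2*pi} (\<lambda>t. (norm (f t))\<^sup>2) = 0" by (simp add: q_def avg_def)
  then have zero: "\<forall>x\<in>{0..2*pi}. (norm (f x))\<^sup>2 = 0"
    by (subst (asm) integral_eq_0_iff) (use per_cont[OF pn] in auto)
  have "f (Arg2pi (cis t)) = 0" using zero Arg2pi_ge_0[of "cis t"] Arg2pi_lt_2pi[of "cis t"] by force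
  moreover have "f (Arg2pi (cis t)) = f t" by (rule cisf, rule cisA) simp
  ultimately show ?thesis by simp
qed

text \<open>The bound on finite sums is the form in which Bessel and Cauchy-Schwarz deliver absolute
  convergence. The convergence is then uniform in \<open>t\<close>, so coefficients can be read off
  from finite partial sums.\<close>

lemma trigonometric_series:
  fixes c :: "int \<Rightarrow> complex"
  assumes K: "\<And>I. finite I \<Longrightarrow> (\<Sum>n\<in>I. norm (c n)) \<le> K"
  defines "v \<equiv> \<lambda>t. \<Sum>\<^sub>\<infinity>n. c n * cis (of_int n * t)"
  shows "per v" "\<And>t. norm (v t) \<le> K" "\<And>n. fc v n = c n"
proof -
  have sm: "(\<lambda>n. norm (c n)) summable_on UNIV"
    by (rule nonneg_bdd_above_summable_on) (auto intro!: bdd_aboveI[of _ K] K)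
  have ul: "uniform_limit UNIV (\<lambda>I t. \<Sum>n\<in>I. c n * cis (of_int n * t)) v (finite_subsets_at_top UNIV)"
    unfolding v_def by (rule Weierstrass_m_test_general[OF _ sm]) (simp add: norm_mult)
  have "continuous_on UNIV v"
    by (rule uniform_limit_theorem[OF _ ul]) (auto intro!: always_eventually continuous_intros)
  moreover have "v (t + 2 * pi) = v t" for t
    unfolding v_def using per_shift[OF per_cis] by simp
  ultimately show p: "per v" by (simp add: per_def)
  show "norm (v t) \<le> K" for t
  proof -
    have "norm (v t) \<le> (\<Sum>\<^sub>\<infinity>n. norm (c n * cis (of_int n * t)))"
      unfolding v_def by (rule norm_infsum_bound) (use sm in \<open>simp add: norm_mult\<close>)
    also have "\<dots> \<le> K" by (rule infsum_le_finite_sums) (use sm K in \<open>auto simp: norm_mult\<close>)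
    finally show ?thesis .
  qed
  show "fc v n = c n" for n
  proof -
    have "norm (fc v n - c n) \<le> 0 + e" if e: "e > 0" for e
    proof -
      have "\<forall>\<^sub>F I in finite_subsets_at_top UNIV. \<forall>t\<in>UNIV. dist (\<Sum>n\<in>I. c n * cis (of_int n * t)) (v t) < e"
        using ul e by (auto simp: uniform_limit_iff)
      moreover have "\<forall>\<^sub>F I in finite_subsets_at_top UNIV. finite I \<and> {n} \<subseteq> I \<and> I \<subseteq> UNIV"
        by (auto simp: eventually_finite_subsets_at_top intro!: exI[of _ "{n}"])
      ultimately have "\<forall>\<^sub>F I in finite_subsets_at_top UNIV.
         (\<forall>t\<in>UNIV. dist (\<Sum>n\<in>I. c n * cis (of_int n * t)) (v t) < e) \<and> finite I \<and> n \<in> I"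
        by eventually_elim auto
      then obtain I where I: "\<forall>t. dist (\<Sum>n\<in>I. c n * cis (of_int n * t)) (v t) < e" "finite I" "n \<in> I"
        using eventually_happens'[of "finite_subsets_at_top (UNIV :: int set)"] finite_subsets_at_top_neq_bot by fastforce
      define s where "s t = (\<Sum>n\<in>I. c n * cis (of_int n * t))" for t
      have ps: "per s" unfolding s_def by (intro per_intros)
      have "fc s n = (\<Sum>k\<in>I. fc (\<lambda>t. c k * cis (of_int k * t)) n)"
        unfolding s_def by (intro fc_sum per_intros)
      also have "\<dots> = (\<Sum>k\<in>I. if n = k then c k else 0)"
        by (intro sum.cong refl) (simp add: fc_cmult[OF per_cis] fc_cis)
      finally have "fc s n = c n" using I by simp
      then have "fc v n - c n = fc (\<lambda>t. v t - s t) n" using fc_diff[OF p ps] by simp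
      moreover have "norm (fc (\<lambda>t. v t - s t) n) \<le> e"
        by (rule norm_fc_le[OF per_diff[OF p ps]])
          (use I(1) in \<open>auto simp: s_def dist_norm norm_minus_commute intro: less_imp_le\<close>)
      ultimately show ?thesis by simp
    qed
    then have "norm (fc v n - c n) \<le> 0" by (rule field_le_epsilon)
    then show ?thesis by simp
  qed
qed

lemma sum_inverse_squares_int_le:
  assumes "finite I"
  shows "(\<Sum>n\<in>I. (1 / (1 + \<bar>real_of_int n\<bar>))\<^sup>2) \<le> 4"
proof -
  define F where "F n = (1 / (1 + \<bar>real_of_int n\<bar>))\<^sup>2" for n
  \<comment> \<open>The subtracted term strengthens the bound so that the induction
    telescopes.\<close>
  have sym: "(\<Sum>n\<in>{-int m..int m}. F n) \<le> 4 - 2 / (real m + 1)" for m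
  proof (induction m)
    case 0
    then show ?case by (simp add: F_def)
  next
    case (Suc m)
    have "{-int (Suc m)..int (Suc m)} = insert (int (Suc m)) (insert (- int (Suc m)) {-int m..int m})" by auto
    then have "(\<Sum>n\<in>{-int (Suc m)..int (Suc m)}. F n) = 2 * (1 / (real m + 2))\<^sup>2 + (\<Sum>n\<in>{-int m..int m}. F n)"
      by (simp add: F_def add_ac)
    also have "\<dots> \<le> 2 * (1 / (real m + 2))\<^sup>2 + (4 - 2 / (real m + 1))" using Suc by simp
    also have "\<dots> \<le> 4 - 2 / (real (Suc m) + 1)"
    proof -
      have "(1 / (real m + 2))\<^sup>2 \<le> 1 / (real m + 1) - 1 / (real m + 2)"
      proof -
        have "1 / (real m + 1) - 1 / (real m + 2) = 1 / ((real m + 1) * (real m + 2))" by (simp add: field_simps)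
        also have "\<dots> \<ge> 1 / ((real m + 2) * (real m + 2))" by (intro divide_left_mono mult_right_mono) auto
        finally show ?thesis by (simp add: power2_eq_square power_divide)
      qed
      then show ?thesis by (simp add: add_ac)
    qed
    finally show ?case .
  qed
  obtain m where m: "\<forall>n\<in>I. \<bar>n\<bar> \<le> int m"
  proof -
    have "finite ((\<lambda>n. nat \<bar>n\<bar>) ` I)" using assms by simp
    then obtain m where "\<forall>k\<in>(\<lambda>n. nat \<bar>n\<bar>) ` I. k \<le> m" using finite_nat_set_iff_bounded_le by blast
    then show ?thesis by (intro that[of m]) auto
  qed
  have "(\<Sum>n\<in>I. F n) \<le> (\<Sum>n\<in>{-int m..int m}. F n)"
    by (rule sum_mono2) (use m in \<open>force simp: F_def\<close>)+
  also have "\<dots> \<le> 4" using sym[of m] by (smt (verit) divide_nonneg_nonneg of_nat_0_le_iff)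
  finally show ?thesis by (simp add: F_def)
qed

text \<open>Cauchy-Schwarz with the weights \<open>1 / (1 + |n|)\<close>, whose l2 norm is at most
  2, and Bessel for the coefficients. Both \<open>n\<close> and \<open>2 - n\<close> are injective
  indexings, so each of the two sums is at most \<open>2 * B\<close>.\<close>

lemma sum_weighted_fc_le:
  assumes f: "per f" and B: "\<And>t. norm (f t) \<le> B" and I: "finite I" and C: "C \<ge> 0"
    and c: "\<And>n. norm (c n) \<le> C / (1 + \<bar>real_of_int n\<bar>) * (norm (fc f n) + norm (fc f (2 - n)))"
  shows "(\<Sum>n\<in>I. norm (c n)) \<le> 4 * C * B"
proof -
  have B0: "B \<ge> 0" using B[of 0] norm_ge_zero order_trans by blast
  let ?w = "\<lambda>n. 1 / (1 + \<bar>real_of_int n\<bar>)"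
  have w: "L2_set ?w I \<le> 2" using sum_inverse_squares_int_le[OF I] real_sqrt_le_mono[of _ 4] by (fastforce simp: L2_set_def)
  have cs: "(\<Sum>n\<in>I. ?w n * norm (fc f (\<sigma> n))) \<le> 2 * B" if "inj_on \<sigma> I" for \<sigma>
  proof -
    have "(\<Sum>n\<in>I. (norm (fc f (\<sigma> n)))\<^sup>2) = (\<Sum>n\<in>\<sigma> ` I. (norm (fc f n))\<^sup>2)"
      using that by (simp add: sum.reindex)
    also have "\<dots> \<le> B\<^sup>2" by (rule bessel[OF f B]) (use I in auto)
    finally have "L2_set (\<lambda>n. norm (fc f (\<sigma> n))) I \<le> B" using B0 real_le_lsqrt by (auto simp: L2_set_def sum_nonneg)
    then have "L2_set ?w I * L2_set (\<lambda>n. norm (fc f (\<sigma> n))) I \<le> 2 * B" using w B0 by (intro mult_mono) (auto simp: L2_set_nonneg)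
    moreover have "(\<Sum>n\<in>I. ?w n * norm (fc f (\<sigma> n))) \<le> L2_set ?w I * L2_set (\<lambda>n. norm (fc f (\<sigma> n))) I"
      using L2_set_mult_ineq[of ?w "\<lambda>n. norm (fc f (\<sigma> n))" I] by simp
    ultimately show ?thesis by linarith
  qed
  have "(\<Sum>n\<in>I. norm (c n)) \<le> (\<Sum>n\<in>I. C * (?w n * norm (fc f n) + ?w n * norm (fc f (2 - n))))"
    by (rule sum_mono) (use c in \<open>simp add: distrib_left\<close>)
  also have "\<dots> = C * ((\<Sum>n\<in>I. ?w n * norm (fc f n)) + (\<Sum>n\<in>I. ?w n * norm (fc f (2 - n))))"
    by (simp add: sum_distrib_left[symmetric] sum.distrib)
  also have "\<dots> \<le> C * (2 * B + 2 * B)"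
    using C cs[of "\<lambda>n. n"] cs[of "\<lambda>n. 2 - n"] by (intro mult_left_mono add_mono) (auto simp: inj_on_def)
  finally show ?thesis by simp
qed

section \<open>The linearised problem\<close>

text \<open>The linearised operator \<open>v \<mapsto> - \<i> v' + B v\<close> couples only the modes \<open>n\<close> and \<open>2 - n\<close>; its kernel is
  spanned by the constants and \<open>\<i> cis\<close>, and its right inverse is computed mode by mode.\<close>
locale linear_model =
  fixes b :: "int \<Rightarrow> real" and \<beta> :: real and Bop :: "(real \<Rightarrow> complex) \<Rightarrow> real \<Rightarrow> complex"
  assumes b_sym: "b (2 - n) = b n" and b0: "b 0 = 0" and b1: "b 1 = 1" and b_bd: "\<bar>b n\<bar> \<le> \<beta>"
    and Bop_per: "per v \<Longrightarrow> per (Bop v)"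
    and Bop_fc: "per v \<Longrightarrow> fc (Bop v) n = of_real (b n) * cnj (fc v (2 - n))"
begin

text \<open>In Fourier modes the equation is \<open>n * v n + b n * cnj (v (2 - n)) = F n\<close>.
  Together with the conjugated equation for \<open>2 - n\<close> it is a two by two system with
  determinant \<open>n * (2 - n) - (b n)^2\<close>. In the exceptional modes, \<open>n = 0\<close>
  is unsolvable since \<open>b 0 = 0\<close>; for \<open>n = 1\<close> the left side is
  \<open>2 * Re (v 1)\<close>, so only the real part of \<open>F 1\<close> is attained; for
  \<open>n = 2\<close> the coupling vanishes. The free choices make the solution orthogonal to the
  kernel.\<close>

definition mode_inverse :: "(int \<Rightarrow> complex) \<Rightarrow> int \<Rightarrow> complex" where
  "mode_inverse F n = (if n = 0 then 0 else if n = 1 then of_real (Re (F 1) / 2) else if n = 2 then F 2 / 2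
     else (of_int (2 - n) * F n - of_real (b n) * cnj (F (2 - n))) / of_real (of_int (n * (2 - n)) - (b n)\<^sup>2))"

definition right_inverse :: "(real \<Rightarrow> complex) \<Rightarrow> real \<Rightarrow> complex" where
  "right_inverse f t = (\<Sum>\<^sub>\<infinity>n. mode_inverse (fc f) n * cis (of_int n * t))"

lemma beta_nonneg: "\<beta> \<ge> 0" using b_bd[of 1] b1 by simp

lemma b2: "b 2 = 0" using b_sym[of 0] b0 by simp

text \<open>Outside the exceptional modes \<open>n * (2 - n)\<close> is negative, and subtracting a
  square cannot cancel it. This is why the kernel is no larger than claimed, whatever the values of
  \<open>b\<close>.\<close>

lemma determinant_bound:
  assumes "n \<noteq> 0" "n \<noteq> 1" "n \<noteq> 2"
  shows "\<bar>real_of_int n\<bar> * \<bar>real_of_int (2 - n)\<bar> \<le> \<bar>of_int (n * (2 - n)) - (b n)\<^sup>2\<bar>"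
proof -
  have "n * (2 - n) < 0" using assms by (auto simp: mult_less_0_iff)
  then have neg: "real_of_int (n * (2 - n)) < 0" by linarith
  have "\<bar>real_of_int n\<bar> * \<bar>real_of_int (2 - n)\<bar> = \<bar>real_of_int (n * (2 - n))\<bar>" by (simp add: abs_mult)
  also have "\<dots> \<le> \<bar>of_int (n * (2 - n)) - (b n)\<^sup>2\<bar>" using neg zero_le_power2[of "b n"] by linarith
  finally show ?thesis .
qed

text \<open>The gain \<open>1 / (1 + |n|)\<close> corresponds to one derivative; it is what makes
  the coefficients absolutely summable for merely bounded data.\<close>

lemma mode_inverse_bound:
  "norm (mode_inverse F n) \<le> 2 * (1 + \<beta>) / (1 + \<bar>real_of_int n\<bar>) * (norm (F n) + norm (F (2 - n)))"
proof -
  have b0: "\<beta> \<ge> 0" by (rule beta_nonneg)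
  consider "n = 0" | "n = 1" | "n = 2" | "n \<noteq> 0" "n \<noteq> 1" "n \<noteq> 2" by blast
  then show ?thesis
  proof cases
    case 1
    then show ?thesis using b0 by (simp add: mode_inverse_def)
  next
    case 2
    have "\<bar>Re (F 1)\<bar> / 2 \<le> (1 + \<beta>) * (2 * norm (F 1))"
      using abs_Re_le_cmod[of "F 1"] mult_mono[of 1 "1 + \<beta>" "\<bar>Re (F 1)\<bar> / 2" "2 * norm (F 1)"] b0 by simp
    then show ?thesis using 2 by (simp add: mode_inverse_def algebra_simps)
  next
    case 3
    have "norm (F 2) / 2 \<le> 2 * (1 + \<beta>) / 3 * (norm (F 2) + norm (F 0))"
      using b0 by (intro order_trans[OF _ mult_mono[of "1/2" "2 * (1 + \<beta>) / 3" "norm (F 2)"]]) auto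
    then show ?thesis using 3 by (simp add: mode_inverse_def norm_divide)
  next
    case 4
    define N where "N = \<bar>real_of_int n\<bar>"
    define N2 where "N2 = \<bar>real_of_int (2 - n)\<bar>"
    define D where "D = of_int (n * (2 - n)) - (b n)\<^sup>2"
    have N: "N \<ge> 1" "N2 \<ge> 1" using 4 by (auto simp: N_def N2_def)
    have D: "N * N2 \<le> \<bar>D\<bar>" using determinant_bound[OF 4] by (simp add: N_def N2_def D_def)
    have NN: "N * N2 > 0" using N by simp
    have iN: "1 / N \<le> 2 / (1 + N)" using N by (simp add: field_simps)
    have "norm (mode_inverse F n) = norm (of_int (2 - n) * F n - of_real (b n) * cnj (F (2 - n))) / \<bar>D\<bar>"
      using 4 by (simp add: mode_inverse_def norm_divide D_def del: of_int_diff of_real_diff)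
    also have "\<dots> \<le> (N2 * norm (F n) + \<beta> * norm (F (2 - n))) / (N * N2)"
    proof (rule frac_le[OF _ _ NN D])
      have "norm (of_int (2 - n) * F n - of_real (b n) * cnj (F (2 - n))) \<le>
          norm (of_int (2 - n) * F n) + norm (of_real (b n) * cnj (F (2 - n)))" by (rule norm_triangle_ineq4)
      also have "\<dots> \<le> N2 * norm (F n) + \<beta> * norm (F (2 - n))"
        using b_bd[of n] by (intro add_mono) (auto simp: norm_mult N2_def mult_right_mono simp del: of_int_diff)
      finally show "norm (of_int (2 - n) * F n - of_real (b n) * cnj (F (2 - n))) \<le> \<dots>" .
    qed (use b0 N in auto)
    also have "\<dots> = 1 / N * norm (F n) + 1 / N * (\<beta> / N2 * norm (F (2 - n)))"
      using N by (simp add: field_simps)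
    also have "\<dots> \<le> 1 / N * ((1 + \<beta>) * norm (F n)) + 1 / N * ((1 + \<beta>) * norm (F (2 - n)))"
    proof -
      have "\<beta> / N2 \<le> \<beta> / 1" using b0 N by (intro divide_left_mono) auto
      then show ?thesis using b0 N
        by (intro add_mono mult_left_mono mult_right_mono) (auto simp: mult_le_cancel_right1 algebra_simps)
    qed
    also have "\<dots> \<le> 2 / (1 + N) * ((1 + \<beta>) * (norm (F n) + norm (F (2 - n))))"
      unfolding distrib_left[symmetric] using b0 iN by (intro mult_right_mono) auto
    also have "2 / (1 + N) * ((1 + \<beta>) * (norm (F n) + norm (F (2 - n)))) =
      2 * (1 + \<beta>) / (1 + \<bar>real_of_int n\<bar>) * (norm (F n) + norm (F (2 - n)))" by (simp add: N_def)
    finally show ?thesis .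
  qed
qed

lemma right_inverse_series:
  assumes f: "per f" and B: "\<And>t. norm (f t) \<le> B"
  shows "per (right_inverse f)" "norm (right_inverse f t) \<le> 8 * (1 + \<beta>) * B"
    "fc (right_inverse f) n = mode_inverse (fc f) n"
proof -
  have "(\<Sum>n\<in>I. norm (mode_inverse (fc f) n)) \<le> 4 * (2 * (1 + \<beta>)) * B" if "finite I" for I
    by (rule sum_weighted_fc_le[OF f B that _ mode_inverse_bound]) (use beta_nonneg in auto)
  then have K: "(\<Sum>n\<in>I. norm (mode_inverse (fc f) n)) \<le> 8 * (1 + \<beta>) * B" if "finite I" for I
    using that by simp
  have eq: "right_inverse f = (\<lambda>t. \<Sum>\<^sub>\<infinity>n. mode_inverse (fc f) n * cis (of_int n * t))"
    by (rule ext) (rule right_inverse_def)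
  show "per (right_inverse f)" "norm (right_inverse f t) \<le> 8 * (1 + \<beta>) * B"
    "fc (right_inverse f) n = mode_inverse (fc f) n" unfolding eq using trigonometric_series[of "mode_inverse (fc f)", OF K] by auto
qed

lemma right_inverse_per: "per f \<Longrightarrow> per (right_inverse f)"
  using right_inverse_series(1) per_bounded by blast

lemma fc_right_inverse: "per f \<Longrightarrow> fc (right_inverse f) n = mode_inverse (fc f) n"
  using right_inverse_series(3) per_bounded by blast

text \<open>The conjugations leave only real linearity. Comparing coefficients avoids rearranging
  the two infinite sums.\<close>

lemma right_inverse_diff:
  assumes f: "per f" and g: "per g"
  shows "right_inverse (\<lambda>t. f t - g t) t = right_inverse f t - right_inverse g t"
proof -
  have "mode_inverse (fc (\<lambda>t. f t - g t)) n = mode_inverse (fc f) n - mode_inverse (fc g) n" for n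
  proof -
    have "(p * (x - y) - q * (x' - y')) / d = (p * x - q * x') / d - (p * y - q * y') / d"
      for p q x y x' y' d :: complex by (simp add: diff_divide_distrib right_diff_distrib)
    then show ?thesis unfolding mode_inverse_def fc_diff[OF f g] complex_cnj_diff
      by (simp add: diff_divide_distrib)
  qed
  note modes = this
  define q where "q t = right_inverse (\<lambda>t. f t - g t) t - (right_inverse f t - right_inverse g t)" for t
  note p = right_inverse_per[OF per_diff[OF f g]] right_inverse_per[OF f] right_inverse_per[OF g]
  have "fc q n = 0" for n
    unfolding q_def
    by (simp only: fc_diff[OF p(1) per_diff[OF p(2,3)]] fc_diff[OF p(2,3)] fc_right_inverse[OF f]
        fc_right_inverse[OF g] fc_right_inverse[OF per_diff[OF f g]] modes diff_self)
  moreover have "per q" unfolding q_def by (rule per_diff[OF p(1) per_diff[OF p(2,3)]])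
  ultimately have "q t = 0" by (rule fourier_uniqueness[rotated])
  then show ?thesis by (simp add: q_def)
qed

lemma avg_right_inverse: "per f \<Longrightarrow> avg (right_inverse f) = 0"
  using fc_right_inverse[of f 0] by (simp add: fc_def mode_inverse_def)

text \<open>The subtracted terms are what the inverse cannot reach: the mean of the data and the
  imaginary part in mode 1. They turn into the two multipliers.\<close>

lemma mode_equation:
  "of_int n * mode_inverse F n + of_real (b n) * cnj (mode_inverse F (2 - n)) =
     F n - (if n = 0 then F 0 else 0) - (if n = 1 then \<i> * of_real (Im (F 1)) else 0)"
proof -
  consider "n = 0" | "n = 1" | "n = 2" | "n \<noteq> 0" "n \<noteq> 1" "n \<noteq> 2" by blast
  then show ?thesis
  proof cases
    case 4
    define D where "D = of_int (n * (2 - n)) - (b n)\<^sup>2"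
    have "\<bar>D\<bar> > 0"
      using determinant_bound[OF 4] 4 unfolding D_def
      by (smt (verit) mult_pos_pos of_int_0_less_iff of_int_abs zero_less_abs_iff eq_iff_diff_eq_0)
    then have D0: "complex_of_real D \<noteq> 0" by simp
    have m1: "mode_inverse F n = (of_int (2 - n) * F n - of_real (b n) * cnj (F (2 - n))) / of_real D"
      using 4 by (simp add: mode_inverse_def D_def)
    have D2: "of_int ((2 - n) * (2 - (2 - n))) - (b (2 - n))\<^sup>2 = D" by (simp add: D_def b_sym mult.commute)
    have "mode_inverse F (2 - n) = (of_int (2 - (2 - n)) * F (2 - n) - of_real (b (2 - n)) * cnj (F (2 - (2 - n)))) / of_real D"
      unfolding D2[symmetric] using 4 by (simp add: mode_inverse_def del: of_real_diff)
    then have m2: "cnj (mode_inverse F (2 - n)) = (of_int n * cnj (F (2 - n)) - of_real (b n) * F n) / of_real D"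
      by (simp add: b_sym)
    have Dc: "complex_of_real D = of_int n * of_int (2 - n) - of_real (b n) * of_real (b n)"
      by (simp add: D_def power2_eq_square)
    have "of_int n * mode_inverse F n + of_real (b n) * cnj (mode_inverse F (2 - n))
        = (of_int n * (of_int (2 - n) * F n - of_real (b n) * cnj (F (2 - n)))
          + of_real (b n) * (of_int n * cnj (F (2 - n)) - of_real (b n) * F n)) / of_real D"
      unfolding m1 m2 by (simp add: add_divide_distrib)
    also have "\<dots> = of_real D * F n / of_real D" unfolding Dc by (simp add: algebra_simps)
    finally show ?thesis using D0 4 by simp
  qed (auto simp: mode_inverse_def b0 b1 b2 complex_eq_iff)
qed

text \<open>The series is never differentiated. An antiderivative of the expected derivative has the
  same nonzero modes as the series, so the two differ by a constant.\<close>

lemma right_inverse_solves: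
  assumes f: "per f"
  shows "(right_inverse f has_vector_derivative
     \<i> * (f t - fc f 0 - \<i> * of_real (Im (fc f 1)) * cis t - Bop (right_inverse f) t)) (at t)"
proof -
  let ?v = "right_inverse f"
  have v: "per ?v" by (rule right_inverse_per[OF f])
  define w where "w t = f t - fc f 0 - \<i> * of_real (Im (fc f 1)) * cis t - Bop ?v t" for t
  have w: "per w" unfolding w_def by (intro per_intros f Bop_per v)
  have fcw: "fc w n = of_int n * fc ?v n" for n
  proof -
    have pcis: "per (\<lambda>t. \<i> * of_real (Im (fc f 1)) * cis t)" by (intro per_intros)
    have "fc w n = fc f n - fc (\<lambda>t. fc f 0) n - fc (\<lambda>t. \<i> * of_real (Im (fc f 1)) * cis t) n - fc (Bop ?v) n"
      unfolding w_def using f Bop_per[OF v] pcis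
      by (simp add: fc_diff per_diff)
    also have "fc (\<lambda>t. \<i> * of_real (Im (fc f 1)) * cis t) n = (if n = 1 then \<i> * of_real (Im (fc f 1)) else 0)"
      using fc_cmult[OF per_cis1, of "\<i> * of_real (Im (fc f 1))" n] fc_cis[of 1 n] by simp
    finally have e1: "fc w n = fc f n - (if n = 0 then fc f 0 else 0) - (if n = 1 then \<i> * of_real (Im (fc f 1)) else 0)
        - of_real (b n) * cnj (fc ?v (2 - n))"
      by (simp add: fc_const Bop_fc[OF v])
    show ?thesis
      by (simp only: e1 mode_equation[symmetric] fc_right_inverse[OF f] add_diff_cancel_right')
  qed
  obtain V where V: "\<And>t. (V has_vector_derivative \<i> * w t) (at t)"
    using continuous_has_antiderivative[of "\<lambda>t. \<i> * w t"] per_cont[OF per_mult[OF per_const w]] by blast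
  have piw: "per (\<lambda>t. \<i> * w t)" by (intro per_intros w)
  have "avg w = 0" using fcw[of 0] by (simp add: fc_def)
  then have pV: "per V" using antiderivative_periodic[OF V piw] avg_cmult[OF w] by simp
  have fcV: "of_int n * fc V n = fc w n" for n
  proof -
    have "((\<lambda>t. V t * cis (- (of_int n * t))) has_vector_derivative
        (\<i> * w t * cis (- (of_int n * t)) - \<i> * of_int n * (V t * cis (- (of_int n * t))))) (at t)" for t
    proof -
      have "((\<lambda>t. cis (- (of_int n * t))) has_vector_derivative (- of_int n *\<^sub>R (\<i> * cis (- (of_int n * t))))) (at t)"
        by (rule vector_diff_chain_at[of "\<lambda>t. - (of_int n * t)" _ _ cis, unfolded o_def])
          (auto intro!: derivative_eq_intros simp: has_vector_derivative_def cis_conv_exp mult_ac scaleR_conv_of_real)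
      from has_vector_derivative_mult[OF V this] show ?thesis
        by (simp add: scaleR_conv_of_real algebra_simps)
    qed
    then have "avg (\<lambda>t. \<i> * w t * cis (- (of_int n * t)) - \<i> * of_int n * (V t * cis (- (of_int n * t)))) = 0"
      by (rule avg_derivative) (rule per_fc[OF pV])
    then have "avg (\<lambda>t. \<i> * (w t * cis (- (of_int n * t)))) = avg (\<lambda>t. \<i> * of_int n * (V t * cis (- (of_int n * t))))"
      using avg_diff[OF per_mult[OF per_const per_fc[OF w]] per_mult[OF per_const per_fc[OF pV]], of \<i> n "\<i> * of_int n" n]
      by (simp add: mult.assoc)
    then show ?thesis
      by (simp add: avg_cmult[OF per_fc[OF w]] avg_cmult[OF per_fc[OF pV]] fc_def)
  qed
  define k where "k = fc ?v 0 - fc V 0"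
  have "fc (\<lambda>t. ?v t - V t - k) n = 0" for n
  proof -
    have "fc (\<lambda>t. ?v t - V t - k) n = fc ?v n - fc V n - fc (\<lambda>t. k) n"
      using v pV by (simp add: fc_diff per_diff)
    moreover have "fc ?v n = fc V n" if "n \<noteq> 0" using fcV[of n] fcw[of n] that by simp
    ultimately show ?thesis by (cases "n = 0") (auto simp: fc_const k_def)
  qed
  then have "?v t - V t - k = 0" for t
    by (intro fourier_uniqueness[of "\<lambda>t. ?v t - V t - k"]) (intro per_intros v pV)
  then have "?v = (\<lambda>t. V t + k)" by (simp add: diff_eq_eq fun_eq_iff add.commute)
  then show ?thesis using V[of t] by (auto intro!: derivative_eq_intros simp: w_def)
qed

end

section \<open>Choreographies near the rotating polygon\<close>

locale ngon =
  fixes N :: nat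
  assumes N2: "N \<ge> 2"
begin

definition shift :: "nat \<Rightarrow> real" where "shift j = 2 * pi * real j / real N"

definition root_gap :: "nat \<Rightarrow> complex" where "root_gap j = 1 - cis (- shift j)"

definition gap_weight :: "nat \<Rightarrow> complex" where "gap_weight j = 2 / (of_nat N - 1) / (root_gap j)\<^sup>2"

text \<open>The factor with which \<open>lin_op\<close> sends the conjugate of mode
  \<open>2 - n\<close> to mode \<open>n\<close>.\<close>

definition symbol :: "int \<Rightarrow> complex" where
  "symbol n = (\<Sum>j\<in>{1..<N}. gap_weight j * (1 - cis (- (of_int n * shift j))))"

text \<open>Minus the linearisation of \<open>vortex_field\<close> at \<open>cis\<close>: the
  conjugated gap of the polygon is \<open>cis (- t) * root_gap j\<close>, and its inverse square
  produces \<open>cis (2 * t) / (root_gap j)^2\<close>.\<close>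

definition lin_op :: "(real \<Rightarrow> complex) \<Rightarrow> real \<Rightarrow> complex" where
  "lin_op v t = cis (2 * t) * (\<Sum>j\<in>{1..<N}. gap_weight j * cnj (v t - v (t + shift j)))"

definition vortex_field :: "(real \<Rightarrow> complex) \<Rightarrow> real \<Rightarrow> complex" where
  "vortex_field u t = 2 / (of_nat N - 1) * (\<Sum>j\<in>{1..<N}. 1 / cnj (u t - u (t + shift j)))"

lemma Npos: "real N > 0" "real N - 1 > 0" "(of_nat N :: complex) \<noteq> 1" using N2 by auto

lemma shift_reflect: "j \<in> {1..<N} \<Longrightarrow> shift (N - j) = 2 * pi - shift j"
  using Npos by (auto simp: shift_def of_nat_diff field_simps)

lemma cis_shift_reflect: "j \<in> {1..<N} \<Longrightarrow> cis (of_int n * shift (N - j)) = cis (- (of_int n * shift j))"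
proof -
  assume j: "j \<in> {1..<N}"
  have "cis (of_int n * shift (N - j)) = cis (2 * pi * of_int n) * cis (- (of_int n * shift j))"
    unfolding shift_reflect[OF j] cis_mult by (simp add: algebra_simps)
  also have "cis (2 * pi * of_int n) = 1" by (simp add: complex_eq_iff cos_int_2pin sin_int_2pin)
  finally show ?thesis by simp
qed

lemma sum_reflect: "(\<Sum>j\<in>{1..<N}. F j) = (\<Sum>j\<in>{1..<N}. F (N - j))"
  by (rule sum.reindex_bij_witness[of _ "\<lambda>j. N - j" "\<lambda>j. N - j"]) auto

lemma root_gap_nonzero: "j \<in> {1..<N} \<Longrightarrow> root_gap j \<noteq> 0"
proof
  assume j: "j \<in> {1..<N}" and "root_gap j = 0"
  then have "cos (- shift j) = 1" by (simp add: root_gap_def complex_eq_iff)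
  then have c: "cos (shift j) = 1" by simp
  have "0 < shift j" "shift j < 2 * pi" using j Npos by (auto simp: shift_def field_simps)
  moreover obtain n :: int where n: "shift j = of_int n * 2 * pi" using c cos_one_2pi_int by blast
  ultimately have "0 < real_of_int n" "real_of_int n < 1" by (simp_all add: zero_less_mult_iff)
  then have "0 < n" "n < 1" by simp_all
  then show False by simp
qed

lemma root_gap_reflect: "j \<in> {1..<N} \<Longrightarrow> root_gap (N - j) = cnj (root_gap j)"
  using cis_shift_reflect[of j "-1"] by (simp add: root_gap_def cis_cnj)

definition gap_min :: real where "gap_min = Min ((\<lambda>j. cmod (root_gap j)) ` {1..<N})"

lemma gap_min_le: "j \<in> {1..<N} \<Longrightarrow> gap_min \<le> cmod (root_gap j)"
  unfolding gap_min_def by (rule Min_le) auto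

lemma gap_min_pos: "gap_min > 0"
proof -
  have "{1..<N} \<noteq> {}" using N2 by auto
  then show ?thesis unfolding gap_min_def using root_gap_nonzero by (subst Min_gr_iff) auto
qed

lemma root_gap_cis: "cnj (cis t - cis (t + shift j)) = cis (- t) * root_gap j"
  by (simp add: root_gap_def cis_cnj cis_mult right_diff_distrib add.commute)

lemma gap_weight_reflect: "j \<in> {1..<N} \<Longrightarrow> gap_weight (N - j) = cnj (gap_weight j)"
  by (simp add: gap_weight_def root_gap_reflect)

lemma symbol_real: "cnj (symbol n) = symbol n"
proof -
  have "symbol n = (\<Sum>j\<in>{1..<N}. gap_weight (N - j) * (1 - cis (- (of_int n * shift (N - j)))))"
    unfolding symbol_def by (rule sum_reflect)
  also have "\<dots> = (\<Sum>j\<in>{1..<N}. cnj (gap_weight j * (1 - cis (- (of_int n * shift j)))))"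
  proof (rule sum.cong[OF refl])
    fix j assume j: "j \<in> {1..<N}"
    show "gap_weight (N - j) * (1 - cis (- (of_int n * shift (N - j)))) =
      cnj (gap_weight j * (1 - cis (- (of_int n * shift j))))"
      using cis_shift_reflect[OF j, of "- n"] gap_weight_reflect[OF j] by (simp add: cis_cnj)
  qed
  finally show ?thesis by (simp add: symbol_def)
qed

text \<open>For \<open>x\<close> on the unit circle other than 1, \<open>1 / (1 - x)\<close> and its
  conjugate add up to 1. Pairing \<open>j\<close> with \<open>N - j\<close> gives the sum
  \<open>(N - 1) / 2\<close>, which the prefactor normalises. This value accounts both for the unit
  speed of the polygon and for the phase direction in the kernel.\<close>

lemma symbol_1: "symbol 1 = 1"
proof -
  let ?c = "2 / (of_nat N - 1) :: complex"
  have s: "symbol 1 = (\<Sum>j\<in>{1..<N}. ?c / root_gap j)"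
    unfolding symbol_def
  proof (rule sum.cong[OF refl])
    fix j assume j: "j \<in> {1..<N}"
    show "gap_weight j * (1 - cis (- (of_int 1 * shift j))) = ?c / root_gap j"
      using root_gap_nonzero[OF j] by (simp add: gap_weight_def root_gap_def[symmetric] power2_eq_square)
  qed
  have "symbol 1 + symbol 1 = (\<Sum>j\<in>{1..<N}. ?c / root_gap j) + (\<Sum>j\<in>{1..<N}. ?c / root_gap (N - j))"
    unfolding s using sum_reflect[of "\<lambda>j. ?c / root_gap j"] by simp
  also have "\<dots> = (\<Sum>j\<in>{1..<N}. ?c * (1 / root_gap j + 1 / root_gap (N - j)))"
    by (simp add: sum.distrib[symmetric] distrib_left)
  also have "\<dots> = (\<Sum>j\<in>{1..<N}. ?c * 1)"
  proof (rule sum.cong[OF refl])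
    fix j assume j: "j \<in> {1..<N}"
    define x where "x = cis (- shift j)"
    have x1: "x * cnj x = 1" by (simp add: x_def cis_cnj cis_mult)
    have g: "root_gap j = 1 - x" "root_gap (N - j) = 1 - cnj x"
      using root_gap_reflect[OF j] by (auto simp: root_gap_def x_def)
    have nz: "1 - x \<noteq> 0" using root_gap_nonzero[OF j] unfolding g(1) .
    then have nz': "1 - cnj x \<noteq> 0" by (metis complex_cnj_diff complex_cnj_one complex_cnj_zero_iff)
    have prod: "(1 - x) * (1 - cnj x) = 2 - x - cnj x" using x1 by (simp add: algebra_simps)
    have "1 / (1 - x) + 1 / (1 - cnj x) = (2 - x - cnj x) / ((1 - x) * (1 - cnj x))"
      using nz nz' by (simp add: field_simps)
    also note prod
    finally have "1 / (1 - x) + 1 / (1 - cnj x) = 1" using nz nz' prod by (metis divide_self mult_eq_0_iff)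
    then show "?c * (1 / root_gap j + 1 / root_gap (N - j)) = ?c * 1" unfolding g by simp
  qed
  also have "\<dots> = (of_nat N - 1) * ?c" using N2 by (simp add: of_nat_diff)
  also have "\<dots> = 2"
  proof -
    have "of_nat N - (1::complex) \<noteq> 0" using Npos(3) by simp
    then show ?thesis by (metis nonzero_mult_div_cancel_left times_divide_eq_right)
  qed
  finally show ?thesis by simp
qed

text \<open>With \<open>x = cis (- shift j)\<close>, the difference to the conjugated symbol at
  \<open>2 - n\<close> no longer depends on \<open>n\<close> and reduces to the sum of
  \<open>(1 + x) / (1 - x)\<close>, which is odd under \<open>j \<mapsto> N - j\<close> and hence
  zero. Reality of the symbol removes the conjugation.\<close>

lemma symbol_sym: "symbol (2 - n) = symbol n"
proof -
  let ?c = "2 / (of_nat N - 1) :: complex"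
  have odd: "(\<Sum>j\<in>{1..<N}. ?c * ((1 + cis (- shift j)) / root_gap j)) = 0" (is "?S = 0")
  proof -
    have "?S = (\<Sum>j\<in>{1..<N}. ?c * ((1 + cis (- shift (N - j))) / root_gap (N - j)))" by (rule sum_reflect)
    also have "\<dots> = (\<Sum>j\<in>{1..<N}. - (?c * ((1 + cis (- shift j)) / root_gap j)))"
    proof (rule sum.cong[OF refl])
      fix j assume j: "j \<in> {1..<N}"
      define x where "x = cis (- shift j)"
      have x1: "x * cnj x = 1" by (simp add: x_def cis_cnj cis_mult)
      have g: "root_gap j = 1 - x" "root_gap (N - j) = 1 - cnj x" "cis (- shift (N - j)) = cnj x"
        using root_gap_reflect[OF j] cis_shift_reflect[OF j, of "-1"] by (auto simp: root_gap_def x_def cis_cnj)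
      have nz: "1 - x \<noteq> 0" using root_gap_nonzero[OF j] unfolding g(1) .
    then have nz': "1 - cnj x \<noteq> 0" by (metis complex_cnj_diff complex_cnj_one complex_cnj_zero_iff)
      have "(1 + cnj x) / (1 - cnj x) = - ((1 + x) / (1 - x))"
        using nz nz' x1 by (simp add: frac_eq_eq minus_divide_left algebra_simps)
      then show "?c * ((1 + cis (- shift (N - j))) / root_gap (N - j)) = - (?c * ((1 + cis (- shift j)) / root_gap j))"
        unfolding g x_def[symmetric] by simp
    qed
    also have "\<dots> = - ?S" by (rule sum_negf)
    finally have "?S + ?S = 0" by (simp add: eq_neg_iff_add_eq_0)
    then show ?thesis by simp
  qed
  have "symbol n - cnj (symbol (2 - n)) = ?S"
    unfolding symbol_def cnj_sum sum_subtractf[symmetric]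
  proof (rule sum.cong[OF refl])
    fix j assume j: "j \<in> {1..<N}"
    define x where "x = cis (- shift j)"
    define y where "y = cis (- (of_int n * shift j))"
    have x1: "x * cnj x = 1" "cnj x * x = 1" by (simp_all add: x_def cis_cnj cis_mult)
    have nz: "1 - x \<noteq> 0" using root_gap_nonzero[OF j] by (simp add: root_gap_def x_def)
    have yx: "cnj (cis (- (of_int (2 - n) * shift j))) = y * cnj x * cnj x"
      by (simp add: y_def x_def cis_cnj cis_mult algebra_simps)
    have gw: "gap_weight j = ?c / (1 - x)\<^sup>2" by (simp add: gap_weight_def root_gap_def x_def)
    have cx: "(1 - cnj x)\<^sup>2 = cnj x * cnj x * (1 - x)\<^sup>2"
    proof -
      have "1 - cnj x = - cnj x * (1 - x)" using x1 by (simp add: algebra_simps)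
      then show ?thesis by (simp add: power2_eq_square)
    qed
    have c0: "cnj x \<noteq> 0" using x1 by auto
    have "cnj (gap_weight j * (1 - cis (- (of_int (2 - n) * shift j))))
       = ?c / (cnj x * cnj x * (1 - x)\<^sup>2) * (1 - y * cnj x * cnj x)"
      unfolding gw complex_cnj_mult complex_cnj_diff yx by (simp add: cx)
    also have "\<dots> = ?c / (1 - x)\<^sup>2 * (x * x - y)"
    proof -
      have "1 - y * cnj x * cnj x = cnj x * cnj x * (x * x - y)"
        using x1 by (simp add: algebra_simps)
      then show ?thesis using c0 by simp
    qed
    finally have e: "cnj (gap_weight j * (1 - cis (- (of_int (2 - n) * shift j)))) = ?c / (1 - x)\<^sup>2 * (x * x - y)" .
    have alg: "k * (1 - y) - k * (x * x - y) = k * ((1 - x) * (1 + x))" for k by (simp add: algebra_simps)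
    have "gap_weight j * (1 - cis (- (of_int n * shift j))) - cnj (gap_weight j * (1 - cis (- (of_int (2 - n) * shift j))))
       = ?c / (1 - x)\<^sup>2 * ((1 - x) * (1 + x))"
      unfolding e unfolding gw y_def[symmetric] by (rule alg)
    also have "\<dots> = ?c * ((1 + x) / (1 - x))" using nz by (simp add: power2_eq_square)
    finally show "gap_weight j * (1 - cis (- (of_int n * shift j))) - cnj (gap_weight j * (1 - cis (- (of_int (2 - n) * shift j))))
       = ?c * ((1 + cis (- shift j)) / root_gap j)"
      by (simp add: x_def root_gap_def)
  qed
  then show ?thesis unfolding odd symbol_real by simp
qed

lemma lin_op_per: "per v \<Longrightarrow> per (lin_op v)"
  unfolding lin_op_def using per_cis[of 2]
  by (auto intro!: per_mult[OF _ per_sum] per_mult[OF per_const] per_cnj per_diff per_translate)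

lemma fc_lin_op:
  assumes v: "per v"
  shows "fc (lin_op v) n = of_real (Re (symbol n)) * cnj (fc v (2 - n))"
proof -
  have pd: "per (\<lambda>t. v t - v (t + shift j))" for j using v by (intro per_intros)
  have "fc (lin_op v) n = fc (\<lambda>t. \<Sum>j\<in>{1..<N}. gap_weight j * cnj (v t - v (t + shift j))) (n - 2)"
    unfolding lin_op_def using fc_shift[of 2 "\<lambda>t. \<Sum>j\<in>{1..<N}. gap_weight j * cnj (v t - v (t + shift j))" n] by simp
  also have "\<dots> = (\<Sum>j\<in>{1..<N}. fc (\<lambda>t. gap_weight j * cnj (v t - v (t + shift j))) (n - 2))"
    by (intro fc_sum per_mult[OF per_const] per_cnj pd)
  also have "\<dots> = (\<Sum>j\<in>{1..<N}. gap_weight j * (1 - cis (- (of_int (2 - n) * shift j)))) * cnj (fc v (2 - n))"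
    unfolding sum_distrib_right
  proof (rule sum.cong[OF refl])
    fix j
    have "fc (\<lambda>t. gap_weight j * cnj (v t - v (t + shift j))) (n - 2) = gap_weight j * cnj (fc (\<lambda>t. v t - v (t + shift j)) (2 - n))"
      using fc_cmult[OF per_cnj[OF pd], of "gap_weight j" j] fc_cnj[OF pd, of j "n - 2"] by simp
    also have "fc (\<lambda>t. v t - v (t + shift j)) (2 - n) = (1 - cis (of_int (2 - n) * shift j)) * fc v (2 - n)"
      by (simp only: fc_diff[OF v per_translate[OF v]] fc_translate[OF v] left_diff_distrib mult_1)
    finally show "fc (\<lambda>t. gap_weight j * cnj (v t - v (t + shift j))) (n - 2) =
        gap_weight j * (1 - cis (- (of_int (2 - n) * shift j))) * cnj (fc v (2 - n))"
      by (simp add: cis_cnj)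
  qed
  also have "\<dots> = symbol n * cnj (fc v (2 - n))" using symbol_sym[of n] by (simp add: symbol_def)
  also have "symbol n = of_real (Re (symbol n))" using symbol_real[of n] by (simp add: complex_eq_iff)
  finally show ?thesis .
qed

sublocale lm: linear_model "\<lambda>n. Re (symbol n)" "\<Sum>j\<in>{1..<N}. 2 * cmod (gap_weight j)" lin_op
proof
  fix n
  show "Re (symbol (2 - n)) = Re (symbol n)" by (simp add: symbol_sym)
  show "Re (symbol 0) = 0" by (simp add: symbol_def)
  show "Re (symbol 1) = 1" by (simp add: symbol_1)
  have "\<bar>Re (symbol n)\<bar> \<le> cmod (symbol n)" by (rule abs_Re_le_cmod)
  also have "\<dots> \<le> (\<Sum>j\<in>{1..<N}. 2 * cmod (gap_weight j))"
    unfolding symbol_def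
  proof (rule sum_norm_le)
    fix j
    have "cmod (1 - cis (- (of_int n * shift j))) \<le> 2"
      using norm_triangle_ineq4[of 1 "cis (- (of_int n * shift j))"] by simp
    then show "cmod (gap_weight j * (1 - cis (- (of_int n * shift j)))) \<le> 2 * cmod (gap_weight j)"
      using mult_left_mono[OF _ norm_ge_zero[of "gap_weight j"]] by (fastforce simp: norm_mult mult.commute)
  qed
  finally show "\<bar>Re (symbol n)\<bar> \<le> (\<Sum>j\<in>{1..<N}. 2 * cmod (gap_weight j))" .
qed (use lin_op_per fc_lin_op in auto)

lemma vortex_field_cis: "vortex_field cis t = cis t"
proof -
  have "1 / cnj (cis t - cis (t + shift j)) = cis t * (1 / root_gap j)" for j
    unfolding root_gap_cis using cis_inverse[of "- t"] by (simp add: divide_inverse)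
  then have "vortex_field cis t = cis t * (\<Sum>j\<in>{1..<N}. 2 / (of_nat N - 1) / root_gap j)"
    by (simp add: vortex_field_def sum_distrib_left divide_inverse mult_ac)
  also have "(\<Sum>j\<in>{1..<N}. 2 / (of_nat N - 1) / root_gap j) = symbol 1"
    unfolding symbol_def
  proof (rule sum.cong[OF refl])
    fix j assume j: "j \<in> {1..<N}"
    show "2 / (of_nat N - 1) / root_gap j = gap_weight j * (1 - cis (- (of_int 1 * shift j)))"
      using root_gap_nonzero[OF j] by (simp add: gap_weight_def root_gap_def[symmetric] power2_eq_square)
  qed
  finally show ?thesis by (simp add: symbol_1)
qed

text \<open>Averages over a period do not change when the roles of \<open>t\<close> and \<open>t + shift j\<close> are exchanged, because the
  shifts form a group modulo the period.\<close>
lemma sum_avg_swap: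
  fixes H :: "real \<Rightarrow> real \<Rightarrow> 'a::euclidean_space"
  assumes H: "\<And>j. j \<in> {1..<N} \<Longrightarrow> per (\<lambda>t. H t (t + shift j))" "\<And>s t. H s (t + 2 * pi) = H s t"
  shows "(\<Sum>j\<in>{1..<N}. avg (\<lambda>t. H t (t + shift j))) = (\<Sum>j\<in>{1..<N}. avg (\<lambda>t. H (t + shift j) t))"
proof -
  have "(\<Sum>j\<in>{1..<N}. avg (\<lambda>t. H t (t + shift j))) = (\<Sum>j\<in>{1..<N}. avg (\<lambda>t. H t (t + shift (N - j))))"
    by (rule sum_reflect)
  also have "\<dots> = (\<Sum>j\<in>{1..<N}. avg (\<lambda>t. H (t + shift j) t))"
  proof (rule sum.cong[OF refl])
    fix j assume j: "j \<in> {1..<N}"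
    then have "N - j \<in> {1..<N}" by auto
    from avg_translate[OF H(1)[OF this], of "shift j"]
    have "avg (\<lambda>t. H t (t + shift (N - j))) = avg (\<lambda>t. H (t + shift j) (t + shift j + shift (N - j)))" by simp
    also have "\<dots> = avg (\<lambda>t. H (t + shift j) t)"
      unfolding shift_reflect[OF j] using H(2) by (simp add: algebra_simps)
    finally show "avg (\<lambda>t. H t (t + shift (N - j))) = avg (\<lambda>t. H (t + shift j) t)" .
  qed
  finally show ?thesis .
qed

end

section \<open>The nonlinear remainder and the contraction\<close>

text \<open>The expression is the reciprocal with its first-order term removed. Its Lipschitz
  constant is proportional to the size of \<open>D\<close> and \<open>D'\<close>, so it is small on
  small balls.\<close>

lemma reciprocal_remainder_lipschitz:
  fixes X D D' :: complex
  assumes m: "m > 0" "m \<le> cmod X" "cmod D \<le> m / 2" "cmod D' \<le> m / 2"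
  shows "cmod ((1 / (X + D) + D / X\<^sup>2) - (1 / (X + D') + D' / X\<^sup>2)) \<le> 8 * (cmod D + cmod D') / m ^ 3 * cmod (D - D')"
proof -
  have low: "cmod X / 2 \<le> cmod (X + d)" if "cmod d \<le> m / 2" for d
    using norm_triangle_ineq2[of X "- d"] that m by simp
  have X0: "cmod X > 0" using m by linarith
  have nz: "X \<noteq> 0" "X + D \<noteq> 0" "X + D' \<noteq> 0"
    using X0 low[OF m(3)] low[OF m(4)] by auto
  have "(1 / (X + D) + D / X\<^sup>2) - (1 / (X + D') + D' / X\<^sup>2)
      = (D - D') * (((D + D') * X + D * D') / (X\<^sup>2 * ((X + D) * (X + D'))))"
    using nz by (simp add: divide_simps) (simp add: algebra_simps power2_eq_square)
  then have "cmod ((1 / (X + D) + D / X\<^sup>2) - (1 / (X + D') + D' / X\<^sup>2))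
      = cmod (D - D') * (cmod ((D + D') * X + D * D') / ((cmod X)\<^sup>2 * (cmod (X + D) * cmod (X + D'))))"
    by (simp add: norm_mult norm_divide norm_power)
  also have "\<dots> \<le> cmod (D - D') * (2 * (cmod D + cmod D') * cmod X / ((cmod X)\<^sup>2 * (cmod X / 2 * (cmod X / 2))))"
  proof (intro mult_left_mono frac_le mult_mono)
    have "cmod ((D + D') * X + D * D') \<le> (cmod D + cmod D') * cmod X + cmod D * cmod D'"
      by (intro order_trans[OF norm_triangle_ineq] add_mono) (auto simp: norm_mult intro: mult_right_mono norm_triangle_ineq)
    also have "cmod D * cmod D' \<le> cmod D * cmod X" using m by (intro mult_left_mono) auto
    also have "(cmod D + cmod D') * cmod X + cmod D * cmod X \<le> 2 * (cmod D + cmod D') * cmod X"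
      by (simp add: algebra_simps)
    finally show "cmod ((D + D') * X + D * D') \<le> 2 * (cmod D + cmod D') * cmod X" by simp
  qed (use X0 low m in auto)
  also have "\<dots> = 8 * (cmod D + cmod D') / cmod X ^ 3 * cmod (D - D')"
    using X0 by (simp add: field_simps power2_eq_square power3_eq_cube)
  also have "\<dots> \<le> 8 * (cmod D + cmod D') / m ^ 3 * cmod (D - D')"
    using m X0 by (intro mult_right_mono divide_left_mono power_mono mult_pos_pos zero_less_power) auto
  finally show ?thesis .
qed

text \<open>\<open>G\<close> stands for the gradient of \<open>g\<close> in the first variable,
  extended to the whole plane. With global bounds the fixed point problem can be posed for every
  centre, without watching the domain.\<close>

locale ngon_field = ngon +
  fixes G :: "complex \<Rightarrow> complex \<Rightarrow> complex" and LG MG :: real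
  assumes G_lip: "cmod (G w z - G w' z') \<le> LG * (cmod (w - w') + cmod (z - z'))"
    and G_bd: "cmod (G w z) \<le> MG"
begin

definition coupling :: "real \<Rightarrow> real" where "coupling r = 4 * pi * r / (real N - 1)"

text \<open>The term \<open>j = 0\<close> is the self-interaction. Each pair occurs twice in the
  Hamiltonian and the gradient of \<open>g (z, z)\<close> is \<open>2 * G z z\<close>, so all terms
  carry the same weight.\<close>

definition gsum :: "complex \<Rightarrow> real \<Rightarrow> (real \<Rightarrow> complex) \<Rightarrow> real \<Rightarrow> complex" where
  "gsum a r u t = (\<Sum>j<N. G (a + of_real r * u t) (a + of_real r * u (t + shift j)))"

definition force :: "complex \<Rightarrow> real \<Rightarrow> (real \<Rightarrow> complex) \<Rightarrow> real \<Rightarrow> complex" where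
  "force a r u t = vortex_field u t + of_real (coupling r) * gsum a r u t"

text \<open>For \<open>u = cis + v\<close> the equation \<open>- \<i> u' = force\<close> reads
  \<open>- \<i> v' + lin_op v = residual\<close>. Adding \<open>lin_op v\<close> removes the part of
  the force that is linear at the polygon.\<close>

definition residual :: "complex \<Rightarrow> real \<Rightarrow> (real \<Rightarrow> complex) \<Rightarrow> real \<Rightarrow> complex" where
  "residual a r v t = force a r (\<lambda>t. cis t + v t) t - cis t + lin_op v t"

lemma LG_nonneg: "LG \<ge> 0" using order_trans[OF norm_ge_zero G_lip[of 1 0 0 0]] by simp
lemma MG_nonneg: "MG \<ge> 0" using order_trans[OF norm_ge_zero G_bd] by blast

lemma G_continuous: "continuous_on UNIV (\<lambda>p. G (fst p) (snd p))"
proof (rule lipschitz_on_continuous_on[of "2 * LG"], rule lipschitz_onI)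
  fix p q :: "complex \<times> complex"
  have "cmod (G (fst p) (snd p) - G (fst q) (snd q)) \<le> LG * (dist (fst p) (fst q) + dist (snd p) (snd q))"
    using G_lip by (simp add: dist_norm)
  also have "\<dots> \<le> LG * (dist p q + dist p q)"
    using LG_nonneg dist_fst_le[of p q] dist_snd_le[of p q] by (intro mult_left_mono add_mono) auto
  finally show "dist (G (fst p) (snd p)) (G (fst q) (snd q)) \<le> 2 * LG * dist p q" by (simp add: dist_norm)
qed (use LG_nonneg in simp)

lemma per_G: "per x \<Longrightarrow> per y \<Longrightarrow> per (\<lambda>t. G (x t) (y t))"
  unfolding per_def
  using continuous_on_compose2[OF G_continuous, of UNIV "\<lambda>t. (x t, y t)"] by (auto intro!: continuous_intros)

lemma per_gsum: "per u \<Longrightarrow> per (gsum a r u)"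
  unfolding gsum_def by (intro per_sum per_G per_add per_mult per_const per_translate)

lemma per_vortex_field:
  assumes "per u" "\<And>t j. j \<in> {1..<N} \<Longrightarrow> u t \<noteq> u (t + shift j)"
  shows "per (vortex_field u)"
proof -
  have "per (\<lambda>t. 1 / cnj (u t - u (t + shift j)))" if "j \<in> {1..<N}" for j
  proof -
    have "per (\<lambda>t. cnj (u t - u (t + shift j)))" using assms(1) by (intro per_intros)
    then show ?thesis using assms(2)[OF that] by (auto simp: per_def intro!: continuous_intros)
  qed
  then show ?thesis unfolding vortex_field_def by (intro per_mult[OF per_const] per_sum)
qed

lemma gsum_lipschitz:
  assumes "r \<ge> 0" and "\<And>t. cmod (u t - u' t) \<le> S"
  shows "cmod (gsum a r u t - gsum a' r u' t) \<le> real N * (LG * (2 * cmod (a - a') + 2 * r * S))"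
proof -
  have *: "cmod (a + of_real r * u s - (a' + of_real r * u' s)) \<le> cmod (a - a') + r * S" for s
  proof -
    have "a + of_real r * u s - (a' + of_real r * u' s) = (a - a') + of_real r * (u s - u' s)" by (simp add: algebra_simps)
    then have "cmod (a + of_real r * u s - (a' + of_real r * u' s)) \<le> cmod (a - a') + cmod (of_real r * (u s - u' s))"
      by (metis norm_triangle_ineq)
    also have "cmod (of_real r * (u s - u' s)) \<le> r * S" using assms by (simp add: norm_mult mult_left_mono)
    finally show ?thesis by simp
  qed
  have "cmod (gsum a r u t - gsum a' r u' t) \<le> (\<Sum>j<N. LG * (2 * cmod (a - a') + 2 * r * S))"
    unfolding gsum_def sum_subtractf[symmetric]
  proof (rule sum_norm_le)
    fix j
    show "cmod (G (a + of_real r * u t) (a + of_real r * u (t + shift j)) - G (a' + of_real r * u' t) (a' + of_real r * u' (t + shift j)))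
      \<le> LG * (2 * cmod (a - a') + 2 * r * S)"
      using *[of t] *[of "t + shift j"] LG_nonneg by (intro order_trans[OF G_lip] mult_left_mono) auto
  qed
  then show ?thesis by simp
qed

lemma gsum_bound: "cmod (gsum a r u t) \<le> real N * MG"
  unfolding gsum_def using sum_norm_le[of "{..<N}" "\<lambda>j. G (a + of_real r * u t) (a + of_real r * u (t + shift j))" "\<lambda>j. MG"] G_bd
  by simp

lemma separated:
  assumes "\<And>t. cmod (v t) \<le> \<delta>" and "j \<in> {1..<N}"
  shows "cmod (cis t + v t - (cis (t + shift j) + v (t + shift j))) \<ge> gap_min - 2 * \<delta>"
proof -
  have "cmod (cis t - cis (t + shift j)) = cmod (root_gap j)"
    by (metis complex_mod_cnj norm_mult norm_cis mult_1 root_gap_cis)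
  then have "gap_min \<le> cmod (cis t - cis (t + shift j))" using gap_min_le[OF assms(2)] by simp
  moreover have "cmod (v t - v (t + shift j)) \<le> 2 * \<delta>"
    using norm_triangle_ineq4[of "v t" "v (t + shift j)"] assms(1)[of t] assms(1)[of "t + shift j"] by linarith
  moreover have "cis t + v t - (cis (t + shift j) + v (t + shift j)) = (cis t - cis (t + shift j)) - (v (t + shift j) - v t)" by simp
  ultimately show ?thesis
    unfolding \<open>cis t + v t - (cis (t + shift j) + v (t + shift j)) = _\<close>
    using norm_triangle_ineq2[of "cis t - cis (t + shift j)" "v (t + shift j) - v t"]
      norm_minus_commute[of "v t" "v (t + shift j)"] by simp
qed

lemma vortex_remainder_lipschitz:
  assumes v: "\<And>t. cmod (v t) \<le> \<delta>" and v': "\<And>t. cmod (v' t) \<le> \<delta>" and d: "4 * \<delta> \<le> gap_min"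
    and S: "\<And>t. cmod (v t - v' t) \<le> S"
  shows "cmod ((vortex_field (\<lambda>t. cis t + v t) t + lin_op v t) - (vortex_field (\<lambda>t. cis t + v' t) t + lin_op v' t))
    \<le> 128 * \<delta> / gap_min ^ 3 * S"
proof -
  have d0: "\<delta> \<ge> 0" using v[of 0] norm_ge_zero order_trans by blast
  define X where "X j = cnj (cis t - cis (t + shift j))" for j
  define D where "D w j = cnj (w t - w (t + shift j))" for w :: "real \<Rightarrow> complex" and j
  let ?c = "2 / (of_nat N - 1) :: complex"
  \<comment> \<open>Brings every summand to the form of the scalar remainder estimate, with the
    conjugated polygon gap as base point.\<close>
  have form: "vortex_field (\<lambda>t. cis t + w t) t + lin_op w t = ?c * (\<Sum>j\<in>{1..<N}. 1 / (X j + D w j) + D w j / (X j)\<^sup>2)" for w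
  proof -
    have 1: "cnj (cis t + w t - (cis (t + shift j) + w (t + shift j))) = X j + D w j" for j
      by (simp add: X_def D_def algebra_simps)
    have 2: "cis (2 * t) * (gap_weight j * cnj (w t - w (t + shift j))) = ?c * (D w j / (X j)\<^sup>2)" for j
    proof -
      have X2: "(X j)\<^sup>2 = cis (- (2 * t)) * (root_gap j)\<^sup>2"
        unfolding X_def root_gap_cis by (simp add: power_mult_distrib Complex.DeMoivre)
      have "cis (2 * t) / (root_gap j)\<^sup>2 = 1 / (X j)\<^sup>2"
        unfolding X2 using cis_inverse[of "- (2 * t)"] by (simp add: divide_inverse)
      then show ?thesis unfolding gap_weight_def D_def by (simp add: divide_inverse mult_ac)
    qed
    have 3: "lin_op w t = ?c * (\<Sum>j\<in>{1..<N}. D w j / (X j)\<^sup>2)"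
      unfolding lin_op_def by (simp only: sum_distrib_left 2)
    show ?thesis unfolding 3 vortex_field_def 1 by (simp only: distrib_left sum.distrib)
  qed
  have Xm: "gap_min \<le> cmod (X j)" if "j \<in> {1..<N}" for j
    using gap_min_le[OF that] unfolding X_def root_gap_cis by (simp add: norm_mult)
  have Db: "cmod (D w j) \<le> 2 * B" if "\<And>t. cmod (w t) \<le> B" for w B j
    unfolding D_def complex_mod_cnj
    using norm_triangle_ineq4[of "w t" "w (t + shift j)"] that[of t] that[of "t + shift j"] by linarith
  have DD: "cmod (D v j - D v' j) \<le> 2 * S" for j
  proof -
    have "D v j - D v' j = D (\<lambda>t. v t - v' t) j" by (simp add: D_def algebra_simps)
    then show ?thesis using Db[of "\<lambda>t. v t - v' t", OF S] by simp
  qed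
  have "cmod ((vortex_field (\<lambda>t. cis t + v t) t + lin_op v t) - (vortex_field (\<lambda>t. cis t + v' t) t + lin_op v' t))
      = 2 / (real N - 1) * cmod (\<Sum>j\<in>{1..<N}. (1 / (X j + D v j) + D v j / (X j)\<^sup>2) - (1 / (X j + D v' j) + D v' j / (X j)\<^sup>2))"
  proof -
    have "cmod ?c = 2 / (real N - 1)" using N2
      by (simp add: norm_divide) (metis (no_types, lifting) norm_of_nat of_nat_1 of_nat_diff order_trans one_le_numeral)
    then show ?thesis by (simp only: form sum_subtractf right_diff_distrib[symmetric] norm_mult)
  qed
  also have "\<dots> \<le> 2 / (real N - 1) * (\<Sum>j\<in>{1..<N}. 8 * (2 * \<delta> + 2 * \<delta>) / gap_min ^ 3 * (2 * S))"
  proof (intro mult_left_mono sum_norm_le)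
    fix j assume j: "j \<in> {1..<N}"
    have "cmod ((1 / (X j + D v j) + D v j / (X j)\<^sup>2) - (1 / (X j + D v' j) + D v' j / (X j)\<^sup>2))
       \<le> 8 * (cmod (D v j) + cmod (D v' j)) / gap_min ^ 3 * cmod (D v j - D v' j)"
      by (rule reciprocal_remainder_lipschitz[OF gap_min_pos Xm[OF j]])
        (use Db[of v \<delta> j, OF v] Db[of v' \<delta> j, OF v'] d in auto)
    also have "\<dots> \<le> 8 * (2 * \<delta> + 2 * \<delta>) / gap_min ^ 3 * (2 * S)"
      using Db[of v \<delta> j, OF v] Db[of v' \<delta> j, OF v'] DD[of j] gap_min_pos d0
      by (intro mult_mono divide_right_mono mult_left_mono add_mono) auto
    finally show "cmod ((1 / (X j + D v j) + D v j / (X j)\<^sup>2) - (1 / (X j + D v' j) + D v' j / (X j)\<^sup>2))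
       \<le> 8 * (2 * \<delta> + 2 * \<delta>) / gap_min ^ 3 * (2 * S)" .
  qed (use Npos in auto)
  also have "\<dots> = 2 / (real N - 1) * ((real N - 1) * (8 * (2 * \<delta> + 2 * \<delta>) / gap_min ^ 3 * (2 * S)))"
    using N2 by (simp add: of_nat_diff)
  also have "\<dots> = 2 * (8 * (2 * \<delta> + 2 * \<delta>) / gap_min ^ 3 * (2 * S))"
    using Npos(2) by (metis less_irrefl mult.assoc nonzero_eq_divide_eq)
  also have "\<dots> = 128 * \<delta> / gap_min ^ 3 * S" by simp
  finally show ?thesis .
qed

end

text \<open>Banach's theorem on a closed set of bounded continuous functions, restated for plain
  functions; the pointwise bound \<open>S\<close> plays the role of the supremum distance.\<close>

lemma periodic_contraction_fixed_point:
  fixes T :: "(real \<Rightarrow> complex) \<Rightarrow> real \<Rightarrow> complex"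
  assumes d: "\<delta> \<ge> 0"
    and T: "\<And>v. per v \<Longrightarrow> (\<And>t. cmod (v t) \<le> \<delta>) \<Longrightarrow> per (T v) \<and> (\<forall>t. cmod (T v t) \<le> \<delta>)"
    and C: "\<And>v w S t. per v \<Longrightarrow> (\<And>t. cmod (v t) \<le> \<delta>) \<Longrightarrow> per w \<Longrightarrow> (\<And>t. cmod (w t) \<le> \<delta>) \<Longrightarrow>
      (\<And>t. cmod (v t - w t) \<le> S) \<Longrightarrow> cmod (T v t - T w t) \<le> S / 2"
  shows "\<exists>v. per v \<and> (\<forall>t. cmod (v t) \<le> \<delta>) \<and> T v = v"
proof -
  define s where "s = {f :: real \<Rightarrow>\<^sub>C complex. per (apply_bcontfun f) \<and> (\<forall>t. cmod (apply_bcontfun f t) \<le> \<delta>)}"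
  define F where "F f = Bcontfun (T (apply_bcontfun f))" for f
  have Fapp: "apply_bcontfun (F f) = T (apply_bcontfun f)" if "f \<in> s" for f
  proof -
    have "T (apply_bcontfun f) \<in> bcontfun"
      by (rule bcontfun_normI[of _ \<delta>]) (use T[of "apply_bcontfun f"] that per_cont in \<open>auto simp: s_def\<close>)
    then show ?thesis by (simp add: F_def Bcontfun_inverse)
  qed
  have lim: "(\<lambda>n. apply_bcontfun (x n) t) \<longlonglongrightarrow> apply_bcontfun l t" if "x \<longlonglongrightarrow> l" for x :: "nat \<Rightarrow> real \<Rightarrow>\<^sub>C complex" and l t
  proof (rule tendstoI)
    fix e :: real assume "e > 0"
    with that have "\<forall>\<^sub>F n in sequentially. dist (x n) l < e" by (rule tendstoD)
    then show "\<forall>\<^sub>F n in sequentially. dist (apply_bcontfun (x n) t) (apply_bcontfun l t) < e"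
      by eventually_elim (metis dist_bounded le_less_trans)
  qed
  have "closed s"
    unfolding closed_sequential_limits
  proof (intro allI impI, elim conjE)
    fix x l assume x: "\<forall>n. x n \<in> s" and l: "x \<longlonglongrightarrow> l"
    have "apply_bcontfun l (t + 2 * pi) = apply_bcontfun l t" for t
    proof -
      have "(\<lambda>n. apply_bcontfun (x n) (t + 2 * pi)) = (\<lambda>n. apply_bcontfun (x n) t)"
        using x by (auto simp: s_def per_def)
      then show ?thesis using lim[OF l, of "t + 2 * pi"] lim[OF l, of t] LIMSEQ_unique by metis
    qed
    moreover have "cmod (apply_bcontfun l t) \<le> \<delta>" for t
      by (rule Lim_bounded[OF tendsto_norm[OF lim[OF l]]]) (use x in \<open>auto simp: s_def\<close>)
    ultimately show "l \<in> s" by (auto simp: s_def per_def)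
  qed
  then have "complete s" by (simp add: complete_eq_closed)
  moreover have "s \<noteq> {}"
  proof -
    have "0 \<in> s" using d by (auto simp: s_def per_def)
    then show ?thesis by blast
  qed
  moreover have "F ` s \<subseteq> s" using T Fapp by (fastforce simp: s_def)
  moreover have "\<forall>f\<in>s. \<forall>g\<in>s. dist (F f) (F g) \<le> (1 / 2) * dist f g"
  proof (intro ballI)
    fix f g assume f: "f \<in> s" and g: "g \<in> s"
    show "dist (F f) (F g) \<le> (1 / 2) * dist f g"
    proof (rule dist_bound)
      fix t
      have "cmod (apply_bcontfun f t - apply_bcontfun g t) \<le> dist f g" for t
        using dist_bounded[of f t g] by (simp add: dist_norm)
      from C[of "apply_bcontfun f" "apply_bcontfun g" "dist f g" t, OF _ _ _ _ this] f g
      show "dist (apply_bcontfun (F f) t) (apply_bcontfun (F g) t) \<le> (1 / 2) * dist f g"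
        by (simp add: Fapp s_def dist_norm)
    qed
  qed
  ultimately obtain f where "f \<in> s" "F f = f" using Banach_fix[of s "1 / 2" F] by auto
  then show ?thesis using Fapp[of f] by (intro exI[of _ "apply_bcontfun f"]) (auto simp: s_def)
qed

context ngon_field begin

lemma per_residual:
  assumes v: "per v" and d: "\<And>t. cmod (v t) \<le> \<delta>" "4 * \<delta> \<le> gap_min"
  shows "per (residual a r v)"
proof -
  have u: "per (\<lambda>t. cis t + v t)" using v by (intro per_intros)
  have "cis t + v t \<noteq> cis (t + shift j) + v (t + shift j)" if "j \<in> {1..<N}" for t j
    using separated[of v \<delta> j t, OF d(1) that] d(2) gap_min_pos by auto
  then have "per (vortex_field (\<lambda>t. cis t + v t))" by (intro per_vortex_field u)
  then show ?thesis unfolding residual_def force_def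
    by (intro per_add per_diff per_mult[OF per_const] per_gsum u lin_op_per v per_cis1)
qed

lemma residual_lipschitz:
  assumes v: "\<And>t. cmod (v t) \<le> \<delta>" and v': "\<And>t. cmod (v' t) \<le> \<delta>" and d: "4 * \<delta> \<le> gap_min"
    and S: "\<And>t. cmod (v t - v' t) \<le> S" and r: "r \<ge> 0"
  shows "cmod (residual a r v t - residual a' r v' t) \<le> 128 * \<delta> / gap_min ^ 3 * S
    + coupling r * (real N * (LG * (2 * cmod (a - a') + 2 * r * S)))"
proof -
  have c0: "coupling r \<ge> 0" using r Npos by (simp add: coupling_def)
  have "residual a r v t - residual a' r v' t =
    ((vortex_field (\<lambda>t. cis t + v t) t + lin_op v t) - (vortex_field (\<lambda>t. cis t + v' t) t + lin_op v' t))
    + of_real (coupling r) * (gsum a r (\<lambda>t. cis t + v t) t - gsum a' r (\<lambda>t. cis t + v' t) t)"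
    by (simp add: residual_def force_def algebra_simps)
  also have "cmod \<dots> \<le> 128 * \<delta> / gap_min ^ 3 * S
      + coupling r * (real N * (LG * (2 * cmod (a - a') + 2 * r * S)))"
  proof (rule order_trans[OF norm_triangle_ineq add_mono])
    show "cmod (of_real (coupling r) * (gsum a r (\<lambda>t. cis t + v t) t - gsum a' r (\<lambda>t. cis t + v' t) t))
      \<le> coupling r * (real N * (LG * (2 * cmod (a - a') + 2 * r * S)))"
      using mult_left_mono[OF gsum_lipschitz[OF r, of "\<lambda>t. cis t + v t" "\<lambda>t. cis t + v' t" S a t a'] c0] S c0
      by (simp add: norm_mult)
  qed (rule vortex_remainder_lipschitz[OF v v' d S])
  finally show ?thesis .
qed

lemma residual_zero_bound:
  assumes "r \<ge> 0"
  shows "cmod (residual a r (\<lambda>t. 0) t) \<le> coupling r * (real N * MG)"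
proof -
  have c0: "coupling r \<ge> 0" using assms Npos by (simp add: coupling_def)
  have "residual a r (\<lambda>t. 0) t = of_real (coupling r) * gsum a r cis t"
    using vortex_field_cis[of t] by (simp add: residual_def force_def lin_op_def)
  then show ?thesis using mult_left_mono[OF gsum_bound c0, of a r cis t] c0 by (simp add: norm_mult)
qed

definition reduced_family :: "real \<Rightarrow> real \<Rightarrow> real \<Rightarrow> (complex \<Rightarrow> real \<Rightarrow> complex) \<Rightarrow> bool" where
  "reduced_family \<rho> \<Lambda> r v \<longleftrightarrow>
    (\<forall>a. per (v a) \<and> (\<forall>t. cmod (v a t) \<le> \<rho> * r) \<and> lm.right_inverse (residual a r (v a)) = v a) \<and>
    (\<forall>a a' t. cmod (v a t - v a' t) \<le> \<Lambda> * cmod (a - a'))"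

lemma reduced_solutions:
  obtains \<rho> r1 \<Lambda> where "0 \<le> \<rho>" "0 < r1" "0 \<le> \<Lambda>" "4 * (\<rho> * r1) \<le> gap_min" "2 * (\<rho> * r1) \<le> 1"
    "\<And>r. 0 < r \<Longrightarrow> r \<le> r1 \<Longrightarrow> \<exists>v. reduced_family \<rho> \<Lambda> r v"
proof -
  define CA where "CA = 8 * (1 + (\<Sum>j\<in>{1..<N}. 2 * cmod (gap_weight j)))"
  have CA0: "CA > 0" using lm.beta_nonneg by (simp add: CA_def)
  define p where "p = 4 * pi / (real N - 1)"
  have p0: "p > 0" using Npos by (simp add: p_def)
  have cpl: "coupling r = p * r" for r by (simp add: coupling_def p_def)
  \<comment> \<open>\<open>CA\<close> bounds the right inverse. The image of zero then has size at
    most \<open>\<rho> * r / 2\<close>, so a contraction with factor 1/2 maps the ball of radius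
    \<open>\<rho> * r\<close> into itself.\<close>
  define \<rho> where "\<rho> = 2 * CA * (p * (real N * MG))"
  have rho0: "\<rho> \<ge> 0" using CA0 p0 MG_nonneg by (simp add: \<rho>_def)
  \<comment> \<open>\<open>E * r\<close> bounds the contraction factor: the vortex remainder is
    small because the ball has radius of order \<open>r\<close>, the regular part because of the
    coupling.\<close>
  define E where "E = CA * (128 * \<rho> / gap_min ^ 3 + p * (real N * (LG * 2)))"
  have E0: "E \<ge> 0" using CA0 p0 LG_nonneg rho0 gap_min_pos by (simp add: E_def)
  \<comment> \<open>Besides \<open>r \<le> 1\<close> and the factor 1/2, the correction must stay
    below \<open>gap_min / 4\<close>, to keep the vortices apart, and below 1/2, to control the
    phase multiplier.\<close>
  define r1 where "r1 = min 1 (min (1 / (2 * E + 1)) (min (gap_min / (4 * \<rho> + 1)) (1 / (2 * \<rho> + 1))))"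
  have r10: "r1 > 0" using E0 rho0 gap_min_pos by (simp add: r1_def)
  have r1a: "r1 \<le> 1" and r1b: "2 * E * r1 \<le> 1" and r1c: "4 * (\<rho> * r1) \<le> gap_min" and r1d: "2 * (\<rho> * r1) \<le> 1"
  proof -
    have "r1 \<le> 1 / (2 * E + 1)" "r1 \<le> gap_min / (4 * \<rho> + 1)" "r1 \<le> 1 / (2 * \<rho> + 1)" by (auto simp: r1_def)
    then have "r1 * (2 * E + 1) \<le> 1" "r1 * (4 * \<rho> + 1) \<le> gap_min" "r1 * (2 * \<rho> + 1) \<le> 1"
      using E0 rho0 by (simp_all add: pos_le_divide_eq)
    then show "2 * E * r1 \<le> 1" "4 * (\<rho> * r1) \<le> gap_min" "2 * (\<rho> * r1) \<le> 1" using r10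
      by (simp_all add: algebra_simps)
  qed (simp add: r1_def)
  define \<Lambda> where "\<Lambda> = 2 * (CA * (p * (real N * (LG * 2))))"
  have L0: "\<Lambda> \<ge> 0" using CA0 p0 LG_nonneg by (simp add: \<Lambda>_def)
  have sol: "\<exists>v. reduced_family \<rho> \<Lambda> r v" if r: "0 < r" "r \<le> r1" for r
  proof -
    define \<delta> where "\<delta> = \<rho> * r"
    have d0: "\<delta> \<ge> 0" using rho0 r by (simp add: \<delta>_def)
    have d4: "4 * \<delta> \<le> gap_min" using mult_left_mono[OF r(2) rho0] r1c by (simp add: \<delta>_def)
    have r2: "r \<le> 1" using r r1a by linarith
    have Er: "E * r \<le> 1 / 2" using mult_left_mono[OF r(2) E0] r1b by simp
    let ?T = "\<lambda>a v. lm.right_inverse (residual a r v)"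
    have res: "per (residual a r v)" if "per v" "\<And>t. cmod (v t) \<le> \<delta>" for a v
      using per_residual[OF that(1) that(2) d4] .
    have dif: "cmod (?T a v t - ?T a' v' t) \<le> S / 2 + CA * (p * (real N * (LG * 2))) * cmod (a - a')"
      if v: "per v" "\<And>t. cmod (v t) \<le> \<delta>" and v': "per v'" "\<And>t. cmod (v' t) \<le> \<delta>"
        and S: "\<And>t. cmod (v t - v' t) \<le> S" for a a' v v' S t
    proof -
      have S0: "S \<ge> 0" using S[of 0] norm_ge_zero order_trans by blast
      have ineq: "cmod (residual a r v t - residual a' r v' t) \<le> E * r / CA * S + p * (real N * (LG * 2)) * cmod (a - a')" for t
      proof -
        have "cmod (residual a r v t - residual a' r v' t) \<le> 128 * \<delta> / gap_min ^ 3 * S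
            + p * r * (real N * (LG * (2 * cmod (a - a') + 2 * r * S)))"
          using residual_lipschitz[of v \<delta> v' S r a t a', OF v(2) v'(2) d4 S] r by (simp add: cpl)
        also have "\<dots> = (128 * \<rho> / gap_min ^ 3 + p * (real N * (LG * 2)) * r) * r * S
            + p * (real N * (LG * 2)) * cmod (a - a') * r"
          by (simp add: \<delta>_def algebra_simps)
        also have "\<dots> \<le> (128 * \<rho> / gap_min ^ 3 + p * (real N * (LG * 2)) * 1) * r * S
            + p * (real N * (LG * 2)) * cmod (a - a') * 1"
          using r r2 S0 p0 LG_nonneg
          by (intro add_mono mult_left_mono mult_right_mono mult_nonneg_nonneg) auto
        also have "(128 * \<rho> / gap_min ^ 3 + p * (real N * (LG * 2)) * 1) * r * S = E * r / CA * S"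
          using CA0 by (simp add: E_def)
        finally show ?thesis by simp
      qed
      have "?T a v t - ?T a' v' t = lm.right_inverse (\<lambda>t. residual a r v t - residual a' r v' t) t"
        by (rule lm.right_inverse_diff[OF res[OF v] res[OF v'], symmetric])
      also have "cmod \<dots> \<le> CA * (E * r / CA * S + p * (real N * (LG * 2)) * cmod (a - a'))"
        unfolding CA_def
        by (rule lm.right_inverse_series(2)[OF per_diff[OF res[OF v] res[OF v']]]) (rule ineq[unfolded CA_def])
      also have "\<dots> = E * r * S + CA * (p * (real N * (LG * 2))) * cmod (a - a')"
        using CA0 by (simp add: algebra_simps)
      also have "E * r * S \<le> S / 2" using mult_right_mono[OF Er S0] by simp
      finally show ?thesis by simp
    qed
    have zero: "cmod (?T a (\<lambda>t. 0) t) \<le> \<delta> / 2" for a t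
    proof -
      have "cmod (?T a (\<lambda>t. 0) t) \<le> CA * (coupling r * (real N * MG))"
        unfolding CA_def
        by (rule lm.right_inverse_series(2)[OF res residual_zero_bound]) (use d0 r in auto)
      then show ?thesis by (simp add: \<delta>_def \<rho>_def cpl mult_ac)
    qed
    have "\<exists>v. per v \<and> (\<forall>t. cmod (v t) \<le> \<delta>) \<and> ?T a v = v" for a
    proof (rule periodic_contraction_fixed_point[OF d0])
      fix v :: "real \<Rightarrow> complex" assume v: "per v" "\<And>t. cmod (v t) \<le> \<delta>"
      have "cmod (?T a v t) \<le> \<delta>" for t
      proof -
        have "cmod (?T a v t - ?T a (\<lambda>t. 0) t) \<le> \<delta> / 2 + CA * (p * (real N * (LG * 2))) * cmod (a - a)"
          by (rule dif[OF v]) (use v d0 in auto)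
        then show ?thesis
          using zero[of a t] norm_triangle_sub[of "?T a v t" "?T a (\<lambda>t. 0) t"] by simp
      qed
      then show "per (?T a v) \<and> (\<forall>t. cmod (?T a v t) \<le> \<delta>)" using lm.right_inverse_per[OF res[OF v]] by blast
    next
      fix v w :: "real \<Rightarrow> complex" and S t
      assume "per v" "\<And>t. cmod (v t) \<le> \<delta>" "per w" "\<And>t. cmod (w t) \<le> \<delta>" "\<And>t. cmod (v t - w t) \<le> S"
      from dif[OF this, of a t a] show "cmod (?T a v t - ?T a w t) \<le> S / 2" by simp
    qed
    then obtain v where v: "\<And>a. per (v a)" "\<And>a t. cmod (v a t) \<le> \<delta>" "\<And>a. ?T a (v a) = v a" by metis
    have "cmod (v a t - v a' t) \<le> \<Lambda> * cmod (a - a')" for a a' t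
    proof -
      \<comment> \<open>The supremum distance satisfies \<open>S \<le> S / 2\<close> plus the
        explicit dependence on the centre; it is finite because both corrections are bounded, and
        this doubling is the 2 in \<open>\<Lambda>\<close>.\<close>
      define S where "S = (SUP t. cmod (v a t - v a' t))"
      have bd: "bdd_above (range (\<lambda>t. cmod (v a t - v a' t)))"
      proof (rule bdd_aboveI2)
        fix t
        show "cmod (v a t - v a' t) \<le> \<delta> + \<delta>" by (rule order_trans[OF norm_triangle_ineq4 add_mono[OF v(2) v(2)]])
      qed
      have S: "cmod (v a t - v a' t) \<le> S" for t unfolding S_def by (rule cSUP_upper[OF _ bd]) simp
      have "cmod (v a t - v a' t) \<le> S / 2 + CA * (p * (real N * (LG * 2))) * cmod (a - a')" for t
        using dif[OF v(1,2) v(1,2) S, of a t a'] v(3) by simp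
      then have "S \<le> S / 2 + CA * (p * (real N * (LG * 2))) * cmod (a - a')"
        unfolding S_def[of ] by (intro cSUP_least) (auto simp: S_def[symmetric])
      then have "S \<le> \<Lambda> * cmod (a - a')" by (simp add: \<Lambda>_def)
      then show ?thesis using S[of t] by linarith
    qed
    then show ?thesis using v unfolding reduced_family_def \<delta>_def by (intro exI[of _ v]) simp
  qed
  show thesis by (rule that[OF rho0 r10 L0 r1c r1d sol])
qed

end

section \<open>Variational structure\<close>

lemma ln_cmod_has_derivative:
  assumes "z \<noteq> 0"
  shows "((\<lambda>z. ln (cmod z)) has_derivative (\<lambda>h. (1 / cnj z) \<bullet> h)) (at z within S)"
proof -
  have "((\<lambda>z. ln (cmod z)) has_derivative (\<lambda>h. (sgn z \<bullet> h) * inverse (cmod z))) (at z within S)"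
    using assms has_derivative_at_withinI[OF has_derivative_norm[OF assms]]
    by (auto intro!: derivative_eq_intros simp: inner_commute)
  moreover have "(sgn z \<bullet> h) * inverse (cmod z) = (1 / cnj z) \<bullet> h" for h
  proof -
    have "1 / cnj z = (inverse (cmod z))\<^sup>2 *\<^sub>R z"
      using assms complex_norm_square[of z]
      by (simp add: scaleR_conv_of_real field_simps)
    then show ?thesis by (simp add: sgn_div_norm power2_eq_square)
  qed
  ultimately show ?thesis by simp
qed

lemma ln_cmod_quadratic_bound:
  assumes m: "m > 0" "m \<le> cmod x" "2 * cmod d \<le> m"
  shows "\<bar>ln (cmod (x + d)) - ln (cmod x) - (1 / cnj x) \<bullet> d\<bar> \<le> 2 / m\<^sup>2 * (cmod d)\<^sup>2"
proof -
  let ?S = "cball x (m / 2)"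
  have low: "m / 2 \<le> cmod z" if "z \<in> ?S" for z
    using that m norm_triangle_ineq2[of x "x - z"] by (simp add: dist_norm)
  have "\<bar>ln (cmod (x + d)) - ln (cmod x) - (1 / cnj x) \<bullet> (x + d - x)\<bar> \<le> 2 / m\<^sup>2 * (cmod (x + d - x))\<^sup>2"
  proof (rule quadratic_bound_lipschitz_gradient[where S = ?S and V = "\<lambda>z. 1 / cnj z"])
    fix z assume z: "z \<in> ?S"
    have z0: "z \<noteq> 0" and x0: "x \<noteq> 0" using low[OF z] m by auto
    show "((\<lambda>z. ln (cmod z)) has_derivative (\<lambda>d. (1 / cnj z) \<bullet> d)) (at z within ?S)"
      by (rule ln_cmod_has_derivative[OF z0])
    have "1 / cnj z - 1 / cnj x = cnj (x - z) / (cnj z * cnj x)" using z0 x0 by (simp add: field_simps)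
    then have "cmod (1 / cnj z - 1 / cnj x) = cmod (z - x) / (cmod z * cmod x)"
      by (simp only: norm_divide norm_mult complex_mod_cnj norm_minus_commute)
    also have "\<dots> \<le> cmod (z - x) / (m / 2 * m)"
      using low[OF z] m by (intro divide_left_mono mult_mono mult_pos_pos) auto
    finally show "cmod (1 / cnj z - 1 / cnj x) \<le> 2 / m\<^sup>2 * cmod (z - x)"
      by (simp add: power2_eq_square mult.commute)
  qed (use m in \<open>auto simp: dist_norm\<close>)
  then show ?thesis by simp
qed

lemma has_derivative_of_quadratic_bound:
  fixes f :: "'a::real_inner \<Rightarrow> real"
  assumes e: "e > 0" and C: "\<And>y. y \<in> S \<Longrightarrow> norm (y - x) \<le> e \<Longrightarrow> \<bar>f y - f x - V \<bullet> (y - x)\<bar> \<le> C * (norm (y - x))\<^sup>2"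
  shows "(f has_derivative (\<lambda>d. V \<bullet> d)) (at x within S)"
  unfolding has_derivative_within_alt
proof (intro conjI allI impI)
  show "bounded_linear (\<lambda>d. V \<bullet> d)" by (rule bounded_linear_inner_right)
  fix \<epsilon> :: real assume ep: "\<epsilon> > 0"
  define D where "D = min e (\<epsilon> / (\<bar>C\<bar> + 1))"
  have D: "D > 0" using e ep by (simp add: D_def)
  have "norm (f y - f x - V \<bullet> (y - x)) \<le> \<epsilon> * norm (y - x)" if y: "y \<in> S" "norm (y - x) < D" for y
  proof -
    have "norm (f y - f x - V \<bullet> (y - x)) \<le> C * (norm (y - x))\<^sup>2" using C[OF y(1)] y(2) by (simp add: D_def)
    also have "\<dots> \<le> (\<bar>C\<bar> + 1) * norm (y - x) * norm (y - x)"
      unfolding power2_eq_square mult.assoc by (intro mult_right_mono) auto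
    also have "\<dots> \<le> \<epsilon> * norm (y - x)"
    proof (rule mult_right_mono)
      have "norm (y - x) \<le> \<epsilon> / (\<bar>C\<bar> + 1)" using y(2) by (simp add: D_def)
      then show "(\<bar>C\<bar> + 1) * norm (y - x) \<le> \<epsilon>" by (simp add: pos_le_divide_eq mult.commute)
    qed simp
    finally show ?thesis .
  qed
  then show "\<exists>d>0. \<forall>y\<in>S. norm (y - x) < d \<longrightarrow> norm (f y - f x - V \<bullet> (y - x)) \<le> \<epsilon> * norm (y - x)"
    using D by blast
qed

lemma i_times_inner_self: "(\<i> * z) \<bullet> z = 0" "z \<bullet> (\<i> * z) = 0"
  by (simp_all add: inner_complex_def)

lemma of_real_mult_inner: "(of_real c * z) \<bullet> w = c * (z \<bullet> w)" for z w :: complex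
  by (simp add: inner_complex_def algebra_simps)

text \<open>By symmetry of \<open>g\<close> its second partial gradient is \<open>G\<close> with
  swapped arguments. Centres will range over the ball of radius \<open>R0\<close> and orbits stray
  from them by at most \<open>2 * r \<le> R0\<close>; hence the radius
  \<open>2 * R0\<close>.\<close>

locale ngon_potential = ngon_field +
  fixes g :: "complex \<times> complex \<Rightarrow> real" and a0 :: complex and R0 :: real
  assumes R0: "R0 > 0"
    and g_der: "\<And>w z. w \<in> cball a0 (2 * R0) \<Longrightarrow> z \<in> cball a0 (2 * R0) \<Longrightarrow>
      (g has_derivative (\<lambda>d. G w z \<bullet> fst d + G z w \<bullet> snd d)) (at (w, z))"
begin

lemma g_has_derivative:
  assumes "p \<in> cball a0 (2 * R0) \<times> cball a0 (2 * R0)"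
  shows "(g has_derivative (\<lambda>d. (G (fst p) (snd p), G (snd p) (fst p)) \<bullet> d)) (at p within S)"
  using g_der[of "fst p" "snd p"] assms has_derivative_at_withinI
  by (auto simp: inner_prod_def)

lemma g_quadratic_bound:
  assumes p: "p \<in> cball a0 (2 * R0) \<times> cball a0 (2 * R0)" and q: "q \<in> cball a0 (2 * R0) \<times> cball a0 (2 * R0)"
  shows "\<bar>g q - g p - (G (fst p) (snd p), G (snd p) (fst p)) \<bullet> (q - p)\<bar> \<le> 4 * LG * (norm (q - p))\<^sup>2"
proof (rule quadratic_bound_lipschitz_gradient[OF _ p q, where V = "\<lambda>p. (G (fst p) (snd p), G (snd p) (fst p))"])
  fix z
  let ?B = "LG * (cmod (fst z - fst p) + cmod (snd z - snd p))"
  have "norm ((G (fst z) (snd z), G (snd z) (fst z)) - (G (fst p) (snd p), G (snd p) (fst p)))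
    \<le> cmod (G (fst z) (snd z) - G (fst p) (snd p)) + cmod (G (snd z) (fst z) - G (snd p) (fst p))"
    using norm_Pair_le by simp
  also have "\<dots> \<le> ?B + ?B"
    using G_lip[of "fst z" "snd z" "fst p" "snd p"] G_lip[of "snd z" "fst z" "snd p" "fst p"]
    by (simp add: add.commute)
  also have "?B \<le> LG * (norm (z - p) + norm (z - p))"
    using dist_fst_le[of z p] dist_snd_le[of z p] LG_nonneg
    by (intro mult_left_mono add_mono) (simp_all add: dist_norm)
  finally show "norm ((G (fst z) (snd z), G (snd z) (fst z)) - (G (fst p) (snd p), G (snd p) (fst p)))
    \<le> 4 * LG * norm (z - p)" by simp
qed (use LG_nonneg g_has_derivative in \<open>auto intro: convex_Times\<close>)

lemma per_g:
  assumes "per x" "per y" "\<And>t. x t \<in> cball a0 (2 * R0)" "\<And>t. y t \<in> cball a0 (2 * R0)"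
  shows "per (\<lambda>t. g (x t, y t))"
proof -
  have "continuous_on (cball a0 (2 * R0) \<times> cball a0 (2 * R0)) g"
    using g_has_derivative has_derivative_continuous continuous_on_eq_continuous_within by blast
  moreover have "continuous_on UNIV (\<lambda>t. (x t, y t))" using assms by (intro continuous_intros per_cont)
  ultimately have "continuous_on UNIV (\<lambda>t. g (x t, y t))"
    by (rule continuous_on_compose2) (use assms in auto)
  then show ?thesis using assms(1,2) by (simp add: per_def)
qed

lemma per_ln: "per x \<Longrightarrow> (\<And>t. x t \<noteq> 0) \<Longrightarrow> per (\<lambda>t. ln (cmod (x t)))"
  by (auto simp: per_def intro!: continuous_intros)

lemma per_recip: "per x \<Longrightarrow> (\<And>t. x t \<noteq> 0) \<Longrightarrow> per (\<lambda>t. 1 / cnj (x t))"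
  by (auto simp: per_def intro!: continuous_intros)

lemma sum_avg_swap_all:
  fixes H :: "real \<Rightarrow> real \<Rightarrow> 'b::euclidean_space"
  assumes "\<And>j. per (\<lambda>t. H t (t + shift j))" "\<And>s t. H s (t + 2 * pi) = H s t"
  shows "(\<Sum>j<N. avg (\<lambda>t. H t (t + shift j))) = (\<Sum>j<N. avg (\<lambda>t. H (t + shift j) t))"
proof -
  have "{..<N} = insert 0 {1..<N}" using N2 by auto
  then show ?thesis using sum_avg_swap[of H] assms by (simp add: shift_def)
qed

definition gap :: "(real \<Rightarrow> complex) \<Rightarrow> nat \<Rightarrow> real \<Rightarrow> complex" where
  "gap u j t = u t - u (t + shift j)"

lemma per_gap: "per u \<Longrightarrow> per (gap u j)" unfolding gap_def by (intro per_intros)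

lemma vortex_field_alt: "vortex_field u t = of_real (2 / (real N - 1)) * (\<Sum>j\<in>{1..<N}. 1 / cnj (gap u j t))"
  by (simp add: vortex_field_def gap_def)

text \<open>The force is the gradient of the interaction energy: by the exchange symmetry of the averages, testing it
  with \<open>d\<close> gives the first variation.\<close>
lemma first_variation:
  fixes a :: complex and r :: real
  assumes u: "per u" and d: "per d" and sep: "\<And>t j. j \<in> {1..<N} \<Longrightarrow> gap u j t \<noteq> 0"
  defines "x \<equiv> \<lambda>t. a + of_real r * u t"
  shows "avg (\<lambda>t. force a r u t \<bullet> d t) =
    1 / (real N - 1) * (\<Sum>j\<in>{1..<N}. avg (\<lambda>t. (1 / cnj (gap u j t)) \<bullet> gap d j t))
    + coupling r / 2 * (\<Sum>j<N. avg (\<lambda>t. G (x t) (x (t + shift j)) \<bullet> d t + G (x (t + shift j)) (x t) \<bullet> d (t + shift j)))"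
proof -
  have px: "per x" unfolding x_def by (intro per_intros u)
  define \<phi> where "\<phi> j t = (1 / cnj (gap u j t)) \<bullet> d t" for j t
  define \<phi>' where "\<phi>' j t = (1 / cnj (gap u j t)) \<bullet> d (t + shift j)" for j t
  define \<gamma> where "\<gamma> j t = G (x t) (x (t + shift j)) \<bullet> d t" for j t
  define \<gamma>' where "\<gamma>' j t = G (x (t + shift j)) (x t) \<bullet> d (t + shift j)" for j t
  have p1: "per (\<phi> j)" "per (\<phi>' j)" if "j \<in> {1..<N}" for j
    unfolding \<phi>_def \<phi>'_def by (intro per_inner per_recip per_gap u sep that d per_translate)+
  have p2: "per (\<gamma> j)" "per (\<gamma>' j)" for j
    unfolding \<gamma>_def \<gamma>'_def by (intro per_inner per_G px d per_translate)+
  have ps1: "per (\<lambda>t. \<Sum>j\<in>{1..<N}. \<phi> j t)" by (intro per_sum p1)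
  have ps2: "per (\<lambda>t. \<Sum>j<N. \<gamma> j t)" by (intro per_sum p2)
  have swap1: "(\<Sum>j\<in>{1..<N}. avg (\<phi> j)) = - (\<Sum>j\<in>{1..<N}. avg (\<phi>' j))"
  proof -
    have "(\<Sum>j\<in>{1..<N}. avg (\<phi> j)) = (\<Sum>j\<in>{1..<N}. avg (\<lambda>t. (1 / cnj (u (t + shift j) - u t)) \<bullet> d (t + shift j)))"
      using sum_avg_swap[of "\<lambda>s t. (1 / cnj (u s - u t)) \<bullet> d s"] p1(1) per_shift[OF u]
      unfolding \<phi>_def gap_def by simp
    also have "\<dots> = (\<Sum>j\<in>{1..<N}. - avg (\<phi>' j))"
    proof (rule sum.cong[OF refl])
      fix j assume j: "j \<in> {1..<N}"
      have e: "1 / cnj (u (t + shift j) - u t) = - (1 / cnj (gap u j t))" for t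
        unfolding gap_def by (metis complex_cnj_minus minus_diff_eq minus_divide_right)
      have "avg (\<lambda>t. (1 / cnj (u (t + shift j) - u t)) \<bullet> d (t + shift j)) = avg (\<lambda>t. - \<phi>' j t)"
        unfolding e \<phi>'_def inner_minus_left by simp
      also have "\<dots> = - avg (\<phi>' j)" using avg_linear[OF bounded_linear_minus[OF bounded_linear_ident] p1(2)[OF j]] by simp
      finally show "avg (\<lambda>t. (1 / cnj (u (t + shift j) - u t)) \<bullet> d (t + shift j)) = - avg (\<phi>' j)" .
    qed
    finally show ?thesis by (simp add: sum_negf)
  qed
  have swap2: "(\<Sum>j<N. avg (\<gamma> j)) = (\<Sum>j<N. avg (\<gamma>' j))"
    using sum_avg_swap_all[of "\<lambda>s t. G (x s) (x t) \<bullet> d s"] p2(1) per_shift[OF px]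
    unfolding \<gamma>_def \<gamma>'_def by simp
  have "force a r u t \<bullet> d t = 2 / (real N - 1) * (\<Sum>j\<in>{1..<N}. \<phi> j t) + coupling r * (\<Sum>j<N. \<gamma> j t)" for t
    unfolding force_def vortex_field_alt gsum_def inner_add_left of_real_mult_inner inner_sum_left \<phi>_def \<gamma>_def x_def
    by simp
  then have "avg (\<lambda>t. force a r u t \<bullet> d t) = avg (\<lambda>t. 2 / (real N - 1) * (\<Sum>j\<in>{1..<N}. \<phi> j t) + coupling r * (\<Sum>j<N. \<gamma> j t))"
    by simp
  also have "\<dots> = 2 / (real N - 1) * avg (\<lambda>t. \<Sum>j\<in>{1..<N}. \<phi> j t) + coupling r * avg (\<lambda>t. \<Sum>j<N. \<gamma> j t)"
    by (simp only: avg_add[OF per_mult[OF per_const ps1] per_mult[OF per_const ps2]]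
        avg_linear[OF bounded_linear_mult_right ps1] avg_linear[OF bounded_linear_mult_right ps2])
  also have "avg (\<lambda>t. \<Sum>j\<in>{1..<N}. \<phi> j t) = (\<Sum>j\<in>{1..<N}. avg (\<phi> j))" by (intro avg_sum p1)
  also have "avg (\<lambda>t. \<Sum>j<N. \<gamma> j t) = (\<Sum>j<N. avg (\<gamma> j))" by (intro avg_sum p2)
  finally have main: "avg (\<lambda>t. force a r u t \<bullet> d t) = 2 / (real N - 1) * (\<Sum>j\<in>{1..<N}. avg (\<phi> j)) + coupling r * (\<Sum>j<N. avg (\<gamma> j))" .
  have s1: "(\<Sum>j\<in>{1..<N}. avg (\<lambda>t. (1 / cnj (gap u j t)) \<bullet> gap d j t)) = 2 * (\<Sum>j\<in>{1..<N}. avg (\<phi> j))"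
  proof -
    have "(\<Sum>j\<in>{1..<N}. avg (\<lambda>t. (1 / cnj (gap u j t)) \<bullet> gap d j t)) = (\<Sum>j\<in>{1..<N}. avg (\<phi> j) - avg (\<phi>' j))"
    proof (rule sum.cong[OF refl])
      fix j assume j: "j \<in> {1..<N}"
      have "(\<lambda>t. (1 / cnj (gap u j t)) \<bullet> gap d j t) = (\<lambda>t. \<phi> j t - \<phi>' j t)"
        by (simp add: \<phi>_def \<phi>'_def gap_def[of d] inner_diff_right)
      then show "avg (\<lambda>t. (1 / cnj (gap u j t)) \<bullet> gap d j t) = avg (\<phi> j) - avg (\<phi>' j)"
        using avg_diff[OF p1[OF j]] by simp
    qed
    then show ?thesis using swap1 by (simp add: sum_subtractf)
  qed
  have s2: "(\<Sum>j<N. avg (\<lambda>t. G (x t) (x (t + shift j)) \<bullet> d t + G (x (t + shift j)) (x t) \<bullet> d (t + shift j))) = 2 * (\<Sum>j<N. avg (\<gamma> j))"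
    using avg_add[OF p2] swap2 by (simp add: \<gamma>_def \<gamma>'_def sum.distrib)
  show ?thesis unfolding main s1 s2 by simp
qed

text \<open>The first variation in the direction \<open>u'\<close> consists of total time
  derivatives of the logarithms and of \<open>g\<close> along the curve, which have mean zero over a
  period.\<close>

lemma force_work_zero:
  assumes u: "per u" and u': "per u'" and der: "\<And>t. (u has_vector_derivative u' t) (at t)"
    and sep: "\<And>t j. j \<in> {1..<N} \<Longrightarrow> gap u j t \<noteq> 0" and r: "r > 0"
    and rng: "\<And>t. a + of_real r * u t \<in> cball a0 (2 * R0)"
  shows "avg (\<lambda>t. force a r u t \<bullet> u' t) = 0"
proof -
  define x where "x t = a + of_real r * u t" for t
  have px: "per x" unfolding x_def by (intro per_intros u)
  have 1: "avg (\<lambda>t. (1 / cnj (gap u j t)) \<bullet> gap u' j t) = 0" if j: "j \<in> {1..<N}" for j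
  proof (rule avg_derivative)
    fix t
    have "(gap u j has_vector_derivative gap u' j t) (at t)"
      unfolding gap_def by (intro has_vector_derivative_diff der has_vector_derivative_translate)
    then have "(gap u j has_derivative (\<lambda>h. h *\<^sub>R gap u' j t)) (at t)" by (simp add: has_vector_derivative_def)
    from has_derivative_compose[OF this ln_cmod_has_derivative[OF sep[OF j]]]
    show "((\<lambda>t. ln (cmod (gap u j t))) has_vector_derivative (1 / cnj (gap u j t)) \<bullet> gap u' j t) (at t)"
      by (simp add: has_vector_derivative_def mult.commute)
  qed (rule per_ln[OF per_gap[OF u] sep[OF j]])
  have 2: "avg (\<lambda>t. G (x t) (x (t + shift j)) \<bullet> u' t + G (x (t + shift j)) (x t) \<bullet> u' (t + shift j)) = 0" for j
  proof -
    define q where "q t = G (x t) (x (t + shift j)) \<bullet> u' t + G (x (t + shift j)) (x t) \<bullet> u' (t + shift j)" for t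
    have pq: "per q" unfolding q_def by (intro per_add per_inner per_G px u' per_translate)
    have "avg (\<lambda>t. r * q t) = 0"
    proof (rule avg_derivative)
      fix t
      have dx: "(x has_vector_derivative of_real r * u' t) (at t)" for t
        unfolding x_def by (auto intro!: derivative_eq_intros der)
      have "((\<lambda>t. (x t, x (t + shift j))) has_vector_derivative (of_real r * u' t, of_real r * u' (t + shift j))) (at t)"
        by (intro has_vector_derivative_Pair dx has_vector_derivative_translate)
      then have "((\<lambda>t. (x t, x (t + shift j))) has_derivative (\<lambda>h. h *\<^sub>R (of_real r * u' t, of_real r * u' (t + shift j)))) (at t)"
        by (simp add: has_vector_derivative_def)
      from has_derivative_compose[OF this g_der]
      have "((\<lambda>t. g (x t, x (t + shift j))) has_derivative
        (\<lambda>h. G (x t) (x (t + shift j)) \<bullet> (h *\<^sub>R (of_real r * u' t)) + G (x (t + shift j)) (x t) \<bullet> (h *\<^sub>R (of_real r * u' (t + shift j))))) (at t)"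
        using rng by (simp add: x_def)
      moreover have "G (x t) (x (t + shift j)) \<bullet> (h *\<^sub>R (of_real r * u' t)) + G (x (t + shift j)) (x t) \<bullet> (h *\<^sub>R (of_real r * u' (t + shift j)))
          = h *\<^sub>R (r * q t)" for h
        unfolding q_def by (simp add: inner_complex_def algebra_simps)
      ultimately show "((\<lambda>t. g (x t, x (t + shift j))) has_vector_derivative r * q t) (at t)"
        by (simp add: has_vector_derivative_def)
    qed (rule per_g[OF px per_translate[OF px]], use rng in \<open>auto simp: x_def\<close>)
    then show ?thesis using r avg_linear[OF bounded_linear_mult_right pq, of r] unfolding q_def by simp
  qed
  show ?thesis
    using first_variation[OF u u' sep, of a r] 1 2 unfolding x_def by simp
qed

end

section \<open>Gradient of the reduced energy\<close>

context ngon_potential begin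

lemma force_lipschitz:
  assumes r: "r > 0" and m: "m > 0" and S: "\<And>t. cmod (u t - u' t) \<le> S"
    and sep: "\<And>t j. j \<in> {1..<N} \<Longrightarrow> m \<le> cmod (gap u j t)" "\<And>t j. j \<in> {1..<N} \<Longrightarrow> m \<le> cmod (gap u' j t)"
  shows "cmod (force a r u t - force a' r u' t) \<le> 4 / m\<^sup>2 * S + coupling r * (real N * (LG * (2 * cmod (a - a') + 2 * r * S)))"
proof -
  have c0: "coupling r \<ge> 0" using r Npos by (simp add: coupling_def)
  have one: "cmod (1 / cnj (gap u j t) - 1 / cnj (gap u' j t)) \<le> 2 / m\<^sup>2 * S" if j: "j \<in> {1..<N}" for j
  proof -
    have nz: "gap u j t \<noteq> 0" "gap u' j t \<noteq> 0" using sep(1)[OF j, of t] sep(2)[OF j, of t] m by auto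
    have "1 / cnj (gap u j t) - 1 / cnj (gap u' j t) = cnj (gap u' j t - gap u j t) / (cnj (gap u j t) * cnj (gap u' j t))"
      using nz by (simp add: field_simps)
    then have "cmod (1 / cnj (gap u j t) - 1 / cnj (gap u' j t)) = cmod (gap u' j t - gap u j t) / (cmod (gap u j t) * cmod (gap u' j t))"
      by (simp only: norm_divide norm_mult complex_mod_cnj)
    also have "\<dots> \<le> (2 * S) / (m * m)"
    proof (rule frac_le)
      have "gap u' j t - gap u j t = (u (t + shift j) - u' (t + shift j)) - (u t - u' t)" by (simp add: gap_def)
      then have "cmod (gap u' j t - gap u j t) \<le> cmod (u (t + shift j) - u' (t + shift j)) + cmod (u t - u' t)"
        by (metis norm_triangle_ineq4)
      then show "cmod (gap u' j t - gap u j t) \<le> 2 * S" using S[of t] S[of "t + shift j"] by linarith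
      then show "0 \<le> 2 * S" using norm_ge_zero order_trans by blast
      show "m * m \<le> cmod (gap u j t) * cmod (gap u' j t)"
        using sep(1)[OF j] sep(2)[OF j] m by (intro mult_mono) auto
    qed (use m in auto)
    finally show ?thesis by (simp add: power2_eq_square)
  qed
  have "force a r u t - force a' r u' t = of_real (2 / (real N - 1)) * (\<Sum>j\<in>{1..<N}. 1 / cnj (gap u j t) - 1 / cnj (gap u' j t))
      + of_real (coupling r) * (gsum a r u t - gsum a' r u' t)"
    unfolding force_def vortex_field_alt sum_subtractf right_diff_distrib by simp
  also have "cmod \<dots> \<le> 2 / (real N - 1) * ((real N - 1) * (2 / m\<^sup>2 * S))
      + coupling r * (real N * (LG * (2 * cmod (a - a') + 2 * r * S)))"
  proof (rule order_trans[OF norm_triangle_ineq add_mono])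
    have "cmod (\<Sum>j\<in>{1..<N}. 1 / cnj (gap u j t) - 1 / cnj (gap u' j t)) \<le> (\<Sum>j\<in>{1..<N}. 2 / m\<^sup>2 * S)"
      by (rule sum_norm_le) (rule one)
    also have "\<dots> = (real N - 1) * (2 / m\<^sup>2 * S)" using N2 by (simp add: of_nat_diff)
    finally show "cmod (of_real (2 / (real N - 1)) * (\<Sum>j\<in>{1..<N}. 1 / cnj (gap u j t) - 1 / cnj (gap u' j t)))
        \<le> 2 / (real N - 1) * ((real N - 1) * (2 / m\<^sup>2 * S))"
      unfolding norm_mult norm_of_real using Npos by (intro mult_mono) auto
    show "cmod (of_real (coupling r) * (gsum a r u t - gsum a' r u' t))
        \<le> coupling r * (real N * (LG * (2 * cmod (a - a') + 2 * r * S)))"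
      using mult_left_mono[OF gsum_lipschitz[of r u u' S a t a', OF less_imp_le[OF r] S] c0] c0
      by (simp add: norm_mult)
  qed
  also have "2 / (real N - 1) * ((real N - 1) * (2 / m\<^sup>2 * S)) = 4 / m\<^sup>2 * S"
    using Npos(2) by (simp add: nonzero_eq_divide_eq)
  finally show ?thesis .
qed

text \<open>Envelope principle: since \<open>u a\<close> is critical for the action among functions of mean zero, only the explicit
  dependence on \<open>a\<close> contributes to the derivative, and no differentiability of \<open>a \<mapsto> u a\<close> is needed.\<close>
lemma reduced_energy_gradient:
  fixes u :: "complex \<Rightarrow> real \<Rightarrow> complex" and c :: "complex \<Rightarrow> complex"
  assumes r: "r > 0" "2 * r \<le> R0" and m: "m > 0" and L: "\<Lambda> \<ge> 0"
    and pu: "\<And>a. per (u a)"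
    and der: "\<And>a t. a \<in> cball a0 R0 \<Longrightarrow> (u a has_vector_derivative \<i> * (force a r (u a) t - c a)) (at t)"
    and mean: "\<And>a. avg (u a) = 0" and bd: "\<And>a t. cmod (u a t) \<le> 2"
    and sep: "\<And>a t j. j \<in> {1..<N} \<Longrightarrow> m \<le> cmod (gap (u a) j t)"
    and lip: "\<And>a b t. cmod (u a t - u b t) \<le> \<Lambda> * cmod (a - b)"
  shows "\<exists>\<Psi>. \<forall>a\<in>cball a0 R0. (\<Psi> has_derivative (\<lambda>e. ((4 * pi / (real N - 1)) *\<^sub>R avg (gsum a r (u a))) \<bullet> e)) (at a within cball a0 R0)"
proof -
  define p where "p = 1 / (real N - 1)"
  have p0: "p > 0" using Npos by (simp add: p_def)
  have cpl: "coupling r / 2 = 2 * pi * p * r"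
    using Npos(2) unfolding coupling_def p_def by (simp add: divide_simps)
  define x where "x a t = a + of_real r * u a t" for a t
  define F where "F a t = force a r (u a) t - c a" for a t
  have sep0: "gap (u a) j t \<noteq> 0" if "j \<in> {1..<N}" for a j t using sep[OF that, of a t] m by auto
  have pforce: "per (force a r (u a))" for a
  proof -
    have "per (vortex_field (u a))" by (rule per_vortex_field[OF pu]) (use sep0 in \<open>auto simp: gap_def\<close>)
    then show ?thesis unfolding force_def by (intro per_add per_mult[OF per_const] per_gsum pu)
  qed
  have pF: "per (F a)" for a unfolding F_def by (intro per_diff pforce per_const)
  have px: "per (x a)" for a unfolding x_def by (intro per_intros pu)
  have rng: "x a t \<in> cball a0 (2 * R0)" if "a \<in> cball a0 R0" for a t
  proof -
    have "cmod (of_real r * u a t) \<le> 2 * r" using bd[of a t] r by (simp add: norm_mult)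
    then show ?thesis using that r norm_triangle_ineq[of "a - a0" "of_real r * u a t"]
      by (simp add: x_def dist_norm norm_minus_commute[of a0] add_diff_eq algebra_simps)
  qed
  have der': "(u a has_vector_derivative \<i> * F a t) (at t)" if "a \<in> cball a0 R0" for a t
    using der[OF that] by (simp add: F_def)
  have cavg: "c a = avg (force a r (u a))" if "a \<in> cball a0 R0" for a
  proof -
    have "avg (\<lambda>t. \<i> * F a t) = 0" by (rule avg_derivative[OF der'[OF that] pu])
    then have "avg (F a) = 0" by (simp add: avg_cmult[OF pF])
    then show ?thesis unfolding F_def by (simp add: avg_diff[OF pforce per_const])
  qed
  \<comment> \<open>The action of \<open>u a\<close>: interaction energy minus the symplectic term,
    in which \<open>- \<i> u'\<close> is written as \<open>F\<close>.\<close>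
  define \<Psi> where "\<Psi> a = p * (\<Sum>j\<in>{1..<N}. avg (\<lambda>t. ln (cmod (gap (u a) j t))))
     + 2 * pi * p * (\<Sum>j<N. avg (\<lambda>t. g (x a t, x a (t + shift j)))) - 1 / 2 * avg (\<lambda>t. F a t \<bullet> u a t)" for a
  define CF where "CF = 4 / m\<^sup>2 * \<Lambda> + coupling r * (real N * (LG * (2 + 2 * r * \<Lambda>)))"
  define K1 where "K1 = 2 / m\<^sup>2 * (2 * \<Lambda>)\<^sup>2"
  define K2 where "K2 = 4 * LG * (2 * (1 + r * \<Lambda>))\<^sup>2"
  \<comment> \<open>For centres this close the gaps change by at most \<open>m / 2\<close>, as the
    expansion of the logarithm requires.\<close>
  define e0 where "e0 = m / (4 * \<Lambda> + 1)"
  have e0: "e0 > 0" using m L by (simp add: e0_def)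
  have key: "\<bar>\<Psi> b - \<Psi> a - ((4 * pi / (real N - 1)) *\<^sub>R avg (gsum a r (u a))) \<bullet> (b - a)\<bar>
      \<le> (p * ((real N - 1) * K1) + 2 * pi * p * (real N * K2) + CF * \<Lambda>) * (norm (b - a))\<^sup>2"
    if a: "a \<in> cball a0 R0" and b: "b \<in> cball a0 R0" and near: "norm (b - a) \<le> e0" for a b
  proof -
    define D where "D = cmod (b - a)"
    have D0: "D \<ge> 0" by (simp add: D_def)
    define d where "d t = u b t - u a t" for t
    have pd: "per d" unfolding d_def by (intro per_diff pu)
    have dD: "cmod (d t) \<le> \<Lambda> * D" for t unfolding d_def D_def by (rule lip)
    have gd: "cmod (gap d j t) \<le> 2 * (\<Lambda> * D)" for j t
      unfolding gap_def using norm_triangle_ineq4[of "d t" "d (t + shift j)"] dD[of t] dD[of "t + shift j"] by linarith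
    have avgd: "avg d = 0" unfolding d_def by (simp add: avg_diff[OF pu pu] mean)
    have gapb: "gap (u b) j t = gap (u a) j t + gap d j t" for j t by (simp add: gap_def d_def)
    have small: "2 * cmod (gap d j t) \<le> m" for j t
    proof -
      have "D * (4 * \<Lambda> + 1) \<le> m" using near L unfolding D_def e0_def by (simp add: pos_le_divide_eq)
      then have "4 * (\<Lambda> * D) \<le> m" using D0 by (simp add: algebra_simps)
      then show ?thesis using gd[of j t] by linarith
    qed
    define V1 where "V1 = (\<Sum>j\<in>{1..<N}. avg (\<lambda>t. (1 / cnj (gap (u a) j t)) \<bullet> gap d j t))"
    define W where "W j t = G (x a t) (x a (t + shift j)) \<bullet> d t + G (x a (t + shift j)) (x a t) \<bullet> d (t + shift j)" for j t
    define V2 where "V2 = (\<Sum>j<N. avg (W j))"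
    have pW: "per (W j)" for j unfolding W_def by (intro per_add per_inner per_G px pd per_translate)
    have fv: "avg (\<lambda>t. force a r (u a) t \<bullet> d t) = p * V1 + 2 * pi * p * r * V2"
      using first_variation[where a = a and r = r and u = "u a" and d = d, OF pu pd sep0] unfolding cpl V1_def V2_def W_def x_def p_def by simp
    have T1: "\<bar>(\<Sum>j\<in>{1..<N}. avg (\<lambda>t. ln (cmod (gap (u b) j t)))) - (\<Sum>j\<in>{1..<N}. avg (\<lambda>t. ln (cmod (gap (u a) j t)))) - V1\<bar>
        \<le> (real N - 1) * K1 * D\<^sup>2"
    proof -
      have "\<bar>avg (\<lambda>t. ln (cmod (gap (u b) j t))) - avg (\<lambda>t. ln (cmod (gap (u a) j t))) - avg (\<lambda>t. (1 / cnj (gap (u a) j t)) \<bullet> gap d j t)\<bar> \<le> K1 * D\<^sup>2"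
        if j: "j \<in> {1..<N}" for j
      proof -
        have P: "per (\<lambda>t. ln (cmod (gap (u c) j t)))" for c by (rule per_ln[OF per_gap[OF pu] sep0[OF j]])
        have Q: "per (\<lambda>t. (1 / cnj (gap (u a) j t)) \<bullet> gap d j t)"
          by (rule per_inner[OF per_recip[OF per_gap[OF pu] sep0[OF j]] per_gap[OF pd]])
        have "norm (avg (\<lambda>t. ln (cmod (gap (u b) j t)) - ln (cmod (gap (u a) j t)) - (1 / cnj (gap (u a) j t)) \<bullet> gap d j t)) \<le> K1 * D\<^sup>2"
        proof (rule norm_avg_le[OF per_diff[OF per_diff[OF P P] Q]])
          fix t
          have "\<bar>ln (cmod (gap (u a) j t + gap d j t)) - ln (cmod (gap (u a) j t)) - (1 / cnj (gap (u a) j t)) \<bullet> gap d j t\<bar>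
              \<le> 2 / m\<^sup>2 * (cmod (gap d j t))\<^sup>2"
            by (rule ln_cmod_quadratic_bound[OF m sep[OF j] small])
          also have "\<dots> \<le> 2 / m\<^sup>2 * (2 * (\<Lambda> * D))\<^sup>2" using gd[of j t] by (intro mult_left_mono power_mono) auto
          also have "\<dots> = K1 * D\<^sup>2" by (simp add: K1_def power_mult_distrib)
          finally show "norm (ln (cmod (gap (u b) j t)) - ln (cmod (gap (u a) j t)) - (1 / cnj (gap (u a) j t)) \<bullet> gap d j t) \<le> K1 * D\<^sup>2"
            unfolding gapb by simp
        qed
        then show ?thesis by (simp only: avg_diff[OF per_diff[OF P P] Q] avg_diff[OF P P] real_norm_def)
      qed
      then have "\<bar>\<Sum>j\<in>{1..<N}. avg (\<lambda>t. ln (cmod (gap (u b) j t))) - avg (\<lambda>t. ln (cmod (gap (u a) j t))) - avg (\<lambda>t. (1 / cnj (gap (u a) j t)) \<bullet> gap d j t)\<bar>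
          \<le> (\<Sum>j\<in>{1..<N}. K1 * D\<^sup>2)"
        by (intro order_trans[OF sum_abs] sum_mono) auto
      also have "\<dots> = (real N - 1) * K1 * D\<^sup>2" using N2 by (simp add: of_nat_diff)
      finally show ?thesis by (simp add: sum_subtractf V1_def)
    qed
    define e where "e = b - a"
    have xb: "x b t = x a t + (e + of_real r * d t)" for t by (simp add: x_def e_def d_def algebra_simps)
    define Z where "Z j t = G (x a t) (x a (t + shift j)) \<bullet> e + G (x a (t + shift j)) (x a t) \<bullet> e" for j t
    have pZ: "per (Z j)" for j unfolding Z_def
      by (rule per_add[OF per_inner[OF per_G[OF px per_translate[OF px]] per_const] per_inner[OF per_G[OF per_translate[OF px] px] per_const]])
    have Zsum: "(\<Sum>j<N. avg (Z j)) = 2 * (avg (gsum a r (u a)) \<bullet> e)"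
    proof -
      have P: "per (\<lambda>t. G (x a t) (x a (t + shift j)) \<bullet> e)" "per (\<lambda>t. G (x a (t + shift j)) (x a t) \<bullet> e)" for j
        by (rule per_inner[OF per_G[OF px per_translate[OF px]] per_const] per_inner[OF per_G[OF per_translate[OF px] px] per_const])+
      have PG: "per (\<lambda>t. G (x a t) (x a (t + shift j)))" for j by (intro per_G px per_translate)
      have "(\<Sum>j<N. avg (\<lambda>t. G (x a t) (x a (t + shift j)) \<bullet> e)) = (\<Sum>j<N. avg (\<lambda>t. G (x a (t + shift j)) (x a t) \<bullet> e))"
        by (rule sum_avg_swap_all[of "\<lambda>s t. G (x a s) (x a t) \<bullet> e"]) (use P per_shift[OF px] in auto)
      moreover have "(\<Sum>j<N. avg (\<lambda>t. G (x a t) (x a (t + shift j)) \<bullet> e)) = avg (gsum a r (u a)) \<bullet> e"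
      proof -
        have "avg (gsum a r (u a)) = (\<Sum>j<N. avg (\<lambda>t. G (x a t) (x a (t + shift j))))"
          unfolding gsum_def x_def[symmetric] by (intro avg_sum PG)
        then show ?thesis by (simp add: inner_sum_left avg_linear[OF bounded_linear_inner_left PG])
      qed
      ultimately show ?thesis unfolding Z_def avg_add[OF P] sum.distrib by simp
    qed
    have T2: "\<bar>(\<Sum>j<N. avg (\<lambda>t. g (x b t, x b (t + shift j)))) - (\<Sum>j<N. avg (\<lambda>t. g (x a t, x a (t + shift j))))
        - (2 * (avg (gsum a r (u a)) \<bullet> e) + r * V2)\<bar> \<le> real N * K2 * D\<^sup>2"
    proof -
      have "\<bar>avg (\<lambda>t. g (x b t, x b (t + shift j))) - avg (\<lambda>t. g (x a t, x a (t + shift j))) - (avg (Z j) + r * avg (W j))\<bar> \<le> K2 * D\<^sup>2" for j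
      proof -
        have P: "per (\<lambda>t. g (x c t, x c (t + shift j)))" if "c \<in> cball a0 R0" for c
          by (rule per_g[OF px per_translate[OF px]]) (rule rng[OF that])+
        have Q: "per (\<lambda>t. Z j t + r * W j t)" by (intro per_add pZ per_mult per_const pW)
        have "norm (avg (\<lambda>t. g (x b t, x b (t + shift j)) - g (x a t, x a (t + shift j)) - (Z j t + r * W j t))) \<le> K2 * D\<^sup>2"
        proof (rule norm_avg_le[OF per_diff[OF per_diff[OF P[OF b] P[OF a]] Q]])
          fix t
          let ?p = "(x a t, x a (t + shift j))" and ?q = "(x b t, x b (t + shift j))"
          have "\<bar>g ?q - g ?p - (G (fst ?p) (snd ?p), G (snd ?p) (fst ?p)) \<bullet> (?q - ?p)\<bar> \<le> 4 * LG * (norm (?q - ?p))\<^sup>2"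
            by (rule g_quadratic_bound) (use rng[OF a] rng[OF b] in auto)
          moreover have "(G (fst ?p) (snd ?p), G (snd ?p) (fst ?p)) \<bullet> (?q - ?p) = Z j t + r * W j t"
            unfolding xb Z_def W_def by (simp add: inner_add_right algebra_simps inner_complex_def)
          moreover have "4 * LG * (norm (?q - ?p))\<^sup>2 \<le> K2 * D\<^sup>2"
          proof -
            have 1: "cmod (e + of_real r * d s) \<le> (1 + r * \<Lambda>) * D" for s
            proof -
              have "cmod (e + of_real r * d s) \<le> cmod e + cmod (of_real r * d s)" by (rule norm_triangle_ineq)
              also have "cmod (of_real r * d s) \<le> r * (\<Lambda> * D)" using dD[of s] r by (simp add: norm_mult)
              finally show ?thesis by (simp add: e_def D_def algebra_simps)
            qed
            have "norm (?q - ?p) \<le> cmod (e + of_real r * d t) + cmod (e + of_real r * d (t + shift j))"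
              unfolding xb using norm_Pair_le[of "e + of_real r * d t" "e + of_real r * d (t + shift j)"] by simp
            also have "\<dots> \<le> 2 * (1 + r * \<Lambda>) * D" using 1[of t] 1[of "t + shift j"] by linarith
            finally have "(norm (?q - ?p))\<^sup>2 \<le> (2 * (1 + r * \<Lambda>) * D)\<^sup>2" by (intro power_mono) auto
            then have "4 * LG * (norm (?q - ?p))\<^sup>2 \<le> 4 * LG * (2 * (1 + r * \<Lambda>) * D)\<^sup>2"
              using LG_nonneg by (intro mult_left_mono) auto
            also have "\<dots> = K2 * D\<^sup>2" by (simp add: K2_def power_mult_distrib)
            finally show ?thesis .
          qed
          ultimately show "norm (g ?q - g ?p - (Z j t + r * W j t)) \<le> K2 * D\<^sup>2" by simp
        qed
        then show ?thesis
          by (simp only: avg_diff[OF per_diff[OF P[OF b] P[OF a]] Q] avg_diff[OF P[OF b] P[OF a]]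
              avg_add[OF pZ per_mult[OF per_const pW]] avg_linear[OF bounded_linear_mult_right pW] real_norm_def)
      qed
      then have "\<bar>\<Sum>j<N. avg (\<lambda>t. g (x b t, x b (t + shift j))) - avg (\<lambda>t. g (x a t, x a (t + shift j))) - (avg (Z j) + r * avg (W j))\<bar>
          \<le> (\<Sum>j<N. K2 * D\<^sup>2)"
        by (intro order_trans[OF sum_abs] sum_mono) auto
      then show ?thesis
        by (simp add: sum_subtractf sum.distrib Zsum V2_def sum_distrib_left)
    qed
    define E where "E t = F b t - F a t" for t
    have pE: "per E" unfolding E_def by (intro per_diff pF)
    have ED: "cmod (E t) \<le> 2 * CF * D" for t
    proof -
      have ff: "cmod (force b r (u b) t - force a r (u a) t) \<le> CF * D" for t
      proof -
        have "cmod (force b r (u b) t - force a r (u a) t)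
            \<le> 4 / m\<^sup>2 * (\<Lambda> * D) + coupling r * (real N * (LG * (2 * cmod (b - a) + 2 * r * (\<Lambda> * D))))"
          by (rule force_lipschitz[OF r(1) m]) (use lip[of b _ a] sep in \<open>auto simp: D_def\<close>)
        also have "\<dots> = CF * D" by (simp add: CF_def D_def algebra_simps)
        finally show ?thesis .
      qed
      have "c b - c a = avg (\<lambda>t. force b r (u b) t - force a r (u a) t)"
        by (simp only: cavg[OF a] cavg[OF b] avg_diff[OF pforce pforce])
      then have "cmod (c b - c a) \<le> CF * D" using norm_avg_le[OF per_diff[OF pforce pforce] ff] by simp
      moreover have "E t = (force b r (u b) t - force a r (u a) t) - (c b - c a)" by (simp add: E_def F_def)
      ultimately show ?thesis using ff[of t] norm_triangle_ineq4[of "force b r (u b) t - force a r (u a) t" "c b - c a"] by simp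
    qed
    \<comment> \<open>The operator \<open>- \<i> d/dt\<close> is symmetric on periodic functions, so
      the two mixed terms coincide.\<close>
    have T3: "1 / 2 * avg (\<lambda>t. F b t \<bullet> u b t) - 1 / 2 * avg (\<lambda>t. F a t \<bullet> u a t) = avg (\<lambda>t. F a t \<bullet> d t) + 1 / 2 * avg (\<lambda>t. E t \<bullet> d t)"
    proof -
      have ibp: "avg (\<lambda>t. F a t \<bullet> d t - E t \<bullet> u a t) = 0"
      proof (rule avg_derivative)
        fix t
        have dd: "(d has_vector_derivative \<i> * E t) (at t)"
          unfolding d_def E_def right_diff_distrib by (intro has_vector_derivative_diff der' a b)
        have id: "((\<lambda>t. \<i> * d t) has_vector_derivative \<i> * (\<i> * E t)) (at t)"
          by (rule bounded_linear.has_vector_derivative[OF bounded_linear_mult_right dd])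
        have "((\<lambda>t. (\<i> * d t) \<bullet> u a t) has_vector_derivative ((\<i> * d t) \<bullet> (\<i> * F a t) + (\<i> * (\<i> * E t)) \<bullet> u a t)) (at t)"
          by (rule bounded_bilinear.has_vector_derivative[OF bounded_bilinear_inner id der'[OF a]])
        moreover have "(\<i> * d t) \<bullet> (\<i> * F a t) + (\<i> * (\<i> * E t)) \<bullet> u a t = F a t \<bullet> d t - E t \<bullet> u a t"
          by (simp add: inner_complex_def algebra_simps)
        ultimately show "((\<lambda>t. (\<i> * d t) \<bullet> u a t) has_vector_derivative F a t \<bullet> d t - E t \<bullet> u a t) (at t)" by simp
      qed (intro per_inner per_mult per_const pd pu)
      have P: "per (\<lambda>t. F a t \<bullet> d t)" "per (\<lambda>t. E t \<bullet> u a t)" "per (\<lambda>t. E t \<bullet> d t)" "per (\<lambda>t. F a t \<bullet> u a t)"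
        by (intro per_inner pF pE pd pu)+
      have "(\<lambda>t. F b t \<bullet> u b t) = (\<lambda>t. (F a t \<bullet> u a t + F a t \<bullet> d t) + (E t \<bullet> u a t + E t \<bullet> d t))"
        by (simp add: E_def d_def inner_simps)
      then have "avg (\<lambda>t. F b t \<bullet> u b t) = avg (\<lambda>t. F a t \<bullet> u a t) + avg (\<lambda>t. F a t \<bullet> d t) + avg (\<lambda>t. E t \<bullet> u a t) + avg (\<lambda>t. E t \<bullet> d t)"
        by (simp add: avg_add per_add P)
      moreover have "avg (\<lambda>t. E t \<bullet> u a t) = avg (\<lambda>t. F a t \<bullet> d t)"
        using ibp by (simp add: avg_diff P)
      ultimately show ?thesis by linarith
    qed
    \<comment> \<open>\<open>F\<close> differs from the force by a constant, which is invisible to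
      the mean-zero variation \<open>d\<close>.\<close>
    have Fd: "avg (\<lambda>t. F a t \<bullet> d t) = p * V1 + 2 * pi * p * r * V2"
    proof -
      have "avg (\<lambda>t. F a t \<bullet> d t) = avg (\<lambda>t. force a r (u a) t \<bullet> d t) - avg (\<lambda>t. c a \<bullet> d t)"
        unfolding F_def inner_diff_left by (intro avg_diff per_inner pforce pd per_const)
      also have "avg (\<lambda>t. c a \<bullet> d t) = 0" by (simp add: avg_linear[OF bounded_linear_inner_right pd] avgd)
      finally show ?thesis using fv by simp
    qed
    have T4: "\<bar>avg (\<lambda>t. E t \<bullet> d t)\<bar> \<le> 2 * CF * \<Lambda> * D\<^sup>2"
    proof -
      have "norm (avg (\<lambda>t. E t \<bullet> d t)) \<le> 2 * CF * D * (\<Lambda> * D)"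
      proof (rule norm_avg_le[OF per_inner[OF pE pd]])
        fix t
        have "norm (E t \<bullet> d t) \<le> cmod (E t) * cmod (d t)" using Cauchy_Schwarz_ineq2[of "E t" "d t"] by simp
        also have "\<dots> \<le> 2 * CF * D * (\<Lambda> * D)"
          by (rule mult_mono[OF ED dD order_trans[OF norm_ge_zero ED] norm_ge_zero])
        finally show "norm (E t \<bullet> d t) \<le> 2 * CF * D * (\<Lambda> * D)" .
      qed
      then show ?thesis by (simp add: power2_eq_square mult_ac)
    qed
    define s1 where "s1 = (\<Sum>j\<in>{1..<N}. avg (\<lambda>t. ln (cmod (gap (u b) j t)))) - (\<Sum>j\<in>{1..<N}. avg (\<lambda>t. ln (cmod (gap (u a) j t)))) - V1"
    define s2 where "s2 = (\<Sum>j<N. avg (\<lambda>t. g (x b t, x b (t + shift j)))) - (\<Sum>j<N. avg (\<lambda>t. g (x a t, x a (t + shift j))))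
        - (2 * (avg (gsum a r (u a)) \<bullet> e) + r * V2)"
    have "\<Psi> b - \<Psi> a = p * (s1 + V1) + 2 * pi * p * (s2 + (2 * (avg (gsum a r (u a)) \<bullet> e) + r * V2))
        - (1 / 2 * avg (\<lambda>t. F b t \<bullet> u b t) - 1 / 2 * avg (\<lambda>t. F a t \<bullet> u a t))"
      unfolding \<Psi>_def s1_def s2_def by (simp add: algebra_simps)
    \<comment> \<open>\<open>V1\<close> and \<open>V2\<close> occur in the energy and in the
      symplectic term and cancel. Apart from the linear term in \<open>e\<close>, only quadratic
      errors remain.\<close>
    also have "\<dots> = p * s1 + 2 * pi * p * s2 + 4 * pi * p * (avg (gsum a r (u a)) \<bullet> e) - 1 / 2 * avg (\<lambda>t. E t \<bullet> d t)"
      unfolding T3 Fd by (simp add: algebra_simps)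
    finally have "\<Psi> b - \<Psi> a - 4 * pi * p * (avg (gsum a r (u a)) \<bullet> e) = p * s1 + 2 * pi * p * s2 - 1 / 2 * avg (\<lambda>t. E t \<bullet> d t)"
      by simp
    moreover have "\<bar>p * s1\<bar> \<le> p * ((real N - 1) * K1 * D\<^sup>2)"
      using T1 p0 unfolding s1_def[symmetric] by (simp add: abs_mult)
    moreover have "\<bar>2 * pi * p * s2\<bar> \<le> 2 * pi * p * (real N * K2 * D\<^sup>2)"
      using T2 p0 unfolding s2_def[symmetric] abs_mult by (intro mult_mono) auto
    ultimately have "\<bar>\<Psi> b - \<Psi> a - 4 * pi * p * (avg (gsum a r (u a)) \<bullet> e)\<bar>
        \<le> p * ((real N - 1) * K1 * D\<^sup>2) + 2 * pi * p * (real N * K2 * D\<^sup>2) + CF * \<Lambda> * D\<^sup>2"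
      using T4 by linarith
    also have "\<dots> = (p * ((real N - 1) * K1) + 2 * pi * p * (real N * K2) + CF * \<Lambda>) * D\<^sup>2"
      by (simp add: algebra_simps)
    finally show ?thesis by (simp add: D_def e_def p_def)
  qed
  show ?thesis
  proof (intro exI ballI)
    fix a assume a: "a \<in> cball a0 R0"
    show "(\<Psi> has_derivative (\<lambda>e. ((4 * pi / (real N - 1)) *\<^sub>R avg (gsum a r (u a))) \<bullet> e)) (at a within cball a0 R0)"
      by (rule has_derivative_of_quadratic_bound[OF e0 key[OF a]])
  qed
qed

end

section \<open>Identification of the multipliers\<close>

context ngon_potential begin

text \<open>Action equals reaction: the mutual forces change sign under the exchange of a pair.
  Hence the constant multiplier comes from \<open>gsum\<close> alone.\<close>

lemma avg_vortex_field:
  assumes u: "per u" and sep: "\<And>t j. j \<in> {1..<N} \<Longrightarrow> gap u j t \<noteq> 0"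
  shows "avg (vortex_field u) = 0"
proof -
  define S where "S = (\<Sum>j\<in>{1..<N}. avg (\<lambda>t. 1 / cnj (gap u j t)))"
  have P: "per (\<lambda>t. 1 / cnj (gap u j t))" if "j \<in> {1..<N}" for j
    by (rule per_recip[OF per_gap[OF u] sep[OF that]])
  have "S = (\<Sum>j\<in>{1..<N}. avg (\<lambda>t. 1 / cnj (u (t + shift j) - u t)))"
    unfolding S_def using sum_avg_swap[of "\<lambda>s t. 1 / cnj (u s - u t)"] P per_shift[OF u]
    unfolding gap_def by simp
  also have "\<dots> = (\<Sum>j\<in>{1..<N}. - avg (\<lambda>t. 1 / cnj (gap u j t)))"
  proof (rule sum.cong[OF refl])
    fix j assume j: "j \<in> {1..<N}"
    have e: "1 / cnj (u (t + shift j) - u t) = - (1 / cnj (gap u j t))" for t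
      unfolding gap_def by (metis complex_cnj_minus minus_diff_eq minus_divide_right)
    show "avg (\<lambda>t. 1 / cnj (u (t + shift j) - u t)) = - avg (\<lambda>t. 1 / cnj (gap u j t))"
      unfolding e by (rule avg_linear[OF bounded_linear_minus[OF bounded_linear_ident] P[OF j]])
  qed
  also have "\<dots> = - S" by (simp add: S_def sum_negf)
  finally have "S = - S" .
  then have "S = 0" by simp
  moreover have "avg (vortex_field u) = of_real (2 / (real N - 1)) * S"
  proof -
    have PS: "per (\<lambda>t. \<Sum>j\<in>{1..<N}. 1 / cnj (gap u j t))" by (intro per_sum P)
    have "avg (vortex_field u) = of_real (2 / (real N - 1)) * avg (\<lambda>t. \<Sum>j\<in>{1..<N}. 1 / cnj (gap u j t))"
      unfolding vortex_field_alt by (rule avg_cmult[OF PS])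
    also have "avg (\<lambda>t. \<Sum>j\<in>{1..<N}. 1 / cnj (gap u j t)) = S" unfolding S_def by (intro avg_sum P)
    finally show ?thesis .
  qed
  ultimately show ?thesis by simp
qed

text \<open>Invariance of the action under time translations removes the multiplier belonging to the kernel
  element \<open>\<i> cis\<close>.\<close>
lemma rotation_multiplier_vanishes:
  assumes u: "per u" and der: "\<And>t. (u has_vector_derivative \<i> * (force a r u t - c - \<i> * of_real \<mu> * cis t)) (at t)"
    and sep: "\<And>t j. j \<in> {1..<N} \<Longrightarrow> gap u j t \<noteq> 0" and r: "r > 0"
    and rng: "\<And>t. a + of_real r * u t \<in> cball a0 (2 * R0)"
    and near: "\<And>t. cmod (u t - cis t) \<le> 1 / 2"
  shows "\<mu> = 0"
proof -
  define z where "z t = force a r u t - c - \<i> * of_real \<mu> * cis t" for t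
  have pforce: "per (force a r u)"
  proof -
    have "per (vortex_field u)" by (rule per_vortex_field[OF u]) (use sep in \<open>auto simp: gap_def\<close>)
    then show ?thesis unfolding force_def by (intro per_add per_mult[OF per_const] per_gsum u)
  qed
  have pz: "per z" unfolding z_def by (intro per_diff pforce per_const per_mult per_cis1)
  define w where "w t = \<i> * z t" for t
  have pw: "per w" unfolding w_def by (intro per_mult per_const pz)
  have dw: "(u has_vector_derivative w t) (at t)" for t using der[of t] by (simp add: w_def z_def)
  have aw: "avg w = 0" by (rule avg_derivative[OF dw u])
  have fw: "avg (\<lambda>t. force a r u t \<bullet> w t) = 0" by (rule force_work_zero[OF u pw dw sep r rng])
  have cw: "avg (\<lambda>t. c \<bullet> w t) = 0" by (simp add: avg_linear[OF bounded_linear_inner_right pw] aw)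
  have pi: "per (\<lambda>t. \<i> * cis t)" by (intro per_mult per_const per_cis1)
  \<comment> \<open>The equation is tested with \<open>w = u'\<close>. Since
    \<open>w = \<i> * z\<close>, the left side drops out; force and constant do no net work, so only
    the phase multiplier is left.\<close>
  have "z t \<bullet> w t = 0" for t by (simp add: w_def i_times_inner_self)
  then have "\<mu> * ((\<i> * cis t) \<bullet> w t) = force a r u t \<bullet> w t - c \<bullet> w t" for t
    unfolding z_def by (simp add: inner_diff_left inner_complex_def algebra_simps)
  then have "avg (\<lambda>t. \<mu> * ((\<i> * cis t) \<bullet> w t)) = avg (\<lambda>t. force a r u t \<bullet> w t) - avg (\<lambda>t. c \<bullet> w t)"
    using avg_diff[OF per_inner[OF pforce pw] per_inner[OF per_const pw], of c] by simp
  then have mu: "\<mu> * avg (\<lambda>t. (\<i> * cis t) \<bullet> w t) = 0"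
    using fw cw avg_linear[OF bounded_linear_mult_right per_inner[OF pi pw], of \<mu>] by simp
  have ibp: "avg (\<lambda>t. (\<i> * cis t) \<bullet> w t - cis t \<bullet> u t) = 0"
  proof (rule avg_derivative)
    fix t
    have dcis: "(cis has_vector_derivative \<i> * cis t) (at t)"
      by (auto intro!: derivative_eq_intros simp: has_vector_derivative_def cis_conv_exp mult_ac scaleR_conv_of_real)
    have id: "((\<lambda>t. \<i> * cis t) has_vector_derivative \<i> * (\<i> * cis t)) (at t)"
      by (rule bounded_linear.has_vector_derivative[OF bounded_linear_mult_right dcis])
    have "((\<lambda>t. (\<i> * cis t) \<bullet> u t) has_vector_derivative ((\<i> * cis t) \<bullet> w t + (\<i> * (\<i> * cis t)) \<bullet> u t)) (at t)"
      by (rule bounded_bilinear.has_vector_derivative[OF bounded_bilinear_inner id dw])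
    moreover have "(\<i> * cis t) \<bullet> w t + (\<i> * (\<i> * cis t)) \<bullet> u t = (\<i> * cis t) \<bullet> w t - cis t \<bullet> u t"
      by (simp add: inner_complex_def)
    ultimately show "((\<lambda>t. (\<i> * cis t) \<bullet> u t) has_vector_derivative (\<i> * cis t) \<bullet> w t - cis t \<bullet> u t) (at t)" by simp
  qed (intro per_inner pi u)
  \<comment> \<open>After integration by parts the factor of \<open>\<mu>\<close> is this average,
    which closeness to \<open>cis\<close> keeps away from zero.\<close>
  have "avg (\<lambda>t. 1 / 2) \<le> avg (\<lambda>t. cis t \<bullet> u t)"
  proof (rule avg_mono[OF per_const per_inner[OF per_cis1 u]])
    fix t
    have "cis t \<bullet> u t = cis t \<bullet> cis t + cis t \<bullet> (u t - cis t)" by (simp add: inner_diff_right)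
    moreover have "cis t \<bullet> cis t = 1" by (simp add: dot_square_norm)
    moreover have "\<bar>cis t \<bullet> (u t - cis t)\<bar> \<le> 1 / 2"
      using Cauchy_Schwarz_ineq2[of "cis t" "u t - cis t"] near[of t] by simp
    ultimately show "1 / 2 \<le> cis t \<bullet> u t" by linarith
  qed
  then have "avg (\<lambda>t. (\<i> * cis t) \<bullet> w t) \<ge> 1 / 2"
    using ibp avg_diff[OF per_inner[OF pi pw] per_inner[OF per_cis1 u]] by simp
  then show ?thesis using mu by auto
qed

text \<open>The remaining multiplier already appears in explicit form, as the coupling times the
  mean of \<open>gsum\<close>; a centre at which it vanishes gives a true solution.\<close>

definition solution_family :: "real \<Rightarrow> real \<Rightarrow> real \<Rightarrow> real \<Rightarrow> (complex \<Rightarrow> real \<Rightarrow> complex) \<Rightarrow> bool" where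
  "solution_family \<rho> \<Lambda> m r u \<longleftrightarrow>
     (\<forall>a. per (u a) \<and> avg (u a) = 0) \<and>
     (\<forall>a t. cmod (u a t - cis t) \<le> \<rho> * r \<and> cmod (u a t - cis t) \<le> 1 / 2 \<and> (\<forall>j\<in>{1..<N}. m \<le> cmod (gap (u a) j t))) \<and>
     (\<forall>a b t. cmod (u a t - u b t) \<le> \<Lambda> * cmod (a - b)) \<and>
     (\<forall>a\<in>cball a0 R0. \<forall>t. (u a has_vector_derivative
        \<i> * (force a r (u a) t - of_real (coupling r) * avg (gsum a r (u a)))) (at t))"

lemma periodic_families:
  obtains \<rho> r1 \<Lambda> m where "0 \<le> \<rho>" "0 < r1" "r1 \<le> 1" "2 * r1 \<le> R0" "0 \<le> \<Lambda>" "0 < m"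
    "\<And>r. 0 < r \<Longrightarrow> r \<le> r1 \<Longrightarrow> \<exists>u. solution_family \<rho> \<Lambda> m r u"
proof -
  obtain \<rho> r2 \<Lambda> where rho: "0 \<le> \<rho>" and r2: "0 < r2" and L: "0 \<le> \<Lambda>" and r2g: "4 * (\<rho> * r2) \<le> gap_min"
    and r2h: "2 * (\<rho> * r2) \<le> 1" and sol: "\<And>r. 0 < r \<Longrightarrow> r \<le> r2 \<Longrightarrow> \<exists>v. reduced_family \<rho> \<Lambda> r v"
    using reduced_solutions by blast
  define r1 where "r1 = min r2 (min 1 (R0 / 2))"
  have r1: "0 < r1" "r1 \<le> 1" "2 * r1 \<le> R0" "r1 \<le> r2" using r2 R0 by (auto simp: r1_def)
  have fam: "\<exists>u. solution_family \<rho> \<Lambda> (gap_min / 2) r u" if r: "0 < r" "r \<le> r1" for r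
  proof -
    obtain v where "reduced_family \<rho> \<Lambda> r v" using sol[OF r(1)] r(2) r1(4) by force
    then have v: "\<And>a. per (v a)" "\<And>a t. cmod (v a t) \<le> \<rho> * r"
      "\<And>a. lm.right_inverse (residual a r (v a)) = v a" "\<And>a a' t. cmod (v a t - v a' t) \<le> \<Lambda> * cmod (a - a')"
      unfolding reduced_family_def by blast+
    have rr: "\<rho> * r \<le> \<rho> * r2" using r r1 rho by (intro mult_left_mono) auto
    have d4: "4 * (\<rho> * r) \<le> gap_min" and d2: "\<rho> * r \<le> 1 / 2" using rr r2g r2h by linarith+
    define u where "u a t = cis t + v a t" for a t
    have pu: "per (u a)" for a unfolding u_def by (intro per_add per_cis1 v)
    have pres: "per (residual a r (v a))" for a by (rule per_residual[OF v(1,2) d4])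
    have acis: "avg cis = 0" using avg_cis[of 1] by simp
    have avgv: "avg (v a) = 0" for a using lm.avg_right_inverse[OF pres, of a] v(3) by simp
    have avgu: "avg (u a) = 0" for a unfolding u_def by (simp add: avg_add[OF per_cis1 v(1)] acis avgv)
    have near: "cmod (u a t - cis t) \<le> 1 / 2" for a t using v(2)[of a t] d2 by (simp add: u_def)
    have sep: "gap_min / 2 \<le> cmod (gap (u a) j t)" if "j \<in> {1..<N}" for a j t
      using separated[of "v a" "\<rho> * r" j t, OF v(2) that] d4 by (simp add: gap_def u_def)
    have sep0: "gap (u a) j t \<noteq> 0" if "j \<in> {1..<N}" for a j t using sep[OF that, of a t] gap_min_pos by auto
    have D: "(u a has_vector_derivative \<i> * (force a r (u a) t - of_real (coupling r) * avg (gsum a r (u a)))) (at t)"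
      if a: "a \<in> cball a0 R0" for a t
    proof -
      define c where "c = fc (residual a r (v a)) 0"
      define \<mu> where "\<mu> = Im (fc (residual a r (v a)) 1)"
      have d1: "(u a has_vector_derivative \<i> * (force a r (u a) t - c - \<i> * of_real \<mu> * cis t)) (at t)" for t
      proof -
        have dcis: "(cis has_vector_derivative \<i> * cis t) (at t)"
          by (auto intro!: derivative_eq_intros simp: has_vector_derivative_def cis_conv_exp mult_ac scaleR_conv_of_real)
        have "(v a has_vector_derivative \<i> * (residual a r (v a) t - c - \<i> * of_real \<mu> * cis t - lin_op (v a) t)) (at t)"
          using lm.right_inverse_solves[OF pres[of a], of t] unfolding v(3) c_def \<mu>_def .
        from has_vector_derivative_add[OF dcis this]
        have "(u a has_vector_derivative (\<i> * cis t + \<i> * (residual a r (v a) t - c - \<i> * of_real \<mu> * cis t - lin_op (v a) t))) (at t)"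
          unfolding u_def .
        moreover have "residual a r (v a) t = force a r (u a) t - cis t + lin_op (v a) t"
          unfolding residual_def u_def by simp
        ultimately show ?thesis by (simp add: algebra_simps)
      qed
      have rng: "a + of_real r * u a t \<in> cball a0 (2 * R0)" for t
      proof -
        have "cmod (u a t) \<le> 2" using near[of a t] norm_triangle_sub[of "u a t" "cis t"] by simp
        then have "cmod (of_real r * u a t) \<le> 2 * r" using r by (simp add: norm_mult)
        then show ?thesis using a r r1 norm_triangle_ineq[of "a - a0" "of_real r * u a t"]
          by (simp add: dist_norm norm_minus_commute[of a0] add_diff_eq algebra_simps)
      qed
      have mu: "\<mu> = 0"
        by (rule rotation_multiplier_vanishes[OF pu d1 sep0 r(1) rng near])
      have pforce: "per (force a r (u a))" and pvf: "per (vortex_field (u a))"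
      proof -
        show "per (vortex_field (u a))" by (rule per_vortex_field[OF pu]) (use sep0 in \<open>auto simp: gap_def\<close>)
        then show "per (force a r (u a))" unfolding force_def by (intro per_add per_mult[OF per_const] per_gsum pu)
      qed
      have pfc: "per (\<lambda>t. force a r (u a) t - c)" by (intro per_diff pforce per_const)
      have "avg (\<lambda>t. \<i> * (force a r (u a) t - c)) = 0"
        by (rule avg_derivative[OF _ pu]) (use d1 mu in simp)
      then have "avg (\<lambda>t. force a r (u a) t - c) = 0" by (simp add: avg_cmult[OF pfc])
      then have "c = avg (force a r (u a))" by (simp add: avg_diff[OF pforce per_const])
      also have "\<dots> = avg (vortex_field (u a)) + of_real (coupling r) * avg (gsum a r (u a))"
        unfolding force_def by (simp only: avg_add[OF pvf per_mult[OF per_const per_gsum[OF pu]]] avg_cmult[OF per_gsum[OF pu]])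
      finally have "c = of_real (coupling r) * avg (gsum a r (u a))"
        using avg_vortex_field[OF pu sep0] by simp
      then show ?thesis using d1[of t] mu by simp
    qed
    have "solution_family \<rho> \<Lambda> (gap_min / 2) r u"
      unfolding solution_family_def
    proof (intro conjI allI ballI)
      show "cmod (u a t - cis t) \<le> \<rho> * r" for a t using v(2) by (simp add: u_def)
      show "cmod (u a t - u b t) \<le> \<Lambda> * cmod (a - b)" for a b t using v(4) by (simp add: u_def)
    qed (use pu avgu near sep D in auto)
    then show ?thesis by (rule exI[of _ u])
  qed
  have g0: "0 < gap_min / 2" using gap_min_pos by simp
  show thesis by (rule that[OF rho r1(1) r1(2) r1(3) L g0 fam])
qed

end

section \<open>Choice of the centre\<close>

context ngon_potential begin

text \<open>As \<open>u' = \<i> * force\<close>, the bound on the force minus \<open>cis\<close> is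
  the bound on the derivatives needed for convergence in the Sobolev norm.\<close>

definition rescaled_solution :: "real \<Rightarrow> real \<Rightarrow> complex \<Rightarrow> (real \<Rightarrow> complex) \<Rightarrow> bool" where
  "rescaled_solution C r a u \<longleftrightarrow> a \<in> cball a0 R0 \<and> per u \<and>
     (\<forall>t. cmod (u t - cis t) \<le> C * r \<and> cmod (u t - cis t) \<le> 1 / 2 \<and> cmod (force a r u t - cis t) \<le> C * r \<and>
       a + of_real r * u t \<in> cball a0 (2 * R0) \<and> (u has_vector_derivative \<i> * force a r u t) (at t) \<and>
       (\<forall>j\<in>{1..<N}. gap u j t \<noteq> 0))"

lemma diagonal_has_derivative:
  assumes "z \<in> cball a0 (2 * R0)"
  shows "((\<lambda>z. g (z, z)) has_derivative (\<lambda>d. (2 * G z z) \<bullet> d)) (at z within S)"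
proof -
  have "((\<lambda>z. (z, z)) has_derivative (\<lambda>d. (d, d))) (at z within S)" by (auto intro!: derivative_eq_intros)
  from has_derivative_compose[OF this g_der[OF assms assms]] show ?thesis
    by (simp add: inner_complex_def algebra_simps)
qed

lemma gsum_near_diagonal:
  assumes "per u" "\<And>t. cmod (u t) \<le> 2" "r \<ge> 0"
  shows "cmod (avg (gsum a r u) - of_nat N * G a a) \<le> real N * (LG * (4 * r))"
proof -
  have "cmod (gsum a r u t - of_nat N * G a a) \<le> real N * (LG * (4 * r))" for t
  proof -
    have 1: "cmod (of_real r * u t) \<le> 2 * r" for t using assms by (simp add: norm_mult mult.commute mult_left_mono)
    have "cmod (\<Sum>j<N. G (a + of_real r * u t) (a + of_real r * u (t + shift j)) - G a a) \<le> (\<Sum>j<N. LG * (4 * r))"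
    proof (rule sum_norm_le)
      fix j
      show "cmod (G (a + of_real r * u t) (a + of_real r * u (t + shift j)) - G a a) \<le> LG * (4 * r)"
        using 1[of t] 1[of "t + shift j"] LG_nonneg by (intro order_trans[OF G_lip] mult_left_mono) auto
    qed
    then show ?thesis by (simp add: gsum_def sum_subtractf)
  qed
  from norm_avg_le[OF per_diff[OF per_gsum[OF assms(1)] per_const] this] show ?thesis
    by (simp add: avg_diff[OF per_gsum[OF assms(1)] per_const])
qed

text \<open>The constant \<open>C\<close> precedes \<open>\<epsilon>\<close>, so solutions chosen
  for different \<open>\<epsilon>\<close> satisfy the same estimate. Closeness of the centre comes
  from applying the perturbation argument on a ball of radius at most
  \<open>\<epsilon>\<close>.\<close>

lemma rescaled_solutions_near_critical_point:
  fixes \<Omega> :: "complex set"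
  defines "X \<equiv> {z \<in> \<Omega>. g (z, z) \<le> g (a0, a0)}"
  assumes sub: "cball a0 (2 * R0) \<subseteq> \<Omega>" and conth: "continuous_on \<Omega> (\<lambda>z. g (z, z))"
    and crit: "G a0 a0 = 0" and e: "e > 0" and isol: "\<And>z. z \<in> ball a0 e \<Longrightarrow> z \<noteq> a0 \<Longrightarrow> G z z \<noteq> 0"
    and nontriv: "\<not> trivial_group (relative_homology_group p (top_of_set X) (X - {a0}))"
  shows "\<exists>C. \<forall>\<epsilon>>0. \<exists>r\<epsilon>>0. \<forall>r. 0 < r \<and> r \<le> r\<epsilon> \<longrightarrow> (\<exists>a u. dist a a0 \<le> \<epsilon> \<and> rescaled_solution C r a u)"
proof -
  obtain \<rho> r1 \<Lambda> m where rho: "0 \<le> \<rho>" and r1: "0 < r1" "r1 \<le> 1" "2 * r1 \<le> R0" and L: "0 \<le> \<Lambda>" and m: "0 < m"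
    and fam: "\<And>r. 0 < r \<Longrightarrow> r \<le> r1 \<Longrightarrow> \<exists>u. solution_family \<rho> \<Lambda> m r u"
    using periodic_families by blast
  define p4 where "p4 = 4 * pi / (real N - 1)"
  have p40: "p4 > 0" using Npos by (simp add: p4_def)
  define m' where "m' = min m gap_min"
  have m': "m' > 0" using m gap_min_pos by (simp add: m'_def)
  define C where "C = \<rho> + (4 / m'\<^sup>2 * \<rho> + p4 * (real N * (LG * (2 * \<rho>))) + p4 * (real N * MG))"
  have Crho: "\<rho> \<le> C" using p40 LG_nonneg MG_nonneg rho by (simp add: C_def)
  have "\<exists>r\<epsilon>>0. \<forall>r. 0 < r \<and> r \<le> r\<epsilon> \<longrightarrow> (\<exists>a u. dist a a0 \<le> \<epsilon> \<and> rescaled_solution C r a u)" if ep: "\<epsilon> > 0" for \<epsilon>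
  proof -
    define R where "R = min \<epsilon> (min R0 (e / 2))"
    have R: "R > 0" "R \<le> \<epsilon>" "R \<le> R0" "R < e" using ep R0 e by (auto simp: R_def)
    have cbR: "z \<in> cball a0 (2 * R0)" if "z \<in> cball a0 R" for z using that R R0 by auto
    interpret h: gradient_ball a0 R "4 * LG" "2 * MG" "\<lambda>z. g (z, z)" "\<lambda>z. 2 * G z z"
    proof
      fix x y :: complex
      have "norm (2 * G x x - 2 * G y y) = 2 * cmod (G x x - G y y)" by (simp only: right_diff_distrib[symmetric] norm_mult norm_numeral)
      then show "norm (2 * G x x - 2 * G y y) \<le> 4 * LG * norm (x - y)" using G_lip[of x x y y] by simp
    next
      fix x assume "x \<in> cball a0 R"
      then show "((\<lambda>z. g (z, z)) has_derivative (\<bullet>) (2 * G x x)) (at x within cball a0 R)"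
        using diagonal_has_derivative[OF cbR] by blast
      show "norm (2 * G x x) \<le> 2 * MG" using G_bd[of x x] by (simp add: norm_mult)
    qed (use R LG_nonneg in auto)
    have subR: "cball a0 R \<subseteq> \<Omega>" using sub cbR by blast
    have V0: "2 * G a0 a0 = 0" using crit by simp
    have nz: "2 * G x x \<noteq> 0" if "x \<in> cball a0 R" "x \<noteq> a0" for x using isol[of x] that R by auto
    have "\<exists>\<delta>>0. (\<forall>(f :: complex \<Rightarrow> real) U K.
       (\<forall>x\<in>cball a0 R. (f has_derivative (\<lambda>d. U x \<bullet> d)) (at x within cball a0 R)) \<and>
       (\<forall>x\<in>cball a0 R. \<forall>y\<in>cball a0 R. norm (U x - U y) \<le> K * norm (x - y)) \<and>
       (\<forall>x\<in>cball a0 R. norm (U x - 2 * G x x) \<le> \<delta>) \<longrightarrow> (\<exists>x\<in>cball a0 R. U x = 0))"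
      by (rule h.close_gradient_has_zero[OF subR conth V0 _ nontriv[unfolded X_def]]) (rule nz)
    then obtain \<delta> where d: "\<delta> > 0 \<and> (\<forall>(f :: complex \<Rightarrow> real) U K.
       (\<forall>x\<in>cball a0 R. (f has_derivative (\<lambda>d. U x \<bullet> d)) (at x within cball a0 R)) \<and>
       (\<forall>x\<in>cball a0 R. \<forall>y\<in>cball a0 R. norm (U x - U y) \<le> K * norm (x - y)) \<and>
       (\<forall>x\<in>cball a0 R. norm (U x - 2 * G x x) \<le> \<delta>) \<longrightarrow> (\<exists>x\<in>cball a0 R. U x = 0))"
      by - (erule exE, rule that)
    have d0: "\<delta> > 0" using d by (rule conjunct1)
    note dz = conjunct2[OF d, rule_format]
    \<comment> \<open>The normalised reduced gradient differs from that of \<open>h\<close> by at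
      most \<open>8 * LG * r\<close>.\<close>
    define r\<epsilon> where "r\<epsilon> = min r1 (\<delta> / (8 * LG + 1))"
    have re: "r\<epsilon> > 0" "r\<epsilon> \<le> r1" "r\<epsilon> \<le> \<delta> / (8 * LG + 1)" using r1 d0 LG_nonneg by (auto simp: r\<epsilon>_def)
    have "\<exists>a u. dist a a0 \<le> \<epsilon> \<and> rescaled_solution C r a u" if r: "0 < r" "r \<le> r\<epsilon>" for r
    proof -
      have rr1: "r \<le> r1" "r \<le> 1" "2 * r \<le> R0" using r re r1 by linarith+
      have rd: "8 * LG * r \<le> \<delta>"
      proof -
        have "r \<le> \<delta> / (8 * LG + 1)" using r re by linarith
        then have "r * (8 * LG + 1) \<le> \<delta>" using LG_nonneg by (simp add: pos_le_divide_eq)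
        then show ?thesis using r by (simp add: algebra_simps)
      qed
      obtain u where "solution_family \<rho> \<Lambda> m r u" using fam[OF r(1) rr1(1)] by blast
      then have u: "\<And>a. per (u a)" "\<And>a. avg (u a) = 0" "\<And>a t. cmod (u a t - cis t) \<le> \<rho> * r"
        "\<And>a t. cmod (u a t - cis t) \<le> 1 / 2" "\<And>a t j. j \<in> {1..<N} \<Longrightarrow> m \<le> cmod (gap (u a) j t)"
        "\<And>a b t. cmod (u a t - u b t) \<le> \<Lambda> * cmod (a - b)"
        "\<And>a t. a \<in> cball a0 R0 \<Longrightarrow> (u a has_vector_derivative
          \<i> * (force a r (u a) t - of_real (coupling r) * avg (gsum a r (u a)))) (at t)"
        unfolding solution_family_def by blast+
      have u2: "cmod (u a t) \<le> 2" for a t using u(4)[of a t] norm_triangle_sub[of "u a t" "cis t"] by simp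
      obtain \<Psi> where Psi: "\<And>a. a \<in> cball a0 R0 \<Longrightarrow>
          (\<Psi> has_derivative (\<lambda>e. ((4 * pi / (real N - 1)) *\<^sub>R avg (gsum a r (u a))) \<bullet> e)) (at a within cball a0 R0)"
        using reduced_energy_gradient[OF r(1) rr1(3) m L u(1) u(7) u(2) u2 u(5) u(6)] by blast
      define U where "U a = (2 / real N) *\<^sub>R avg (gsum a r (u a))" for a
      \<comment> \<open>Rescales the reduced energy so that its gradient \<open>U\<close>
        approximates \<open>2 * G a a\<close>, the gradient of \<open>h\<close>, instead of a
        multiple of it.\<close>
      define k where "k = (real N - 1) / (2 * pi * real N)"
      have kk: "k * (4 * pi / (real N - 1)) = 2 / real N" using Npos by (simp add: k_def field_simps)
      have U1: "((\<lambda>a. k * \<Psi> a) has_derivative (\<lambda>d. U a \<bullet> d)) (at a within cball a0 R)" if a: "a \<in> cball a0 R" for a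
      proof -
        have aR: "a \<in> cball a0 R0" using a R by auto
        have "(\<Psi> has_derivative (\<lambda>e. ((4 * pi / (real N - 1)) *\<^sub>R avg (gsum a r (u a))) \<bullet> e)) (at a within cball a0 R)"
          by (rule has_derivative_subset[OF Psi[OF aR]]) (use R in auto)
        from has_derivative_mult_right[OF this, of k]
        have "((\<lambda>a. k * \<Psi> a) has_derivative (\<lambda>e. k * (((4 * pi / (real N - 1)) *\<^sub>R avg (gsum a r (u a))) \<bullet> e))) (at a within cball a0 R)" .
        moreover have "k * (((4 * pi / (real N - 1)) *\<^sub>R avg (gsum a r (u a))) \<bullet> e) = U a \<bullet> e" for e
          unfolding U_def inner_scaleR_left mult.assoc[symmetric] kk ..
        ultimately show ?thesis by simp
      qed
      have U2: "norm (U a - U b) \<le> (2 * (LG * (2 + 2 * r * \<Lambda>))) * norm (a - b)" for a b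
      proof -
        have "cmod (avg (\<lambda>t. gsum a r (u a) t - gsum b r (u b) t)) \<le> real N * (LG * (2 * cmod (a - b) + 2 * r * (\<Lambda> * cmod (a - b))))"
          by (rule norm_avg_le[OF per_diff[OF per_gsum per_gsum] gsum_lipschitz]) (use u r in auto)
        then have *: "cmod (avg (gsum a r (u a)) - avg (gsum b r (u b))) \<le> real N * (LG * (2 + 2 * r * \<Lambda>) * cmod (a - b))"
          by (simp add: avg_diff per_gsum u algebra_simps)
        have "norm (U a - U b) = 2 / real N * cmod (avg (gsum a r (u a)) - avg (gsum b r (u b)))"
          unfolding U_def scaleR_diff_right[symmetric] norm_scaleR by simp
        also have "\<dots> \<le> 2 / real N * (real N * (LG * (2 + 2 * r * \<Lambda>) * cmod (a - b)))"
          using * by (rule mult_left_mono) simp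
        also have "\<dots> = (2 * (LG * (2 + 2 * r * \<Lambda>))) * norm (a - b)" using Npos by simp
        finally show ?thesis .
      qed
      have U3: "norm (U a - 2 * G a a) \<le> \<delta>" for a
      proof -
        have "U a - 2 * G a a = (2 / real N) *\<^sub>R (avg (gsum a r (u a)) - of_nat N * G a a)"
          using Npos by (simp add: U_def scaleR_conv_of_real right_diff_distrib)
        then have "norm (U a - 2 * G a a) = 2 / real N * cmod (avg (gsum a r (u a)) - of_nat N * G a a)" by simp
        also have "\<dots> \<le> 2 / real N * (real N * (LG * (4 * r)))"
          using gsum_near_diagonal[OF u(1) u2, of r a a] r by (intro mult_left_mono) auto
        also have "\<dots> = 8 * LG * r" using Npos by simp
        finally show ?thesis using rd by linarith
      qed
      obtain a where a: "a \<in> cball a0 R" and Ua: "U a = 0"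
      proof -
        have "\<exists>a\<in>cball a0 R. U a = 0" by (rule dz[of "\<lambda>a. k * \<Psi> a" U "2 * (LG * (2 + 2 * r * \<Lambda>))"], intro conjI ballI U1 U2 U3)
        then show thesis using that by blast
      qed
      have aR0: "a \<in> cball a0 R0" using a R by auto
      \<comment> \<open>At this centre the last multiplier vanishes.\<close>
      have gz: "avg (gsum a r (u a)) = 0" using Ua Npos by (simp add: U_def)
      have cp: "coupling r = p4 * r" by (simp add: coupling_def p4_def)
      have fb: "cmod (force a r (u a) t - cis t) \<le> C * r" for t
      proof -
        have 1: "cmod (force a r (u a) t - force a r cis t) \<le> 4 / m'\<^sup>2 * (\<rho> * r) + coupling r * (real N * (LG * (2 * cmod (a - a) + 2 * r * (\<rho> * r))))"
        proof (rule force_lipschitz[OF r(1) m' u(3)])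
          fix t j assume j: "j \<in> {1..<N}"
          show "m' \<le> cmod (gap (u a) j t)" using u(5)[OF j, of a t] by (simp add: m'_def)
          show "m' \<le> cmod (gap cis j t)"
            using separated[of "\<lambda>t. 0" 0 j t] j by (simp add: m'_def gap_def)
        qed
        have "force a r cis t - cis t = of_real (coupling r) * gsum a r cis t"
          using vortex_field_cis[of t] by (simp add: force_def)
        then have 2: "cmod (force a r cis t - cis t) \<le> coupling r * (real N * MG)"
          using mult_left_mono[OF gsum_bound[of a r cis t], of "coupling r"] p40 r by (simp add: norm_mult cp)
        have "2 * r * (\<rho> * r) \<le> 2 * 1 * (\<rho> * 1)" using rr1 r rho by (intro mult_mono) auto
        then have le: "coupling r * (real N * (LG * (2 * r * (\<rho> * r)))) \<le> coupling r * (real N * (LG * (2 * \<rho>)))"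
          using p40 r LG_nonneg by (intro mult_left_mono) (auto simp: cp)
        have "cmod (force a r (u a) t - cis t) \<le> 4 / m'\<^sup>2 * (\<rho> * r) + coupling r * (real N * (LG * (2 * \<rho>))) + coupling r * (real N * MG)"
        proof -
          have z: "2 * cmod (a - a) + 2 * r * (\<rho> * r) = 2 * r * (\<rho> * r)" by simp
          have "cmod (force a r (u a) t - cis t) \<le> cmod (force a r (u a) t - force a r cis t) + cmod (force a r cis t - cis t)"
            using norm_triangle_ineq[of "force a r (u a) t - force a r cis t" "force a r cis t - cis t"] by simp
          then show ?thesis using 1[unfolded z] 2 le by linarith
        qed
        also have "\<dots> = (C - \<rho>) * r" by (simp add: C_def cp algebra_simps)
        also have "\<dots> \<le> C * r" using rho r by (intro mult_right_mono) auto
        finally show ?thesis .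
      qed
      have rng: "a + of_real r * u a t \<in> cball a0 (2 * R0)" for t
      proof -
        have "cmod (of_real r * u a t) \<le> 2 * r" using r u2[of a t] by (simp add: norm_mult)
        then show ?thesis using aR0 rr1 norm_triangle_ineq[of "a - a0" "of_real r * u a t"]
          by (simp add: dist_norm norm_minus_commute[of a0] add_diff_eq algebra_simps)
      qed
      have near: "cmod (u a t - cis t) \<le> C * r" for t
        using u(3)[of a t] mult_right_mono[OF Crho, of r] r by linarith
      have gp: "gap (u a) j t \<noteq> 0" if "j \<in> {1..<N}" for j t using u(5)[OF that, of a t] m by auto
      have "rescaled_solution C r a (u a)"
        unfolding rescaled_solution_def
        using aR0 u(1) near u(4) fb rng u(7)[OF aR0] gz gp by simp
      moreover have "dist a a0 \<le> \<epsilon>" using a R by (simp add: dist_commute)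
      ultimately show ?thesis by blast
    qed
    then show ?thesis using re(1) by blast
  qed
  then show ?thesis by blast
qed

end

section \<open>The point vortex system\<close>

text \<open>Continuity of the second derivative on a compact product of balls makes the gradient
  Lipschitz there. Composing with the nearest point projection, which does not increase distances,
  extends it to the plane with the same bounds.\<close>

lemma C2_symmetric_gradient:
  assumes op: "open \<Omega>" and a0: "a0 \<in> \<Omega>" and C2: "C2_upto (closure \<Omega> \<times> \<Omega>) g"
    and sym: "\<And>w z. w \<in> \<Omega> \<Longrightarrow> z \<in> \<Omega> \<Longrightarrow> g (w, z) = g (z, w)"
  obtains R0 G LG MG where "R0 > 0" "cball a0 (2 * R0) \<subseteq> \<Omega>"
    "\<forall>w z w' z'. cmod (G w z - G w' z') \<le> LG * (cmod (w - w') + cmod (z - z'))" "\<forall>w z. cmod (G w z) \<le> MG"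
    "\<forall>w\<in>cball a0 (2 * R0). \<forall>z\<in>cball a0 (2 * R0).
      (g has_derivative (\<lambda>d. G w z \<bullet> fst d + G z w \<bullet> snd d)) (at (w, z))"
proof -
  obtain g1 :: "complex \<times> complex \<Rightarrow> ((complex \<times> complex) \<Rightarrow>\<^sub>L real)"
    and g2 :: "complex \<times> complex \<Rightarrow> ((complex \<times> complex) \<Rightarrow>\<^sub>L ((complex \<times> complex) \<Rightarrow>\<^sub>L real))"
    where g1: "\<forall>x\<in>interior (closure \<Omega> \<times> \<Omega>). (g has_derivative blinfun_apply (g1 x)) (at x)"
      and g2: "\<forall>x\<in>interior (closure \<Omega> \<times> \<Omega>). (g1 has_derivative blinfun_apply (g2 x)) (at x)"
      and c2: "continuous_on (closure \<Omega> \<times> \<Omega>) g2"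
    using C2 unfolding C2_upto_def by blast
  have int: "\<Omega> \<times> \<Omega> \<subseteq> interior (closure \<Omega> \<times> \<Omega>)"
    by (rule interior_maximal) (use closure_subset open_Times[OF op op] in auto)
  obtain e where e: "e > 0" "cball a0 e \<subseteq> \<Omega>" using op a0 open_contains_cball by blast
  define R0 where "R0 = e / 2"
  have R0: "R0 > 0" and sub: "cball a0 (2 * R0) \<subseteq> \<Omega>" using e by (auto simp: R0_def)
  let ?B = "cball a0 (2 * R0)"
  let ?K = "?B \<times> ?B"
  have KO: "?K \<subseteq> \<Omega> \<times> \<Omega>" using sub by auto
  define G0 where "G0 w z = Complex (g1 (w, z) (1, 0)) (g1 (w, z) (\<i>, 0))" for w z
  have G0i: "G0 w z \<bullet> d = g1 (w, z) (d, 0)" for w z d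
  proof -
    have "(d, 0 :: complex) = Re d *\<^sub>R (1, 0) + Im d *\<^sub>R (\<i>, 0)" by (simp add: complex_eq_iff)
    then have "g1 (w, z) (d, 0) = Re d * g1 (w, z) (1, 0) + Im d * g1 (w, z) (\<i>, 0)"
      by (simp only: blinfun.add_right blinfun.scaleR_right real_scaleR_def)
    then show ?thesis by (simp add: G0_def inner_complex_def mult.commute)
  qed
  have cK: "compact ?K" by (intro compact_Times compact_cball)
  have "continuous_on ?K g2" using c2 by (rule continuous_on_subset) (use KO closure_subset in blast)
  then have "bounded (g2 ` ?K)" using compact_continuous_image[OF _ cK] compact_imp_bounded by blast
  then obtain B where B: "\<forall>x\<in>?K. norm (g2 x) \<le> B" unfolding bounded_iff by blast
  have B0: "B \<ge> 0"
  proof -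
    have "(a0, a0) \<in> ?K" using R0 by auto
    then show ?thesis using B norm_ge_zero order_trans by blast
  qed
  have lip: "norm (g1 x - g1 y) \<le> B * norm (x - y)" if "x \<in> ?K" "y \<in> ?K" for x y
  proof (rule differentiable_bound[where f' = "\<lambda>x. blinfun_apply (g2 x)"])
    show "convex ?K" by (intro convex_Times convex_cball)
    fix z assume z: "z \<in> ?K"
    then show "(g1 has_derivative blinfun_apply (g2 z)) (at z within ?K)"
      using g2 int KO has_derivative_at_withinI by blast
    show "onorm (blinfun_apply (g2 z)) \<le> B" using bspec[OF B z] unfolding norm_blinfun.rep_eq .
  qed (use that in auto)
  have G0_lip: "cmod (G0 w z - G0 w' z') \<le> 2 * B * (cmod (w - w') + cmod (z - z'))"
    if "w \<in> ?B" "z \<in> ?B" "w' \<in> ?B" "z' \<in> ?B" for w z w' z'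
  proof -
    have n: "norm ((w, z) - (w', z')) \<le> cmod (w - w') + cmod (z - z')" using norm_Pair_le by simp
    have *: "\<bar>g1 (w, z) (d, 0) - g1 (w', z') (d, 0)\<bar> \<le> B * (cmod (w - w') + cmod (z - z'))" if d: "cmod d = 1" for d
    proof -
      have "\<bar>g1 (w, z) (d, 0) - g1 (w', z') (d, 0)\<bar> \<le> norm (g1 (w, z) - g1 (w', z')) * norm (d, 0 :: complex)"
        using norm_blinfun[of "g1 (w, z) - g1 (w', z')" "(d, 0)"] by (simp add: blinfun.diff_left)
      also have "\<dots> = norm (g1 (w, z) - g1 (w', z'))" using d by (simp add: norm_Pair)
      also have "\<dots> \<le> B * norm ((w, z) - (w', z'))" by (rule lip) (use \<open>w \<in> ?B\<close> \<open>z \<in> ?B\<close> \<open>w' \<in> ?B\<close> \<open>z' \<in> ?B\<close> in auto)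
      also have "\<dots> \<le> B * (cmod (w - w') + cmod (z - z'))" using n B0 by (rule mult_left_mono)
      finally show ?thesis .
    qed
    have "cmod (G0 w z - G0 w' z') \<le> \<bar>Re (G0 w z - G0 w' z')\<bar> + \<bar>Im (G0 w z - G0 w' z')\<bar>" by (rule cmod_le)
    also have "\<dots> \<le> 2 * B * (cmod (w - w') + cmod (z - z'))" using *[of 1] *[of \<i>] by (simp add: G0_def)
    finally show ?thesis .
  qed
  define P where "P = closest_point ?B"
  have ne: "?B \<noteq> {}" using R0 by simp
  have PB: "P w \<in> ?B" for w unfolding P_def by (rule closest_point_in_set[OF closed_cball ne])
  have Pid: "P w = w" if "w \<in> ?B" for w unfolding P_def by (rule closest_point_self[OF that])
  have Plip: "cmod (P w - P w') \<le> cmod (w - w')" for w w'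
    using closest_point_lipschitz[OF convex_cball closed_cball ne, of w w'] by (simp add: P_def dist_norm)
  define G where "G w z = G0 (P w) (P z)" for w z
  show thesis
  proof (rule that[of R0 G "2 * B" "cmod (G0 a0 a0) + 2 * B * (2 * R0 + 2 * R0)"]; (intro allI ballI)?)
    show "R0 > 0" "?B \<subseteq> \<Omega>" by (fact R0 sub)+
    show "cmod (G w z - G w' z') \<le> 2 * B * (cmod (w - w') + cmod (z - z'))" for w z w' z'
    proof -
      have "cmod (G w z - G w' z') \<le> 2 * B * (cmod (P w - P w') + cmod (P z - P z'))"
        unfolding G_def by (rule G0_lip[OF PB PB PB PB])
      also have "\<dots> \<le> 2 * B * (cmod (w - w') + cmod (z - z'))"
        using Plip B0 by (intro mult_left_mono add_mono) auto
      finally show ?thesis .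
    qed
    show "cmod (G w z) \<le> cmod (G0 a0 a0) + 2 * B * (2 * R0 + 2 * R0)" for w z
    proof -
      have a: "a0 \<in> ?B" using R0 by simp
      have "cmod (G w z - G0 a0 a0) \<le> 2 * B * (cmod (P w - a0) + cmod (P z - a0))"
        unfolding G_def by (rule G0_lip[OF PB PB a a])
      also have "\<dots> \<le> 2 * B * (2 * R0 + 2 * R0)"
        using PB[of w] PB[of z] B0 by (intro mult_left_mono add_mono) (auto simp: dist_norm norm_minus_commute)
      finally show ?thesis using norm_triangle_sub[of "G w z" "G0 a0 a0"] by linarith
    qed
    fix w z assume w: "w \<in> ?B" and z: "z \<in> ?B"
    have wz: "(w, z) \<in> \<Omega> \<times> \<Omega>" "(z, w) \<in> \<Omega> \<times> \<Omega>" using w z sub by auto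
    have d1: "(g has_derivative blinfun_apply (g1 (w, z))) (at (w, z))"
      and d2: "(g has_derivative blinfun_apply (g1 (z, w))) (at (z, w))"
      using g1 int wz by blast+
    \<comment> \<open>Symmetry of \<open>g\<close> turns the derivative at the swapped point into
      the derivative at \<open>(w, z)\<close>; this identifies the second partial gradient.\<close>
    have "(prod.swap has_derivative prod.swap) (at (w, z))"
      unfolding prod.swap_def by (auto intro!: derivative_eq_intros)
    from has_derivative_compose[OF this, of g "blinfun_apply (g1 (z, w))"] d2
    have "((\<lambda>p. g (prod.swap p)) has_derivative (\<lambda>d. g1 (z, w) (prod.swap d))) (at (w, z))" by simp
    then have d3: "(g has_derivative (\<lambda>d. g1 (z, w) (prod.swap d))) (at (w, z))"
      by (rule has_derivative_transform_within_open[OF _ open_Times[OF op op] wz(1)]) (use sym in auto)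
    have eq: "blinfun_apply (g1 (w, z)) = (\<lambda>d. g1 (z, w) (prod.swap d))" by (rule has_derivative_unique[OF d1 d3])
    have "g1 (w, z) d = G w z \<bullet> fst d + G z w \<bullet> snd d" for d
    proof -
      have "g1 (w, z) d = g1 (w, z) ((fst d, 0) + (0, snd d))" by simp
      also have "\<dots> = g1 (w, z) (fst d, 0) + g1 (w, z) (0, snd d)" by (rule blinfun.add_right)
      also have "g1 (w, z) (0, snd d) = g1 (z, w) (snd d, 0)" unfolding eq by simp
      finally show ?thesis using w z by (simp only: G_def Pid G0i)
    qed
    then have "blinfun_apply (g1 (w, z)) = (\<lambda>d. G w z \<bullet> fst d + G z w \<bullet> snd d)" ..
    with d1 show "(g has_derivative (\<lambda>d. G w z \<bullet> fst d + G z w \<bullet> snd d)) (at (w, z))" by simp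
  qed
qed

text \<open>Each pair containing \<open>k\<close> occurs twice among the ordered pairs.\<close>

lemma sum_pairs_through_index:
  fixes A :: "nat \<Rightarrow> 'a::real_vector"
  assumes "finite S" "k \<in> S"
  shows "(\<Sum>j\<in>S. \<Sum>l\<in>S - {j}. if j = k then A l else if l = k then A j else 0) = 2 *\<^sub>R (\<Sum>l\<in>S - {k}. A l)"
proof -
  have "(\<Sum>j\<in>S. \<Sum>l\<in>S - {j}. if j = k then A l else if l = k then A j else 0)
      = (\<Sum>l\<in>S - {k}. A l) + (\<Sum>j\<in>S - {k}. \<Sum>l\<in>S - {j}. if j = k then A l else if l = k then A j else 0)"
    by (subst sum.remove[OF assms]) simp
  also have "(\<Sum>j\<in>S - {k}. \<Sum>l\<in>S - {j}. if j = k then A l else if l = k then A j else 0) = (\<Sum>j\<in>S - {k}. A j)"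
  proof (rule sum.cong[OF refl])
    fix j assume j: "j \<in> S - {k}"
    have "(\<Sum>l\<in>S - {j}. if j = k then A l else if l = k then A j else 0) = (\<Sum>l\<in>S - {j}. if l = k then A j else 0)"
      using j by (intro sum.cong) auto
    also have "\<dots> = A j" using assms j by (subst sum.delta) auto
    finally show "(\<Sum>l\<in>S - {j}. if j = k then A l else if l = k then A j else 0) = A j" .
  qed
  finally show ?thesis by (simp add: scaleR_2)
qed

context ngon_potential begin

text \<open>Both sums run over all \<open>l\<close>. In the first the term \<open>l = k\<close> is
  \<open>1 / 0 = 0\<close>; in the second it is the self-interaction, which has the weight 2 of a
  pair since the diagonal has gradient \<open>2 * G z z\<close>.\<close>

lemma Ham_partial_gradient:
  assumes z: "\<And>j. j \<in> {1..N} \<Longrightarrow> z j \<in> cball a0 (2 * R0)"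
    and dist: "\<And>j l. j \<in> {1..N} \<Longrightarrow> l \<in> {1..N} \<Longrightarrow> j \<noteq> l \<Longrightarrow> z j \<noteq> z l" and k: "k \<in> {1..N}"
  shows "partial_gradient (Ham g N) k z
    (- (of_real (1 / pi) * (\<Sum>l\<in>{1..N}. 1 / cnj (z k - z l)) + 2 * (\<Sum>l\<in>{1..N}. G (z k) (z l))))"
proof -
  define S where "S = {1..N}"
  have S: "finite S" "k \<in> S" using k by (auto simp: S_def)
  have zS: "z j \<in> cball a0 (2 * R0)" if "j \<in> S" for j using z that by (simp add: S_def)
  define A where "A l = - (1 / cnj (z k - z l))" for l
  define Gk where "Gk l = G (z k) (z l)" for l
  have fst_der: "((\<lambda>w. ln (1 / cmod (w - z l))) has_derivative (\<lambda>d. A l \<bullet> d)) (at (z k))" if "l \<in> S - {k}" for l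
  proof -
    have "z k - z l \<noteq> 0" using dist[OF k, of l] that by (auto simp: S_def)
    moreover have "((\<lambda>w. w - z l) has_derivative (\<lambda>d. d)) (at (z k))" by (auto intro!: derivative_eq_intros)
    ultimately have "((\<lambda>w. ln (cmod (w - z l))) has_derivative (\<lambda>d. (1 / cnj (z k - z l)) \<bullet> d)) (at (z k))"
      using has_derivative_compose ln_cmod_has_derivative by blast
    from has_derivative_minus[OF this] show ?thesis
      by (simp add: A_def divide_inverse ln_inverse)
  qed
  have d1: "((\<lambda>w. ln (1 / cmod ((z(k := w)) j - (z(k := w)) l))) has_derivative
      (\<lambda>d. (if j = k then A l else if l = k then A j else 0) \<bullet> d)) (at (z k))" if j: "j \<in> S" and l: "l \<in> S - {j}" for j l
  proof -
    consider "j = k" "l \<noteq> k" | "j \<noteq> k" "l = k" | "j \<noteq> k" "l \<noteq> k" using l by auto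
    then show ?thesis
    proof cases
      case 1
      then show ?thesis using fst_der[of l] l by simp
    next
      case 2
      have "cmod (z j - w) = cmod (w - z j)" for w by (rule norm_minus_commute)
      then show ?thesis using 2 fst_der[of j] j by simp
    qed simp
  qed
  have d2: "((\<lambda>w. g ((z(k := w)) j, (z(k := w)) l)) has_derivative
      (\<lambda>d. (if j = k then Gk l else if l = k then Gk j else 0) \<bullet> d)) (at (z k))" if j: "j \<in> S" and l: "l \<in> S - {j}" for j l
  proof -
    consider "j = k" "l \<noteq> k" | "j \<noteq> k" "l = k" | "j \<noteq> k" "l \<noteq> k" using l by auto
    then show ?thesis
    proof cases
      case 1
      have "((\<lambda>w. (w, z l)) has_derivative (\<lambda>d. (d, 0))) (at (z k))" by (auto intro!: derivative_eq_intros)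
      from has_derivative_compose[OF this g_der[OF zS[OF S(2)] zS[of l]]] show ?thesis using 1 l by (simp add: Gk_def)
    next
      case 2
      have "((\<lambda>w. (z j, w)) has_derivative (\<lambda>d. (0, d))) (at (z k))" by (auto intro!: derivative_eq_intros)
      from has_derivative_compose[OF this g_der[OF zS[OF j] zS[OF S(2)]]] show ?thesis using 2 by (simp add: Gk_def)
    qed simp
  qed
  have d3: "((\<lambda>w. g ((z(k := w)) j, (z(k := w)) j)) has_derivative (\<lambda>d. (if j = k then 2 * Gk k else 0) \<bullet> d)) (at (z k))" for j
    using diagonal_has_derivative[OF zS[OF S(2)], of UNIV] by (cases "j = k") (auto simp: Gk_def)
  have "((\<lambda>w. Ham g N (z(k := w))) has_derivative (\<lambda>d.
      1 / (2 * pi) * (\<Sum>j\<in>S. \<Sum>l\<in>S - {j}. (if j = k then A l else if l = k then A j else 0) \<bullet> d)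
      - (\<Sum>j\<in>S. \<Sum>l\<in>S - {j}. (if j = k then Gk l else if l = k then Gk j else 0) \<bullet> d)
      - (\<Sum>j\<in>S. (if j = k then 2 * Gk k else 0) \<bullet> d))) (at (z k))"
    unfolding Ham_def S_def[symmetric]
    by (intro has_derivative_diff has_derivative_mult_right has_derivative_sum d1 d2 d3)
  moreover have "1 / (2 * pi) * (\<Sum>j\<in>S. \<Sum>l\<in>S - {j}. (if j = k then A l else if l = k then A j else 0) \<bullet> d)
      - (\<Sum>j\<in>S. \<Sum>l\<in>S - {j}. (if j = k then Gk l else if l = k then Gk j else 0) \<bullet> d)
      - (\<Sum>j\<in>S. (if j = k then 2 * Gk k else 0) \<bullet> d)
    = - (of_real (1 / pi) * (\<Sum>l\<in>S. 1 / cnj (z k - z l)) + 2 * (\<Sum>l\<in>S. G (z k) (z l))) \<bullet> d" for d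
  proof -
    have s1: "(\<Sum>l\<in>S - {k}. A l) = - (\<Sum>l\<in>S. 1 / cnj (z k - z l))"
      using sum.remove[OF S, of "\<lambda>l. 1 / cnj (z k - z l)"] by (simp add: A_def sum_negf)
    have s2: "(\<Sum>l\<in>S - {k}. Gk l) = (\<Sum>l\<in>S. G (z k) (z l)) - Gk k"
      using sum.remove[OF S, of Gk] by (simp add: Gk_def)
    have s3: "(\<Sum>j\<in>S. if j = k then 2 * Gk k else 0) = 2 * Gk k" using S by (subst sum.delta) auto
    show ?thesis
      unfolding inner_sum_left[symmetric] sum_pairs_through_index[OF S] s1 s2 s3
      by (simp add: inner_complex_def algebra_simps)
  qed
  ultimately show ?thesis unfolding partial_gradient_def S_def by simp
qed

text \<open>The positions are \<open>N\<close>-periodic in the index because \<open>N\<close> shifts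
  make a full period; so the sum may start at any vortex. This makes all \<open>N\<close> equations
  instances of a single one.\<close>

lemma sum_rotate:
  fixes F :: "complex \<Rightarrow> complex"
  assumes u: "per u"
  shows "(\<Sum>l\<in>{1..N}. F (u (c + shift (l - 1)))) = (\<Sum>j<N. F (u (c + shift i + shift j)))"
proof -
  define f where "f m = F (u (c + shift m))" for m
  have fN: "f (m + N) = f m" for m
  proof -
    have e: "c + shift (m + N) = c + shift m + 2 * pi" using Npos by (simp add: shift_def field_simps)
    show ?thesis by (simp only: f_def e per_shift[OF u])
  qed
  have "(\<Sum>j<N. f (i + j)) = (\<Sum>j<N. f j)" for i
  proof (induction i)
    case (Suc i)
    have "(\<Sum>j<N. f (Suc i + j)) + f i = (\<Sum>j<Suc N. f (i + j))"
      by (subst sum.lessThan_Suc_shift) (simp add: add.commute)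
    also have "\<dots> = (\<Sum>j<N. f (i + j)) + f (i + N)" by simp
    finally show ?case using Suc fN[of i] by simp
  qed simp
  moreover have "shift (i + j) = shift i + shift j" for i j by (simp add: shift_def field_simps add_divide_distrib)
  moreover have "(\<Sum>l\<in>{1..N}. F (u (c + shift (l - 1)))) = (\<Sum>j<N. f j)"
    using sum.atLeast1_atMost_eq[of "\<lambda>l. F (u (c + shift (l - 1)))" N] by (simp add: f_def)
  ultimately show ?thesis unfolding f_def by (metis (no_types, lifting) add.assoc sum.cong)
qed

text \<open>Angular speed of the polygon of radius \<open>r\<close>, that is, \<open>2 * pi\<close>
  divided by the period.\<close>

definition rate :: "real \<Rightarrow> real" where "rate r = (real N - 1) / (2 * pi * r\<^sup>2)"

definition choreography :: "real \<Rightarrow> complex \<Rightarrow> (real \<Rightarrow> complex) \<Rightarrow> nat \<Rightarrow> real \<Rightarrow> complex" where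
  "choreography r a u k t = a + of_real r * u (rate r * t + shift (k - 1))"

lemma rate_period: "r > 0 \<Longrightarrow> rate r * (4 * pi\<^sup>2 * r\<^sup>2 / (real N - 1)) = 2 * pi"
  using Npos by (simp add: rate_def field_simps power2_eq_square)

lemma choreography_solves:
  assumes sol: "rescaled_solution C r a u" and r: "r > 0" and sub: "cball a0 (2 * R0) \<subseteq> \<Omega>"
  shows "HS_solution \<Omega> g N (choreography r a u)"
proof -
  have u: "per u" and rng: "\<And>t. a + of_real r * u t \<in> cball a0 (2 * R0)"
    and der: "\<And>t. (u has_vector_derivative \<i> * force a r u t) (at t)"
    and gap: "\<And>t j. j \<in> {1..<N} \<Longrightarrow> gap u j t \<noteq> 0"
    using sol unfolding rescaled_solution_def by auto
  let ?z = "choreography r a u"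
  have zB: "?z k t \<in> cball a0 (2 * R0)" for k t unfolding choreography_def by (rule rng)
  have lt: "?z j t \<noteq> ?z l t" if "j \<in> {1..N}" "l \<in> {1..N}" "j < l" for j l t
  proof -
    let ?s = "rate r * t + shift (j - 1)"
    have "l - j \<in> {1..<N}" using that by auto
    then have ne: "u ?s \<noteq> u (?s + shift (l - j))" using gap[of "l - j" ?s] by (simp add: gap_def)
    have e: "rate r * t + shift (l - 1) = ?s + shift (l - j)"
      using that Npos by (simp add: shift_def of_nat_diff field_simps)
    have "u ?s \<noteq> u (rate r * t + shift (l - 1))" unfolding e by (rule ne)
    then show ?thesis using r by (simp add: choreography_def)
  qed
  then have dist: "?z j t \<noteq> ?z l t" if "j \<in> {1..N}" "l \<in> {1..N}" "j \<noteq> l" for j l t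
    using that by (metis linorder_neqE_nat)
  show ?thesis
    unfolding HS_solution_def
  proof (intro conjI allI ballI)
    fix t
    show "(\<lambda>k. ?z k t) \<in> config_space \<Omega> N"
      unfolding config_space_def using zB sub dist by blast
    fix k assume k: "k \<in> {1..N}"
    let ?s = "rate r * t + shift (k - 1)"
    define v where "v = - (of_real (1 / pi) * (\<Sum>l\<in>{1..N}. 1 / cnj (?z k t - ?z l t)) + 2 * (\<Sum>l\<in>{1..N}. G (?z k t) (?z l t)))"
    have "partial_gradient (Ham g N) k (\<lambda>j. ?z j t) v"
      unfolding v_def by (rule Ham_partial_gradient[OF zB dist k])
    moreover have "(?z k has_vector_derivative - \<i> * v) (at t)"
    proof -
      have "((\<lambda>t. rate r * t + shift (k - 1)) has_vector_derivative rate r) (at t)"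
        by (auto intro!: derivative_eq_intros)
      from vector_diff_chain_at[OF this der]
      have "((\<lambda>t. u (rate r * t + shift (k - 1))) has_vector_derivative rate r *\<^sub>R (\<i> * force a r u ?s)) (at t)"
        by (simp add: o_def)
      from has_vector_derivative_add[OF has_vector_derivative_const bounded_linear.has_vector_derivative[OF bounded_linear_mult_right this]]
      have "(?z k has_vector_derivative of_real r * (rate r *\<^sub>R (\<i> * force a r u ?s))) (at t)"
        unfolding choreography_def by simp
      moreover have "of_real r * (rate r *\<^sub>R (\<i> * force a r u ?s)) = - \<i> * v"
      proof -
        have S1: "(\<Sum>l\<in>{1..N}. 1 / cnj (?z k t - ?z l t)) = of_real (1 / r) * (\<Sum>j\<in>{1..<N}. 1 / cnj (u ?s - u (?s + shift j)))"
        proof -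
          have "(\<Sum>l\<in>{1..N}. 1 / cnj (?z k t - ?z l t)) = (\<Sum>l\<in>{1..N}. of_real (1 / r) * (1 / cnj (u ?s - u (rate r * t + shift (l - 1)))))"
            using r by (intro sum.cong refl) (simp add: choreography_def flip: right_diff_distrib)
          also have "\<dots> = (\<Sum>j<N. of_real (1 / r) * (1 / cnj (u ?s - u (?s + shift j))))"
            by (rule sum_rotate[OF u, of "\<lambda>w. of_real (1 / r) * (1 / cnj (u ?s - w))"])
          \<comment> \<open>The extra term \<open>j = 0\<close> is a division by zero and
            contributes 0.\<close>
          also have "{..<N} = insert 0 {1..<N}" using N2 by auto
          finally show ?thesis by (simp add: shift_def sum_distrib_left)
        qed
        have S2: "(\<Sum>l\<in>{1..N}. G (?z k t) (?z l t)) = gsum a r u ?s"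
          unfolding choreography_def gsum_def
          by (rule sum_rotate[OF u, of "\<lambda>w. G (a + of_real r * u ?s) (a + of_real r * w)"])
        \<comment> \<open>The single time scale \<open>rate r\<close> has to match the prefactors of
          both the singular and the regular part.\<close>
        have c1: "r * rate r * (2 / (real N - 1)) = 1 / pi * (1 / r)"
          using r Npos by (simp add: rate_def field_simps power2_eq_square)
        have c2: "r * rate r * coupling r = 2" using r Npos by (simp add: rate_def coupling_def field_simps power2_eq_square)
        have "of_real r * (rate r *\<^sub>R (\<i> * force a r u ?s)) = \<i> * (of_real (r * rate r * (2 / (real N - 1))) * (\<Sum>j\<in>{1..<N}. 1 / cnj (u ?s - u (?s + shift j)))
            + of_real (r * rate r * coupling r) * gsum a r u ?s)"
          unfolding force_def vortex_field_alt gap_def scaleR_conv_of_real by (simp add: algebra_simps)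
        also have "\<dots> = - \<i> * v"
          unfolding c1 c2 v_def S1 S2 by (simp add: algebra_simps)
        finally show ?thesis .
      qed
      ultimately show ?thesis by simp
    qed
    ultimately show "\<exists>v. partial_gradient (Ham g N) k (\<lambda>j. ?z j t) v \<and> (?z k has_vector_derivative - \<i> * v) (at t)" by blast
  qed
qed

text \<open>A smaller period would be a translation by some \<open>q\<close> strictly between 0 and
  \<open>2 * pi\<close> that fixes \<open>u\<close>, hence multiply the first Fourier coefficient by
  \<open>cis q\<close>. This coefficient is nonzero because \<open>u\<close> is within 1/2 of
  \<open>cis\<close>.\<close>

lemma choreography_minimal_period:
  assumes sol: "rescaled_solution C r a u" and r: "r > 0"
  shows "minimal_period N (choreography r a u) (4 * pi\<^sup>2 * r\<^sup>2 / (real N - 1))"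
proof -
  let ?T = "4 * pi\<^sup>2 * r\<^sup>2 / (real N - 1)"
  have u: "per u" and near: "\<And>t. cmod (u t - cis t) \<le> 1 / 2" using sol unfolding rescaled_solution_def by auto
  have rate0: "rate r > 0" using r Npos by (simp add: rate_def)
  have T0: "?T > 0" using r Npos by simp
  have "choreography r a u k (t + ?T) = choreography r a u k t" for k t
    using per_shift[OF u, of "rate r * t + shift (k - 1)"] rate_period[OF r]
    unfolding choreography_def distrib_left by (simp add: add_ac)
  moreover have False if T': "0 < T'" "T' < ?T" and p: "\<forall>t. \<forall>k\<in>{1..N}. choreography r a u k (t + T') = choreography r a u k t" for T'
  proof -
    define q where "q = rate r * T'"
    have q: "0 < q" "q < 2 * pi" using rate0 T' mult_strict_left_mono[OF T'(2) rate0] rate_period[OF r] by (auto simp: q_def)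
    have "u (s + q) = u s" for s
    proof -
      have one: "1 \<in> {1..N}" using N2 by auto
      have "choreography r a u 1 (s / rate r + T') = choreography r a u 1 (s / rate r)" using p one by blast
      then show ?thesis using r rate0 by (simp add: choreography_def shift_def q_def distrib_left)
    qed
    then have "fc u 1 = cis q * fc u 1" using fc_translate[OF u, of q 1] by simp
    moreover have "fc u 1 \<noteq> 0"
    proof
      assume z: "fc u 1 = 0"
      have "fc (\<lambda>t. u t - cis t) 1 = fc u 1 - 1" using fc_diff[OF u per_cis1, of 1] fc_cis[of 1 1] by simp
      moreover have "cmod (fc (\<lambda>t. u t - cis t) 1) \<le> 1 / 2" by (rule norm_fc_le[OF per_diff[OF u per_cis1] near])
      ultimately show False using z by simp
    qed
    ultimately have "cis q = 1" by simp
    then have "cos q = 1" by (simp add: complex_eq_iff)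
    then obtain n :: int where n: "q = of_int n * 2 * pi" using cos_one_2pi_int by blast
    have "0 < real_of_int n" "real_of_int n < 1" using q n by (simp_all add: zero_less_mult_iff)
    then have "0 < n" "n < 1" by simp_all
    then show False by simp
  qed
  ultimately show ?thesis unfolding minimal_period_def using T0 by blast
qed

lemma H1_dist_sq_rescaled:
  assumes sol: "rescaled_solution C r a u"
  shows "\<bar>H1_dist_sq u cis\<bar> \<le> 2 * (C * r)\<^sup>2 * (2 * pi)"
proof -
  have u: "per u" and n1: "\<And>t. cmod (u t - cis t) \<le> C * r" and n2: "\<And>t. cmod (force a r u t - cis t) \<le> C * r"
    and der: "\<And>t. (u has_vector_derivative \<i> * force a r u t) (at t)"
    and gap: "\<And>t j. j \<in> {1..<N} \<Longrightarrow> gap u j t \<noteq> 0"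
    using sol unfolding rescaled_solution_def by auto
  have pforce: "per (force a r u)"
  proof -
    have "per (vortex_field u)" by (rule per_vortex_field[OF u]) (use gap in \<open>auto simp: gap_def\<close>)
    then show ?thesis unfolding force_def by (intro per_add per_mult[OF per_const] per_gsum u)
  qed
  have dcis: "(cis has_vector_derivative \<i> * cis t) (at t)" for t
    by (auto intro!: derivative_eq_intros simp: has_vector_derivative_def cis_conv_exp mult_ac scaleR_conv_of_real)
  have vd: "vector_derivative u (at t) = \<i> * force a r u t" "vector_derivative cis (at t) = \<i> * cis t" for t
    by (rule vector_derivative_at[OF der] vector_derivative_at[OF dcis])+
  let ?f = "\<lambda>t. (cmod (u t - cis t))\<^sup>2 + (cmod (\<i> * force a r u t - \<i> * cis t))\<^sup>2"
  have "norm (integral {0..2*pi} ?f) \<le> 2 * (C * r)\<^sup>2 * (2 * pi - 0)"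
  proof (rule integral_bound)
    show "continuous_on {0..2*pi} ?f" by (intro continuous_intros per_cont u pforce)
    fix t
    have "cmod (\<i> * force a r u t - \<i> * cis t) = cmod (force a r u t - cis t)"
      by (simp add: norm_mult flip: right_diff_distrib)
    then have "?f t \<le> (C * r)\<^sup>2 + (C * r)\<^sup>2" using n1[of t] n2[of t] by (intro add_mono) (auto intro: power_mono)
    then show "norm (?f t) \<le> 2 * (C * r)\<^sup>2" by simp
  qed simp
  then show ?thesis unfolding H1_dist_sq_def vd by simp
qed

end

text \<open>The admissible range of \<open>r\<close> shrinks with \<open>\<epsilon>\<close>, yet one
  choice for each \<open>r\<close> must serve all \<open>\<epsilon>\<close>. Choosing a centre whose
  distance to \<open>a0\<close> is within \<open>r\<close> of the infimum does so, even if the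
  infimum is not attained.\<close>

lemma select_converging_to:
  fixes Q :: "real \<Rightarrow> 'a::metric_space \<Rightarrow> 'b \<Rightarrow> bool"
  assumes ex: "\<And>\<epsilon>. \<epsilon> > 0 \<Longrightarrow> \<exists>r\<epsilon>>0. \<forall>r. 0 < r \<and> r \<le> r\<epsilon> \<longrightarrow> (\<exists>a u. dist a a0 \<le> \<epsilon> \<and> Q r a u)"
  obtains r0 A U where "r0 > 0" "\<forall>r. 0 < r \<and> r \<le> r0 \<longrightarrow> Q r (A r) (U r)" "(A \<longlongrightarrow> a0) (at_right 0)"
proof -
  obtain r0 where r0: "r0 > 0" and sol: "\<And>r. 0 < r \<Longrightarrow> r \<le> r0 \<Longrightarrow> \<exists>a u. Q r a u"
    using ex[of 1] by fastforce
  define D where "D r = {dist a a0 | a u. Q r a u}" for r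
  have bdd: "bdd_below (D r)" for r by (rule bdd_belowI[of _ 0]) (auto simp: D_def)
  have near: "\<exists>a u. Q r a u \<and> dist a a0 < Inf (D r) + r" if r: "0 < r" "r \<le> r0" for r
  proof -
    have "D r \<noteq> {}" using sol[OF r] by (auto simp: D_def)
    then obtain d where "d \<in> D r" "d < Inf (D r) + r" using cInf_lessD[of "D r" "Inf (D r) + r"] r by auto
    then show ?thesis by (auto simp: D_def)
  qed
  then obtain A U where AU: "\<And>r. 0 < r \<Longrightarrow> r \<le> r0 \<Longrightarrow> Q r (A r) (U r) \<and> dist (A r) a0 < Inf (D r) + r"
    by metis
  have "(A \<longlongrightarrow> a0) (at_right 0)"
  proof (rule tendstoI)
    fix \<epsilon> :: real assume e: "\<epsilon> > 0"
    obtain r1 where r1: "r1 > 0" and s1: "\<And>r. 0 < r \<Longrightarrow> r \<le> r1 \<Longrightarrow> \<exists>a u. dist a a0 \<le> \<epsilon> / 2 \<and> Q r a u"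
      using ex[of "\<epsilon> / 2"] e by auto
    have "dist (A r) a0 < \<epsilon>" if r: "0 < r" "r < min r0 (min r1 (\<epsilon> / 2))" for r
    proof -
      obtain a u where "dist a a0 \<le> \<epsilon> / 2" "Q r a u" using s1[of r] r by auto
      then have "dist a a0 \<in> D r" by (auto simp: D_def)
      from cInf_lower[OF this bdd] have "Inf (D r) \<le> \<epsilon> / 2" using \<open>dist a a0 \<le> \<epsilon> / 2\<close> by linarith
      then show ?thesis using AU[of r] r by auto
    qed
    then show "\<forall>\<^sub>F r in at_right 0. dist (A r) a0 < \<epsilon>"
      unfolding eventually_at_right_field using r0 r1 e
      by (intro exI[of _ "min r0 (min r1 (\<epsilon> / 2))"]) auto
  qed
  then show thesis using that[OF r0] AU by blast
qed

theorem theorem2p1: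
  fixes \<Omega> :: "complex set" and N :: nat and g :: "complex \<times> complex \<Rightarrow> real" and a0 :: complex
  assumes "open \<Omega>" and "connected \<Omega>" and "\<Omega> \<noteq> {}"
    and "N \<ge> 2"
    and "C2_upto (closure \<Omega> \<times> \<Omega>) g"
    and "\<And>w z. w \<in> \<Omega> \<Longrightarrow> z \<in> \<Omega> \<Longrightarrow> g (w, z) = g (z, w)"
    and "stable_critical_point \<Omega> (\<lambda>z. g (z, z)) a0"
  shows "\<exists>r0>0. \<exists>zr :: real \<Rightarrow> nat \<Rightarrow> real \<Rightarrow> complex. \<exists>ar :: real \<Rightarrow> complex.
     (\<forall>r. 0 < r \<and> r \<le> r0 \<longrightarrow>
        (let T = 4 * pi\<^sup>2 * r\<^sup>2 / (real N - 1) in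
           HS_solution \<Omega> g N (zr r) \<and>
           minimal_period N (zr r) T \<and>
           (\<forall>k\<in>{1..N}. \<forall>t. zr r k t = zr r 1 (t + (real k - 1) * T / real N)) \<and>
           ar r \<in> \<Omega>)) \<and>
     (ar \<longlongrightarrow> a0) (at_right 0) \<and>
     ((\<lambda>r. H1_dist_sq
             (\<lambda>t. (zr r 1 (4 * pi\<^sup>2 * r\<^sup>2 / (real N - 1) * t / (2 * pi)) - ar r) / complex_of_real r)
             (\<lambda>t. cis t)) \<longlongrightarrow> 0) (at_right 0)"
proof -
  let ?h = "\<lambda>z. g (z, z)"
  have a0: "a0 \<in> \<Omega>" and h0: "(?h has_derivative (\<lambda>_. 0)) (at a0)"
    using assms(7) unfolding stable_critical_point_def critical_point_def by auto
  obtain e where e: "e > 0" "\<forall>z\<in>ball a0 e. z \<noteq> a0 \<longrightarrow> \<not> critical_point \<Omega> ?h z"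
    using assms(7) unfolding stable_critical_point_def by blast
  obtain p :: int where nontriv: "\<not> trivial_group (relative_homology_group p (top_of_set {z \<in> \<Omega>. ?h z \<le> ?h a0})
      ({z \<in> \<Omega>. ?h z \<le> ?h a0} - {a0}))"
    using assms(7) unfolding stable_critical_point_def sublevel_def by blast
  obtain R0 G LG MG where R0: "R0 > 0" and sub: "cball a0 (2 * R0) \<subseteq> \<Omega>"
    and lip: "\<forall>w z w' z'. cmod (G w z - G w' z') \<le> LG * (cmod (w - w') + cmod (z - z'))"
    and bnd: "\<forall>w z. cmod (G w z) \<le> MG"
    and gder: "\<forall>w\<in>cball a0 (2 * R0). \<forall>z\<in>cball a0 (2 * R0).
      (g has_derivative (\<lambda>d. G w z \<bullet> fst d + G z w \<bullet> snd d)) (at (w, z))"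
    by (rule C2_symmetric_gradient[OF assms(1) a0 assms(5,6)])
  interpret ngon_potential N G LG MG g a0 R0
    by unfold_locales (use assms(4) lip bnd R0 gder in auto)
  have conth: "continuous_on \<Omega> ?h"
  proof -
    have "continuous_on (closure \<Omega> \<times> \<Omega>) g" using assms(5) unfolding C2_upto_def by blast
    then show ?thesis by (rule continuous_on_compose2) (use closure_subset in \<open>auto intro!: continuous_intros\<close>)
  qed
  have crit: "G a0 a0 = 0"
  proof -
    have "a0 \<in> cball a0 (2 * R0)" using R0 by simp
    from fun_cong[OF has_derivative_unique[OF diagonal_has_derivative[OF this] h0], of "2 * G a0 a0"]
    have "(2 * G a0 a0) \<bullet> (2 * G a0 a0) = 0" .
    then show ?thesis by simp
  qed
  \<comment> \<open>The zeros of \<open>G z z\<close> are the critical points of \<open>h\<close>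
    only where \<open>G\<close> is the true gradient, so the isolating ball is cut down to that
    region.\<close>
  define e1 where "e1 = min e R0"
  have e1: "e1 > 0" using e R0 by (simp add: e1_def)
  have isol: "G z z \<noteq> 0" if "z \<in> ball a0 e1" "z \<noteq> a0" for z
  proof
    assume z: "G z z = 0"
    have zb: "z \<in> cball a0 (2 * R0)" "z \<in> ball a0 e" using that R0 by (auto simp: e1_def)
    have "(?h has_derivative (\<lambda>_. 0)) (at z)" using diagonal_has_derivative[OF zb(1), of UNIV] z by simp
    then have "critical_point \<Omega> ?h z" using zb sub by (auto simp: critical_point_def)
    then show False using e zb that by blast
  qed
  have "\<exists>C. \<forall>\<epsilon>>0. \<exists>r\<epsilon>>0. \<forall>r. 0 < r \<and> r \<le> r\<epsilon> \<longrightarrow> (\<exists>a u. dist a a0 \<le> \<epsilon> \<and> rescaled_solution C r a u)"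
    by (rule rescaled_solutions_near_critical_point[OF sub conth crit e1 _ nontriv]) (rule isol)
  then obtain C where "\<forall>\<epsilon>>0. \<exists>r\<epsilon>>0. \<forall>r. 0 < r \<and> r \<le> r\<epsilon> \<longrightarrow> (\<exists>a u. dist a a0 \<le> \<epsilon> \<and> rescaled_solution C r a u)" ..
  then have C: "\<exists>r\<epsilon>>0. \<forall>r. 0 < r \<and> r \<le> r\<epsilon> \<longrightarrow> (\<exists>a u. dist a a0 \<le> \<epsilon> \<and> rescaled_solution C r a u)" if "\<epsilon> > 0" for \<epsilon>
    using that by (elim allE[of _ \<epsilon>] impE)
  obtain r0 A U where r0: "r0 > 0" and sol: "\<forall>r. 0 < r \<and> r \<le> r0 \<longrightarrow> rescaled_solution C r (A r) (U r)"
    and A: "(A \<longlongrightarrow> a0) (at_right 0)"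
    by (rule select_converging_to[of a0 "rescaled_solution C", OF C])
  define zr where "zr r = choreography r (A r) (U r)" for r
  have chor: "zr r k t = zr r 1 (t + (real k - 1) * (4 * pi\<^sup>2 * r\<^sup>2 / (real N - 1)) / real N)"
    if r: "0 < r" and k: "k \<in> {1..N}" for r k t
  proof -
    let ?T = "4 * pi\<^sup>2 * r\<^sup>2 / (real N - 1)"
    have "rate r * (t + (real k - 1) * ?T / real N) = rate r * t + (real k - 1) * (rate r * ?T) / real N"
      by (simp add: algebra_simps)
    also have "\<dots> = rate r * t + shift (k - 1)"
      unfolding rate_period[OF r] using k by (simp add: shift_def of_nat_diff)
    finally have e: "rate r * (t + (real k - 1) * ?T / real N) = rate r * t + shift (k - 1)" .
    show ?thesis unfolding zr_def choreography_def e by (simp add: shift_def)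
  qed
  have resc: "(\<lambda>t. (zr r 1 (4 * pi\<^sup>2 * r\<^sup>2 / (real N - 1) * t / (2 * pi)) - A r) / complex_of_real r) = U r"
    if r: "0 < r" for r
  proof
    fix t
    have "rate r * (4 * pi\<^sup>2 * r\<^sup>2 / (real N - 1) * t / (2 * pi)) = (rate r * (4 * pi\<^sup>2 * r\<^sup>2 / (real N - 1))) * t / (2 * pi)"
      by simp
    then have e: "rate r * (4 * pi\<^sup>2 * r\<^sup>2 / (real N - 1) * t / (2 * pi)) = t" unfolding rate_period[OF r] by simp
    show "(zr r 1 (4 * pi\<^sup>2 * r\<^sup>2 / (real N - 1) * t / (2 * pi)) - A r) / complex_of_real r = U r t"
      unfolding zr_def choreography_def e using r by (simp add: shift_def)
  qed
  have H1: "((\<lambda>r. H1_dist_sq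
             (\<lambda>t. (zr r 1 (4 * pi\<^sup>2 * r\<^sup>2 / (real N - 1) * t / (2 * pi)) - A r) / complex_of_real r)
             (\<lambda>t. cis t)) \<longlongrightarrow> 0) (at_right 0)"
  proof (rule Lim_null_comparison)
    show "\<forall>\<^sub>F r in at_right 0. norm (H1_dist_sq
             (\<lambda>t. (zr r 1 (4 * pi\<^sup>2 * r\<^sup>2 / (real N - 1) * t / (2 * pi)) - A r) / complex_of_real r)
             (\<lambda>t. cis t)) \<le> 2 * (C * r)\<^sup>2 * (2 * pi)"
      unfolding eventually_at_right_field
    proof (intro exI[of _ r0] conjI allI impI)
      fix r assume r: "0 < r" "r < r0"
      show "norm (H1_dist_sq
             (\<lambda>t. (zr r 1 (4 * pi\<^sup>2 * r\<^sup>2 / (real N - 1) * t / (2 * pi)) - A r) / complex_of_real r)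
             (\<lambda>t. cis t)) \<le> 2 * (C * r)\<^sup>2 * (2 * pi)"
        unfolding resc[OF r(1)] using H1_dist_sq_rescaled[OF sol[rule_format, of r]] r by simp
    qed (use r0 in auto)
    have "((\<lambda>r. 2 * (C * r)\<^sup>2 * (2 * pi)) \<longlongrightarrow> 2 * (C * 0)\<^sup>2 * (2 * pi)) (at_right 0)" by (intro tendsto_intros)
    then show "((\<lambda>r. 2 * (C * r)\<^sup>2 * (2 * pi)) \<longlongrightarrow> 0) (at_right 0)" by simp
  qed
  have main: "\<forall>r. 0 < r \<and> r \<le> r0 \<longrightarrow>
        (let T = 4 * pi\<^sup>2 * r\<^sup>2 / (real N - 1) in
           HS_solution \<Omega> g N (zr r) \<and>
           minimal_period N (zr r) T \<and>
           (\<forall>k\<in>{1..N}. \<forall>t. zr r k t = zr r 1 (t + (real k - 1) * T / real N)) \<and>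
           A r \<in> \<Omega>)"
  proof (intro allI impI, unfold Let_def, elim conjE)
    fix r assume r: "0 < r" "r \<le> r0"
    have s: "rescaled_solution C r (A r) (U r)" using sol r by blast
    have "A r \<in> cball a0 R0" using s unfolding rescaled_solution_def by blast
    then have "A r \<in> \<Omega>" using sub R0 by auto
    moreover have "HS_solution \<Omega> g N (zr r)" unfolding zr_def by (rule choreography_solves[OF s r(1) sub])
    moreover have "minimal_period N (zr r) (4 * pi\<^sup>2 * r\<^sup>2 / (real N - 1))"
      unfolding zr_def by (rule choreography_minimal_period[OF s r(1)])
    ultimately show "HS_solution \<Omega> g N (zr r) \<and> minimal_period N (zr r) (4 * pi\<^sup>2 * r\<^sup>2 / (real N - 1)) \<and>
        (\<forall>k\<in>{1..N}. \<forall>t. zr r k t = zr r 1 (t + (real k - 1) * (4 * pi\<^sup>2 * r\<^sup>2 / (real N - 1)) / real N)) \<and> A r \<in> \<Omega>"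
      using chor[OF r(1)] by blast
  qed
  show ?thesis
    by (rule exI[of _ r0], rule conjI[OF r0], rule exI[of _ zr], rule exI[of _ A], intro conjI main A H1)
qed

end
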